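(* Let $\beta>1$, $q>0$, and let $X$ be a Lévy process on $\mathbb{R}$ for which there exist $\mu_-<-\beta$ and $\mu_+>0$ such that for all $\gamma\in[\mu_-,\mu_+]$, $\mathbb{E}[e^{-\gamma X_1}]<\infty$ and $q+\psi(i\gamma)>0$. Assume that the Wiener–Hopf factors admit the representations $\phi^\pm_q=a^\pm_q+\phi^{\pm\pm}_q$ with $a^\pm_q\ge0$ and $$|\phi^{++}_q(\xi)|\le C_+(q)(1+|\xi|)^{-\nu_+},\ \Im\xi\ge\mu_-;\qquad |\phi^{--}_q(\xi)|\le C_-(q)(1+|\xi|)^{-\nu_-},\ \Im\xi\le\mu_+,$$ where $\nu_\pm>0$ and $C_\pm(q)>0$ are independent of $\xi$. Let $f(x_1,x_2)=(e^{\beta x_1}-e^{x_2})_+\mathbf{1}_{(-\infty,x_2]}(x_1)$. Then, for $x_1\le x_2$ with $x_2\ge0$, and any $0<\omega_1<\mu_+$, $\mu_-<\omega_-<-\beta$, $$\tilde V(f;q,x_1,x_2)=I_1(q,x_1,x_2)+q^{-1}\sum_{j=2,3}I_j(q,x_1,x_2),$$ where $$I_1(q,x_1,x_2)=\frac{1}{2\pi}\int_{\Im\xi_1=\omega_1}d\xi_1\,\frac{e^{i(x_1-x_2)\xi_1}}{q+\psi(\xi_1)}\left(\frac{e^{x_2\beta}}{\beta-i\xi_1}+\beta\frac{e^{x_2(1+i\xi_1(1-1/\beta))}}{(\beta-i\xi_1)(-i\xi_1)}-\frac{e^{x_2}}{-i\xi_1}\right),$$ $$I_2(q,x_1,x_2)=a^-_q\frac{e^{x_2}}{2\pi}\int_{\Im\eta=\omega_-}d\eta\,e^{i(x_1-x_2)\eta}\frac{\phi^{++}_q(\eta)}{i\eta(1-i\eta)},$$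 $$I_3(q,x_1,x_2)=\frac{1}{(2\pi)^2}\int_{\Im\eta=\omega_-}d\eta\,e^{i(x_1-x_2)\eta}\phi^{++}_q(\eta)\int_{\Im\xi_1=\omega_1}d\xi_1\,e^{-ix_2\xi_1}e^{ix_2\xi_1}\frac{\phi^{--}_q(\xi_1)}{i(\eta-\xi_1)}\,e^{-ix_2\xi_1}\left[\frac{e^{\beta x_2}}{i\eta-\beta}+\frac{\beta e^{(1+i\xi_1(1-1/\beta))x_2}(1-i\xi_1/\beta)}{(\beta-i\xi_1)(-i\xi_1)(i\eta-1-i\xi_1(1-1/\beta))}-\frac{e^{x_2}(1-i\xi_1)}{(-i\xi_1)(i\eta-1)}\right].$$
   Context: $X=(X_t)_{t\ge0}$ is a one-dimensional Lévy process with $X_0=0$, expectation $\mathbb{E}$, and characteristic exponent $\psi$ defined by $\mathbb{E}[e^{i\xi X_t}]=e^{-t\psi(\xi)}$. Put $\bar X_t=\sup_{0\le s\le t}X_s$, $\underline X_t=\inf_{0\le s\le t}X_s$, and $(a)_+=\max\{a,0\}$. For $q>0$, $T_q$ is an exponentially distributed random variable of mean $1/q$ independent of $X$. The Wiener–Hopf factors are $\phi^+_q(\xi)=\mathbb{E}[e^{i\xi\bar X_{T_q}}]$ and $\phi^-_q(\xi)=\mathbb{E}[e^{i\xi\underline X_{T_q}}]$; they satisfy $\phi^+_q\phi^-_q=q/(q+\psi)$, and under the stated moment conditions $\phi^+_q$ (resp. $\phi^-_q$) continues analytically to $\{\Im\xi\ge\mu_-\}$ (resp. $\{\Im\xi\le\mu_+\}$),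 i.e. analytic in the interior and continuous up to the boundary. $V(f;T;x_1,x_2)=\mathbb{E}[f(x_1+X_T,\max\{x_2,x_1+\bar X_T\})]$ and $\tilde V(f;q,x_1,x_2)=\int_0^\infty e^{-qT}V(f;T;x_1,x_2)\,dT$ (the value, in Laplace space, of the option to exchange the supremum $e^{\bar X_T}$ for the power $e^{\beta X_T}$).
   Formalization: In I_2, e^{x_2}/(iη(1−iη)) is corrected to e^{βx_2}/(iη−β)−e^{x_2}/(iη−1); in I_3 the net factor e^{−ix_2ξ_1} is removed; the case x_1=x_2>0 with a^+_q a^-_q>0 is excluded; line integrals are limits of symmetric truncations. *)

theory Defs
  imports "HOL-Probability.Probability"
begin

text \<open>Only the values of \<open>X\<close> at times \<open>t \<ge> 0\<close> matter. All paths (not just almost all)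
  start at 0 and are cadlag, so that running extrema are measurable without completing \<open>M\<close>;
  stochastic continuity is then automatic.\<close>

locale levy_process = prob_space M for M :: "'a measure" +
  fixes X :: "real \<Rightarrow> 'a \<Rightarrow> real"
  assumes measurable_X: "0 \<le> t \<Longrightarrow> X t \<in> borel_measurable M"
    and start_zero: "\<omega> \<in> space M \<Longrightarrow> X 0 \<omega> = 0"
    and indep_increments:
      "\<And>(t :: nat \<Rightarrow> real) n. 0 \<le> t 0 \<Longrightarrow> (\<And>i. i < n \<Longrightarrow> t i \<le> t (Suc i)) \<Longrightarrow>
         indep_vars (\<lambda>_. borel) (\<lambda>i \<omega>. X (t (Suc i)) \<omega> - X (t i) \<omega>) {..<n}"
    and stationary_increments:
      "0 \<le> s \<Longrightarrow> 0 \<le> h \<Longrightarrow>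
         distr M borel (\<lambda>\<omega>. X (s + h) \<omega> - X s \<omega>) = distr M borel (X h)"
    and right_continuous: "\<omega> \<in> space M \<Longrightarrow> 0 \<le> t \<Longrightarrow> ((\<lambda>s. X s \<omega>) \<longlongrightarrow> X t \<omega>) (at_right t)"
    and left_limits: "\<omega> \<in> space M \<Longrightarrow> 0 < t \<Longrightarrow> \<exists>l. ((\<lambda>s. X s \<omega>) \<longlongrightarrow> l) (at_left t)"

definition running_sup :: "(real \<Rightarrow> 'a \<Rightarrow> real) \<Rightarrow> real \<Rightarrow> 'a \<Rightarrow> real" where
  "running_sup X t \<omega> = (SUP s\<in>{0..t}. X s \<omega>)"

definition running_inf :: "(real \<Rightarrow> 'a \<Rightarrow> real) \<Rightarrow> real \<Rightarrow> 'a \<Rightarrow> real" where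
  "running_inf X t \<omega> = (INF s\<in>{0..t}. X s \<omega>)"

text \<open>The defining identity \<open>E[exp (i \<xi> X t)] = exp (- t \<psi> \<xi>)\<close> for every complex \<open>\<xi>\<close> at which
  \<open>exp (i \<xi> X 1)\<close> is integrable (in particular for all real \<open>\<xi>\<close>). Since it is required for all
  \<open>t \<ge> 0\<close>, it determines \<open>\<psi> \<xi>\<close> uniquely at each such \<open>\<xi>\<close>.\<close>

definition characteristic_exponent ::
    "'a measure \<Rightarrow> (real \<Rightarrow> 'a \<Rightarrow> real) \<Rightarrow> (complex \<Rightarrow> complex) \<Rightarrow> bool" where
  "characteristic_exponent M X \<psi> \<longleftrightarrow>
     (\<forall>\<xi>. integrable M (\<lambda>\<omega>. exp (- Im \<xi> * X 1 \<omega>)) \<longrightarrow>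
        (\<forall>t\<ge>0. (LINT \<omega>|M. exp (\<i> * \<xi> * complex_of_real (X t \<omega>)))
               = exp (- complex_of_real t * \<psi> \<xi>)))"

definition independent_exponential_time ::
    "'a measure \<Rightarrow> (real \<Rightarrow> 'a \<Rightarrow> real) \<Rightarrow> real \<Rightarrow> ('a \<Rightarrow> real) \<Rightarrow> bool" where
  "independent_exponential_time M X q T \<longleftrightarrow>
     distributed M lborel T (exponential_density q) \<and>
     prob_space.indep_set M {T -` B \<inter> space M | B. B \<in> sets borel}
       (sigma_sets (space M) {X t -` B \<inter> space M | t B. 0 \<le> t \<and> B \<in> sets borel})"

text \<open>The Wiener--Hopf factors at complex arguments. Wherever the expectation converges absolutely
  (on the closed half-planes of the theorem it does, under the moment conditions there) it is the
  continuation of the factor from the real line: continuous, and analytic in the interior.\<close>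

definition wh_plus :: "'a measure \<Rightarrow> (real \<Rightarrow> 'a \<Rightarrow> real) \<Rightarrow> ('a \<Rightarrow> real) \<Rightarrow> complex \<Rightarrow> complex" where
  "wh_plus M X T \<xi> = (LINT \<omega>|M. exp (\<i> * \<xi> * complex_of_real (running_sup X (T \<omega>) \<omega>)))"

definition wh_minus :: "'a measure \<Rightarrow> (real \<Rightarrow> 'a \<Rightarrow> real) \<Rightarrow> ('a \<Rightarrow> real) \<Rightarrow> complex \<Rightarrow> complex" where
  "wh_minus M X T \<xi> = (LINT \<omega>|M. exp (\<i> * \<xi> * complex_of_real (running_inf X (T \<omega>) \<omega>)))"

definition option_value ::
    "'a measure \<Rightarrow> (real \<Rightarrow> 'a \<Rightarrow> real) \<Rightarrow> (real \<Rightarrow> real \<Rightarrow> real) \<Rightarrow> real \<Rightarrow> real \<Rightarrow> real \<Rightarrow> real" where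
  "option_value M X f T x1 x2 =
     (LINT \<omega>|M. f (x1 + X T \<omega>) (max x2 (x1 + running_sup X T \<omega>)))"

definition laplace_value ::
    "'a measure \<Rightarrow> (real \<Rightarrow> 'a \<Rightarrow> real) \<Rightarrow> (real \<Rightarrow> real \<Rightarrow> real) \<Rightarrow> real \<Rightarrow> real \<Rightarrow> real \<Rightarrow> real" where
  "laplace_value M X f q x1 x2 =
     (LINT T:{0..}|lborel. exp (- q * T) * option_value M X f T x1 x2)"

definition exchange_payoff :: "real \<Rightarrow> real \<Rightarrow> real \<Rightarrow> real" where
  "exchange_payoff \<beta> x1 x2 = max (exp (\<beta> * x1) - exp x2) 0 * indicator {..x2} x1"

text \<open>The integral over the line \<open>Im \<xi> = w\<close>, from left to right, as the limit of symmetric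
  truncations. It agrees with the Lebesgue integral when that exists, but the integral \<open>I1\<close> below
  converges only conditionally when \<open>X\<close> is at 0 at an exponential time with positive probability
  (compound Poisson case). In that case, for \<open>x1 = x2 > 0\<close>, the limit exists but yields half the
  jump of \<open>f(\<cdot>, x2)\<close> at \<open>x2\<close> in place of its value, so the theorem excludes this one
  configuration.\<close>

definition line_integral :: "real \<Rightarrow> (complex \<Rightarrow> complex) \<Rightarrow> complex" where
  "line_integral w g = Lim at_top (\<lambda>R. LINT u:{-R..R}|lborel. g (Complex u w))"

definition I1 ::
    "(complex \<Rightarrow> complex) \<Rightarrow> real \<Rightarrow> real \<Rightarrow> real \<Rightarrow> real \<Rightarrow> real \<Rightarrow> complex" where
  "I1 \<psi> \<beta> w1 q x1 x2 = 1 / (2 * pi) * line_integral w1 (\<lambda>\<xi>.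
     exp (\<i> * (x1 - x2) * \<xi>) / (q + \<psi> \<xi>) *
     (exp (x2 * \<beta>) / (\<beta> - \<i> * \<xi>)
      + \<beta> * (exp (x2 * (1 + \<i> * \<xi> * (1 - 1 / \<beta>))) / ((\<beta> - \<i> * \<xi>) * (- \<i> * \<xi>)))
      - exp x2 / (- \<i> * \<xi>)))"

text \<open>The last factor of the integrand times \<open>exp (- i x2 \<eta>)\<close> is the Fourier transform of
  \<open>1{y > x2} (f(y, y) - f(y, x2))\<close>. For the exchange payoff \<open>f(y, x2) = 0\<close> when \<open>y > x2\<close>, so this
  is the transform of \<open>1{y > x2} (exp (\<beta> y) - exp y)\<close>. The source prints
  \<open>exp x2 / (i \<eta> (1 - i \<eta>))\<close> in its place, which belongs to
  \<open>1{y > x2} (exp x2 - exp y)\<close>, that is, to the payoff without the indicator of \<open>x1 \<le> x2\<close>.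
  With it the identity fails: for \<open>X t = t\<close>, \<open>x1 = x2 = 0\<close>, \<open>q > \<beta>\<close> the value is
  \<open>1 / (q - \<beta>) - 1 / (q - 1) > 0\<close>, while the printed right-hand side is
  \<open>- 1 / (q (q - 1)) < 0\<close>.\<close>

definition I2 ::
    "real \<Rightarrow> (complex \<Rightarrow> complex) \<Rightarrow> real \<Rightarrow> real \<Rightarrow> real \<Rightarrow> real \<Rightarrow> complex" where
  "I2 am \<phi>pp \<beta> wm x1 x2 = am / (2 * pi) * line_integral wm (\<lambda>\<eta>.
     exp (\<i> * (x1 - x2) * \<eta>) * \<phi>pp \<eta> *
     (exp (\<beta> * x2) / (\<i> * \<eta> - \<beta>) - exp x2 / (\<i> * \<eta> - 1)))"

text \<open>The source prints the inner integrand with additional factors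
  \<open>exp (- i x2 \<xi>) exp (i x2 \<xi>) exp (- i x2 \<xi>)\<close>. They do not belong there: the bracket over
  \<open>i (\<eta> - \<xi>)\<close> times \<open>exp (- i x2 \<eta>)\<close> is the transform, in \<open>y > x2\<close>, of
  \<open>exp (i y \<xi>) (F(\<xi>, y) - F(\<xi>, x2))\<close>, where \<open>F(\<xi>, y)\<close> is the Fourier transform of
  \<open>f(\<cdot>, y)\<close>; the exponentials in \<open>\<xi>\<close> cancel when \<open>y\<close> is integrated out.\<close>

definition I3 ::
    "(complex \<Rightarrow> complex) \<Rightarrow> (complex \<Rightarrow> complex) \<Rightarrow> real \<Rightarrow> real \<Rightarrow> real \<Rightarrow> real \<Rightarrow> real \<Rightarrow> complex" where
  "I3 \<phi>pp \<phi>mm \<beta> w1 wm x1 x2 = 1 / (2 * pi)\<^sup>2 * line_integral wm (\<lambda>\<eta>.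
     exp (\<i> * (x1 - x2) * \<eta>) * \<phi>pp \<eta> *
     line_integral w1 (\<lambda>\<xi>. \<phi>mm \<xi> / (\<i> * (\<eta> - \<xi>)) *
       (exp (\<beta> * x2) / (\<i> * \<eta> - \<beta>)
        + \<beta> * exp ((1 + \<i> * \<xi> * (1 - 1 / \<beta>)) * x2) * (1 - \<i> * \<xi> / \<beta>)
          / ((\<beta> - \<i> * \<xi>) * (- \<i> * \<xi>) * (\<i> * \<eta> - 1 - \<i> * \<xi> * (1 - 1 / \<beta>)))
        - exp x2 * (1 - \<i> * \<xi>) / ((- \<i> * \<xi>) * (\<i> * \<eta> - 1)))))"

end

theory Submission
  imports Defs
begin

text \<open>Let \<open>S\<close> be the supremum and \<open>X\<close> the position of the process at the exponential time, and \<open>Z = X - S\<close>.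
  Up to the factor \<open>1 / q\<close>, the value in Laplace space is the mean of
  \<open>f(x1 + X, max x2 (x1 + S))\<close>. The payoff splits (\<open>payoff_split\<close>) into the payoff \<open>f(x1 + X, x2)\<close> with the barrier
  kept at \<open>x2\<close>, and a gain that is present only when \<open>S\<close> exceeds \<open>x2 - x1\<close> and depends on the excess
  \<open>S - (x2 - x1)\<close> and on \<open>Z\<close>. The first term is a function of \<open>X\<close> alone; Fourier inversion on the line
  \<open>Im \<xi> = w1\<close> gives \<open>I1\<close>, because \<open>q / (q + \<psi>)\<close> is the characteristic function of \<open>X\<close>. For the second term one needs
  the joint law of \<open>S\<close> and \<open>Z\<close>.

  That law comes from the Wiener--Hopf factorisation (\<open>wiener_hopf\<close>): \<open>S\<close> and \<open>Z\<close> are independent, and \<open>Z\<close> has the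
  law of the infimum. For a random walk stopped at an independent geometric time this is elementary: cutting the path
  at the first time of its maximum turns the joint law into a convolution over the time of the cut, so
  that its generating function is a product (\<open>geometric_time_factorization\<close>), and reversing the order of the
  steps exchanges \<open>Z\<close> and the minimum. Sampling the process on the grid of mesh \<open>1 / (m + 1)\<close> and letting
  \<open>m\<close> grow transfers both statements to the process; right continuity and local boundedness of the paths suffice when
  the last grid point is taken at or after the exponential time.

  The gain is then inverted twice. For a fixed value of \<open>Z\<close> it is inverted in \<open>S\<close> on the line \<open>Im \<eta> = wm\<close>
  (\<open>supremum_inversion\<close>); its transform in the excess is \<open>gain_transform\<close>. Averaging this transform over \<open>Z\<close> gives the value at
  \<open>0\<close> times the mass \<open>am\<close> of the atom of \<open>Z\<close> at \<open>0\<close>, which is \<open>I2\<close>, plus the mean off the atom, which is inverted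
  on the line \<open>Im \<xi> = w1\<close> (\<open>infimum_inversion\<close>) and is \<open>I3\<close>.

  All inversions use one principle (\<open>fourier_inversion\<close>): if the product of the characteristic function of a weighted random
  variable with the transform of \<open>g\<close> is integrable, then its integral is the mean of \<open>g\<close>, provided that \<open>g\<close>
  is continuous at almost every value that carries weight. Removing the atom at \<open>0\<close> from the weight replaces
  a Wiener--Hopf factor by its decaying part \<open>\<phi>pp\<close> or \<open>\<phi>mm\<close>, and this yields integrability.
  The decay also shows that there are no other atoms (\<open>measure_singleton_eq_char_limit\<close>), so that jumps of the payoff away
  from \<open>0\<close> do no harm. What remains is the atom \<open>ap * am\<close> of \<open>X\<close> at \<open>0\<close>, whose contribution to \<open>I1\<close> converges only
  conditionally; it reduces to the simple poles of \<open>line_pole_integral\<close>.\<close>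

section \<open>Fourier inversion by Gaussian regularisation\<close>

lemma integrable_mult_pair:
  fixes f :: "'a \<Rightarrow> complex" and g :: "'b \<Rightarrow> complex"
  assumes "pair_sigma_finite M1 M2" "integrable M1 f" "integrable M2 g"
  shows "integrable (M1 \<Otimes>\<^sub>M M2) (\<lambda>p. f (fst p) * g (snd p))"
proof -
  interpret pair_sigma_finite M1 M2 by fact
  have [measurable]: "f \<in> borel_measurable M1" "g \<in> borel_measurable M2" using assms by auto
  show ?thesis
  proof (rule Fubini_integrable)
    show "integrable M1 (\<lambda>x. LINT y|M2. norm (f (fst (x, y)) * g (snd (x, y))))"
      using assms by (simp add: norm_mult integrable_norm)
  qed (use assms in auto)
qed

text \<open>A Gaussian weight turns an integral over the line into a mean under the standard normal law, so that its
  Fourier transform can be taken from the characteristic function of that law.\<close>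

lemma integral_gaussian_weight:
  fixes F :: "real \<Rightarrow> complex"
  assumes [measurable]: "F \<in> borel_measurable borel" and e: "e > 0"
  shows "(LINT u|lborel. exp (- (e * u)\<^sup>2 / 2) *\<^sub>R F u)
       = complex_of_real (sqrt (2 * pi) / e) * (LINT x|std_normal_distribution. F (x / e))"
proof -
  have "(LINT u|lborel. exp (- (e * u)\<^sup>2 / 2) *\<^sub>R F u)
      = \<bar>1 / e\<bar> *\<^sub>R (LINT x|lborel. exp (- (e * (0 + (1/e) * x))\<^sup>2 / 2) *\<^sub>R F (0 + (1/e) * x))"
    using e by (intro lborel_integral_real_affine) auto
  also have "\<dots> = (1 / e) *\<^sub>R (LINT x|lborel. exp (- x\<^sup>2 / 2) *\<^sub>R F (x / e))"
    using e by simp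
  also have "(LINT x|lborel. exp (- x\<^sup>2 / 2) *\<^sub>R F (x / e)) =
     (LINT x|lborel. sqrt (2 * pi) *\<^sub>R (std_normal_density x *\<^sub>R F (x / e)))"
    by (intro Bochner_Integration.integral_cong) (auto simp: std_normal_density_def)
  also have "\<dots> = sqrt (2 * pi) *\<^sub>R (LINT x|std_normal_distribution. F (x / e))"
    by (subst integral_density) (auto simp del: scaleR_scaleR)
  finally show ?thesis by (simp add: scaleR_conv_of_real)
qed

lemma std_normal_char:
  "(LINT x|std_normal_distribution. iexp (t * x)) = complex_of_real (exp (- t\<^sup>2 / 2))"
  using char_std_normal_distribution[THEN fun_cong, of t] by (simp add: char_def)

text \<open>With the weight \<open>exp (- (e * u)\<^sup>2 / 2)\<close> every integral converges absolutely, and Fubini shows that the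
  regularised integral is \<open>2 * pi\<close> times the mean of \<open>g (Z + e * N)\<close> for a normal \<open>N\<close>. Both sides converge
  as \<open>e\<close> tends to 0 by dominated convergence: the left one since the product is integrable, the right one since
  \<open>g\<close> is bounded and continuous where \<open>c\<close> has mass. The complex weight \<open>c\<close> serves both to move the line of
  integration and to cut out an atom.\<close>

theorem fourier_inversion:
  fixes Z :: "'a \<Rightarrow> real" and c :: "'a \<Rightarrow> complex" and g :: "real \<Rightarrow> complex"
  assumes P: "sigma_finite_measure P" and Z[measurable]: "Z \<in> borel_measurable P"
    and c: "integrable P c" and g: "integrable lborel g" and gb: "\<And>x. norm (g x) \<le> C"
    and cont: "AE \<omega> in P. c \<omega> \<noteq> 0 \<longrightarrow> isCont g (Z \<omega>)"
    and int: "integrable lborel (\<lambda>u. (LINT \<omega>|P. c \<omega> * iexp (u * Z \<omega>)) * (LINT y|lborel. iexp (- u * y) * g y))"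
  shows "(LINT u|lborel. (LINT \<omega>|P. c \<omega> * iexp (u * Z \<omega>)) * (LINT y|lborel. iexp (- u * y) * g y))
       = 2 * pi * (LINT \<omega>|P. c \<omega> * g (Z \<omega>))"
proof -
  let ?N = "std_normal_distribution"
  interpret N: real_distribution ?N by (rule real_dist_normal_dist)
  interpret P: sigma_finite_measure P by fact
  interpret PL: pair_sigma_finite P lborel ..
  interpret NPL: pair_sigma_finite ?N "P \<Otimes>\<^sub>M lborel" ..
  have [measurable]: "c \<in> borel_measurable P" "g \<in> borel_measurable borel" using c g by auto
  define F where "F u = (LINT \<omega>|P. c \<omega> * iexp (u * Z \<omega>)) * (LINT y|lborel. iexp (- u * y) * g y)" for u
  have Fint: "integrable lborel F" using int unfolding F_def .
  then have Fm[measurable]: "F \<in> borel_measurable borel" by auto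
  have icg: "integrable (P \<Otimes>\<^sub>M lborel) (\<lambda>p. c (fst p) * g (snd p))"
    by (rule integrable_mult_pair) (unfold_locales, use c g in auto)
  have Fpair: "F u = (LINT p|(P \<Otimes>\<^sub>M lborel). c (fst p) * g (snd p) * iexp (u * (Z (fst p) - snd p)))" for u
  proof -
    have i: "integrable (P \<Otimes>\<^sub>M lborel) (\<lambda>p. c (fst p) * g (snd p) * iexp (u * (Z (fst p) - snd p)))"
      by (rule Bochner_Integration.integrable_bound[OF icg]) (auto simp: norm_mult)
    have "(LINT p|(P \<Otimes>\<^sub>M lborel). c (fst p) * g (snd p) * iexp (u * (Z (fst p) - snd p)))
       = (LINT \<omega>|P. LINT y|lborel. c \<omega> * g y * iexp (u * (Z \<omega> - y)))"
      using PL.integral_fst'[OF i] by simp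
    also have "\<dots> = (LINT \<omega>|P. LINT y|lborel. (c \<omega> * iexp (u * Z \<omega>)) * (iexp (- u * y) * g y))"
      by (simp add: right_diff_distrib exp_diff exp_minus field_simps)
    also have "\<dots> = F u" unfolding F_def by simp
    finally show ?thesis ..
  qed
  \<comment> \<open>Fubini twice: the inner integral over the line is the normal characteristic function.\<close>
  have reg: "(LINT u|lborel. exp (- (e * u)\<^sup>2 / 2) *\<^sub>R F u)
      = 2 * pi * (LINT \<omega>|P. c \<omega> * (LINT x|?N. g (Z \<omega> + e * x)))" if e: "e > 0" for e
  proof -
    let ?k = "\<lambda>x p. c (fst p) * g (snd p) * iexp (x / e * (Z (fst p) - snd p))"
    have i3: "integrable (?N \<Otimes>\<^sub>M (P \<Otimes>\<^sub>M lborel)) (\<lambda>(x, p). ?k x p)"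
    proof (rule Bochner_Integration.integrable_bound)
      show "integrable (?N \<Otimes>\<^sub>M (P \<Otimes>\<^sub>M lborel)) (\<lambda>q. (\<lambda>_. 1) (fst q) * (\<lambda>p. c (fst p) * g (snd p)) (snd q))"
        by (rule integrable_mult_pair) (unfold_locales, use icg in auto)
    qed (auto simp: norm_mult split: prod.split intro!: AE_I2)
    have "(LINT x|?N. F (x / e)) = (LINT x|?N. LINT p|(P \<Otimes>\<^sub>M lborel). ?k x p)"
      by (simp add: Fpair)
    also have "\<dots> = (LINT p|(P \<Otimes>\<^sub>M lborel). LINT x|?N. ?k x p)"
      by (rule NPL.Fubini_integral[OF i3, symmetric])
    also have "\<dots> = (LINT p|(P \<Otimes>\<^sub>M lborel). c (fst p) * g (snd p) * exp (- ((Z (fst p) - snd p) / e)\<^sup>2 / 2))"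
    proof (intro Bochner_Integration.integral_cong refl)
      fix p
      have "(LINT x|?N. ?k x p) = c (fst p) * g (snd p) * (LINT x|?N. iexp ((Z (fst p) - snd p) / e * x))"
        by (subst integral_mult_right_zero[symmetric]) (simp add: mult_ac)
      then show "(LINT x|?N. ?k x p) = c (fst p) * g (snd p) * exp (- ((Z (fst p) - snd p) / e)\<^sup>2 / 2)"
        by (simp only: std_normal_char)
    qed
    also have "\<dots> = (LINT \<omega>|P. LINT y|lborel. c \<omega> * g y * exp (- ((Z \<omega> - y) / e)\<^sup>2 / 2))"
    proof -
      have "integrable (P \<Otimes>\<^sub>M lborel) (\<lambda>p. c (fst p) * g (snd p) * complex_of_real (exp (- ((Z (fst p) - snd p) / e)\<^sup>2 / 2)))"
        by (rule Bochner_Integration.integrable_bound[OF icg])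
           (auto simp: norm_mult intro!: AE_I2 mult_left_le)
      from PL.integral_fst'[OF this] show ?thesis by simp
    qed
    also have "\<dots> = (LINT \<omega>|P. c \<omega> * (e * sqrt (2 * pi) * (LINT x|?N. g (Z \<omega> + e * x))))"
    proof (intro Bochner_Integration.integral_cong refl)
      fix \<omega>
      have "(LINT y|lborel. c \<omega> * g y * complex_of_real (exp (- ((Z \<omega> - y) / e)\<^sup>2 / 2)))
          = c \<omega> * (LINT y|lborel. g y * complex_of_real (exp (- ((Z \<omega> - y) / e)\<^sup>2 / 2)))"
        by (simp add: mult.assoc)
      also have "(LINT y|lborel. g y * complex_of_real (exp (- ((Z \<omega> - y) / e)\<^sup>2 / 2)))
        = \<bar>e\<bar> *\<^sub>R (LINT x|lborel. g (Z \<omega> + e * x) * complex_of_real (exp (- ((Z \<omega> - (Z \<omega> + e * x)) / e)\<^sup>2 / 2)))"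
        using e by (intro lborel_integral_real_affine) auto
      also have "(LINT x|lborel. g (Z \<omega> + e * x) * complex_of_real (exp (- ((Z \<omega> - (Z \<omega> + e * x)) / e)\<^sup>2 / 2)))
         = (LINT x|lborel. sqrt (2 * pi) *\<^sub>R (std_normal_density x *\<^sub>R g (Z \<omega> + e * x)))"
        using e by (intro Bochner_Integration.integral_cong) (auto simp: std_normal_density_def scaleR_conv_of_real)
      also have "\<dots> = sqrt (2 * pi) *\<^sub>R (LINT x|?N. g (Z \<omega> + e * x))"
        by (subst integral_density) (auto simp del: scaleR_scaleR)
      finally show "(LINT y|lborel. c \<omega> * g y * complex_of_real (exp (- ((Z \<omega> - y) / e)\<^sup>2 / 2)))
         = c \<omega> * (e * sqrt (2 * pi) * (LINT x|?N. g (Z \<omega> + e * x)))"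
        using e by (simp add: scaleR_conv_of_real)
    qed
    also have "\<dots> = e * sqrt (2 * pi) * (LINT \<omega>|P. c \<omega> * (LINT x|?N. g (Z \<omega> + e * x)))"
      by (subst integral_mult_right_zero[symmetric]) (simp add: mult_ac)
    finally have eq: "(LINT x|?N. F (x / e)) = e * sqrt (2 * pi) * (LINT \<omega>|P. c \<omega> * (LINT x|?N. g (Z \<omega> + e * x)))" .
    have "sqrt (2 * pi) / e * (e * sqrt (2 * pi)) = 2 * pi" using e by simp
    then have q: "complex_of_real (sqrt (2 * pi) / e) * complex_of_real (e * sqrt (2 * pi)) = complex_of_real (2 * pi)"
      by (simp only: flip: of_real_mult)
    show ?thesis
      by (simp only: integral_gaussian_weight[OF Fm e] eq mult.assoc[symmetric] q)
  qed
  define e where "e n = 1 / real (Suc n)" for n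
  have e0: "e n > 0" for n by (simp add: e_def)
  have elim: "e \<longlonglongrightarrow> 0" unfolding e_def by (rule LIMSEQ_Suc[OF lim_1_over_n])
  have L1: "(\<lambda>n. LINT u|lborel. exp (- (e n * u)\<^sup>2 / 2) *\<^sub>R F u) \<longlonglongrightarrow> (LINT u|lborel. F u)"
  proof (rule integral_dominated_convergence)
    show "integrable lborel (\<lambda>u. norm (F u))" using Fint by (rule integrable_norm)
    show "AE u in lborel. (\<lambda>n. exp (- (e n * u)\<^sup>2 / 2) *\<^sub>R F u) \<longlonglongrightarrow> F u"
    proof (rule AE_I2)
      fix u
      have "(\<lambda>n. exp (- (e n * u)\<^sup>2 / 2) *\<^sub>R F u) \<longlonglongrightarrow> exp (- (0 * u)\<^sup>2 / 2) *\<^sub>R F u"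
        by (intro tendsto_intros elim) auto
      then show "(\<lambda>n. exp (- (e n * u)\<^sup>2 / 2) *\<^sub>R F u) \<longlonglongrightarrow> F u" by simp
    qed
  qed (auto intro!: AE_I2 mult_left_le_one_le)
  have L2: "(\<lambda>n. LINT \<omega>|P. c \<omega> * (LINT x|?N. g (Z \<omega> + e n * x))) \<longlonglongrightarrow> (LINT \<omega>|P. c \<omega> * g (Z \<omega>))"
  proof (rule integral_dominated_convergence)
    have "C \<ge> 0" using gb[of 0] norm_ge_zero[of "g 0"] by linarith
    show "integrable P (\<lambda>\<omega>. C * norm (c \<omega>))" using c by auto
    show "AE \<omega> in P. norm (c \<omega> * (LINT x|?N. g (Z \<omega> + e n * x))) \<le> C * norm (c \<omega>)" for n
    proof (rule AE_I2)
      fix \<omega>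
      have "norm (LINT x|?N. g (Z \<omega> + e n * x)) \<le> (LINT x|?N. norm (g (Z \<omega> + e n * x)))"
        by (rule integral_norm_bound)
      also have "\<dots> \<le> (LINT x|?N. C)"
        by (intro integral_mono_AE N.integrable_const_bound[where B=C] AE_I2) (use gb \<open>C \<ge> 0\<close> in auto)
      also have "\<dots> = C" by (simp add: N.prob_space[simplified])
      finally show "norm (c \<omega> * (LINT x|?N. g (Z \<omega> + e n * x))) \<le> C * norm (c \<omega>)"
        by (simp add: norm_mult mult_left_mono mult.commute[of C])
    qed
    show "AE \<omega> in P. (\<lambda>n. c \<omega> * (LINT x|?N. g (Z \<omega> + e n * x))) \<longlonglongrightarrow> c \<omega> * g (Z \<omega>)"
      using cont
    proof eventually_elim
      case (elim \<omega>)
      show ?case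
      proof (cases "c \<omega> = 0")
        case False
        then have ct: "isCont g (Z \<omega>)" using elim by simp
        have "(\<lambda>n. LINT x|?N. g (Z \<omega> + e n * x)) \<longlonglongrightarrow> (LINT x|?N. g (Z \<omega>))"
        proof (rule integral_dominated_convergence)
          show "integrable ?N (\<lambda>_. C)" by simp
          show "AE x in ?N. (\<lambda>n. g (Z \<omega> + e n * x)) \<longlonglongrightarrow> g (Z \<omega>)"
          proof (rule AE_I2)
            fix x
            have "(\<lambda>n. Z \<omega> + e n * x) \<longlonglongrightarrow> Z \<omega> + 0 * x" by (intro tendsto_intros \<open>e \<longlonglongrightarrow> 0\<close>)
            then show "(\<lambda>n. g (Z \<omega> + e n * x)) \<longlonglongrightarrow> g (Z \<omega>)"
              using isCont_tendsto_compose[OF ct] by simp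
          qed
        qed (auto intro!: AE_I2 gb)
        then show ?thesis by (intro tendsto_intros) (simp add: N.prob_space[simplified])
      qed simp
    qed
  qed measurable
  have "(\<lambda>n. 2 * pi * (LINT \<omega>|P. c \<omega> * (LINT x|?N. g (Z \<omega> + e n * x)))) \<longlonglongrightarrow> (LINT u|lborel. F u)"
    using L1 unfolding reg[OF e0] .
  moreover have "(\<lambda>n. 2 * pi * (LINT \<omega>|P. c \<omega> * (LINT x|?N. g (Z \<omega> + e n * x)))) \<longlonglongrightarrow> 2 * pi * (LINT \<omega>|P. c \<omega> * g (Z \<omega>))"
    by (intro tendsto_intros L2)
  ultimately show ?thesis unfolding F_def[symmetric] by (rule LIMSEQ_unique)
qed

lemma gaussian_tendsto_0:
  fixes k :: real
  assumes "k \<noteq> 0"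
  shows "(\<lambda>n. exp (- (real n * k)\<^sup>2 / 2)) \<longlonglongrightarrow> 0"
proof -
  define c where "c = k\<^sup>2 / 2"
  have c: "c > 0" using assms by (simp add: c_def)
  have "filterlim (\<lambda>x::real. c * x^2) at_top at_top"
    by (intro filterlim_tendsto_pos_mult_at_top[OF tendsto_const c] filterlim_pow_at_top filterlim_ident) auto
  then have "((\<lambda>x::real. exp (- (c * x^2))) \<longlongrightarrow> 0) at_top"
    by (intro filterlim_compose[OF exp_at_bot]) (simp add: filterlim_uminus_at_top)
  from filterlim_compose[OF this filterlim_real_sequentially]
  show ?thesis by (simp add: c_def power_mult_distrib mult.commute)
qed

text \<open>The mean of \<open>exp (- (n * (Z - d))\<^sup>2 / 2)\<close> tends to the mass at \<open>d\<close>. It is also a Gaussian average of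
  the characteristic function at scale \<open>n\<close>, and the limit of that average depends only on the limit of the function at infinity.\<close>

lemma measure_singleton_eq_char_limit:
  fixes Z :: "'a \<Rightarrow> real"
  assumes P: "prob_space P" and Z[measurable]: "Z \<in> borel_measurable P"
    and lim: "((\<lambda>u. (LINT \<omega>|P. iexp (u * Z \<omega>)) - complex_of_real a) \<longlongrightarrow> 0) at_infinity"
  shows "measure P {\<omega>\<in>space P. Z \<omega> = d} = (if d = 0 then a else 0)"
proof -
  let ?N = "std_normal_distribution"
  interpret N: real_distribution ?N by (rule real_dist_normal_dist)
  interpret P: prob_space P by fact
  interpret PN: pair_sigma_finite P ?N ..
  define \<phi> where "\<phi> u = (LINT \<omega>|P. iexp (u * Z \<omega>))" for u
  have mphi[measurable]: "\<phi> \<in> borel_measurable borel" unfolding \<phi>_def by measurable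
  have phib: "norm (\<phi> u) \<le> 1" for u
  proof -
    have "norm (\<phi> u) \<le> (LINT \<omega>|P. norm (iexp (u * Z \<omega>)))" unfolding \<phi>_def by (rule integral_norm_bound)
    then show ?thesis by (simp add: P.prob_space)
  qed
  \<comment> \<open>The Gaussian in \<open>Z\<close> is the characteristic function of a normal variable at \<open>n * (Z - d)\<close>.\<close>
  have eq: "complex_of_real (LINT \<omega>|P. exp (- (n * (Z \<omega> - d))\<^sup>2 / 2))
      = (LINT x|?N. iexp (- n * d * x) * \<phi> (n * x))" for n :: real
  proof -
    have "complex_of_real (LINT \<omega>|P. exp (- (n * (Z \<omega> - d))\<^sup>2 / 2))
       = (LINT \<omega>|P. LINT x|?N. iexp (n * (Z \<omega> - d) * x))"
      by (subst std_normal_char) simp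
    also have "\<dots> = (LINT x|?N. LINT \<omega>|P. iexp (n * (Z \<omega> - d) * x))"
    proof (rule PN.Fubini_integral[symmetric])
      interpret Q: prob_space "P \<Otimes>\<^sub>M ?N"
        by (rule prob_space_pair) unfold_locales
      show "integrable (P \<Otimes>\<^sub>M ?N) (\<lambda>(x, y). iexp (n * (Z x - d) * y))"
        by (rule Q.integrable_const_bound[where B=1]) (auto intro!: AE_I2 split: prod.split)
    qed
    also have "\<dots> = (LINT x|?N. iexp (- n * d * x) * \<phi> (n * x))"
      unfolding \<phi>_def
      by (intro Bochner_Integration.integral_cong refl, subst integral_mult_right_zero[symmetric])
         (simp add: algebra_simps flip: exp_add)
    finally show ?thesis .
  qed
  have 1: "(\<lambda>n. LINT \<omega>|P. exp (- (real n * (Z \<omega> - d))\<^sup>2 / 2)) \<longlonglongrightarrow> (LINT \<omega>|P. indicator {\<omega>\<in>space P. Z \<omega> = d} \<omega>)"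
  proof (rule integral_dominated_convergence)
    show "integrable P (\<lambda>_. 1::real)" by simp
    show "AE \<omega> in P. (\<lambda>n. exp (- (real n * (Z \<omega> - d))\<^sup>2 / 2)) \<longlonglongrightarrow> indicator {\<omega>\<in>space P. Z \<omega> = d} \<omega>"
    proof (rule AE_I2)
      fix \<omega> assume w: "\<omega> \<in> space P"
      show "(\<lambda>n. exp (- (real n * (Z \<omega> - d))\<^sup>2 / 2)) \<longlonglongrightarrow> indicator {\<omega>\<in>space P. Z \<omega> = d} \<omega>"
      proof (cases "Z \<omega> = d")
        case False
        then have "(\<lambda>n. exp (- (real n * (Z \<omega> - d))\<^sup>2 / 2)) \<longlonglongrightarrow> 0"
          by (intro gaussian_tendsto_0) simp
        then show ?thesis using False by simp
      qed (use w in simp)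
    qed
  qed (auto intro!: AE_I2)
  define r where "r n x = iexp (- real n * d * x) * (\<phi> (real n * x) - a)" for n x
  have rb: "norm (r n x) \<le> 1 + \<bar>a\<bar>" for n x
  proof -
    have "norm (r n x) = norm (\<phi> (real n * x) - a)" by (simp add: r_def norm_mult)
    also have "\<dots> \<le> norm (\<phi> (real n * x)) + norm (complex_of_real a)" by (rule norm_triangle_ineq4)
    finally show ?thesis using phib[of "real n * x"] by simp
  qed
  have 2: "(\<lambda>n. LINT x|?N. r n x) \<longlonglongrightarrow> (LINT x|?N. 0)"
  proof (rule integral_dominated_convergence)
    show "integrable ?N (\<lambda>_. 1 + \<bar>a\<bar>)" by simp
    show "AE x in ?N. norm (r n x) \<le> 1 + \<bar>a\<bar>" for n
      by (intro AE_I2 rb)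
    have "AE x in lborel. x \<noteq> (0::real)" by (rule AE_lborel_singleton)
    then have "AE x in ?N. x \<noteq> 0" by (subst AE_density) (auto elim: eventually_mono)
    then show "AE x in ?N. (\<lambda>n. r n x) \<longlonglongrightarrow> 0"
    proof eventually_elim
      case (elim x)
      have "filterlim (\<lambda>n. real n * \<bar>x\<bar>) at_top sequentially"
        by (intro filterlim_at_top_mult_tendsto_pos[OF tendsto_const _ filterlim_real_sequentially]) (use elim in auto)
      then have "filterlim (\<lambda>n. real n * x) at_infinity sequentially"
        by (subst filterlim_at_infinity_conv_norm_at_top) (simp add: abs_mult)
      then have "(\<lambda>n. \<phi> (real n * x) - a) \<longlonglongrightarrow> 0"
        using filterlim_compose[OF lim[folded \<phi>_def]] by auto
      then have "(\<lambda>n. norm (r n x)) \<longlonglongrightarrow> 0" by (simp add: r_def norm_mult tendsto_norm_zero)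
      then show ?case by (rule tendsto_norm_zero_cancel)
    qed
  qed (auto simp: r_def)
  have eq2: "complex_of_real (LINT \<omega>|P. exp (- (real n * (Z \<omega> - d))\<^sup>2 / 2))
      = (LINT x|?N. r n x) + a * complex_of_real (exp (- (real n * d)\<^sup>2 / 2))" for n
  proof -
    have "(LINT x|?N. iexp (- real n * d * x) * \<phi> (real n * x)) = (LINT x|?N. r n x + a * iexp (- real n * d * x))"
      by (simp add: r_def algebra_simps)
    also have "\<dots> = (LINT x|?N. r n x) + (LINT x|?N. a * iexp (- real n * d * x))"
    proof (rule Bochner_Integration.integral_add)
      show "integrable ?N (\<lambda>x. r n x)"
      proof (rule N.integrable_const_bound[where B="1 + \<bar>a\<bar>"])
        show "AE x in ?N. norm (r n x) \<le> 1 + \<bar>a\<bar>" by (intro AE_I2 rb)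
      qed (auto simp: r_def)
      show "integrable ?N (\<lambda>x. a * iexp (- real n * d * x))"
        by (rule N.integrable_const_bound[where B="\<bar>a\<bar>"]) (auto intro!: AE_I2 simp: norm_mult)
    qed
    also have "(LINT x|?N. a * iexp (- real n * d * x)) = a * complex_of_real (exp (- (- real n * d)\<^sup>2 / 2))"
      by (subst std_normal_char[symmetric]) simp
    finally show ?thesis using eq[of "real n"] by simp
  qed
  have 3: "(\<lambda>n. complex_of_real (exp (- (real n * d)\<^sup>2 / 2))) \<longlonglongrightarrow> (if d = 0 then 1 else 0)"
  proof (cases "d = 0")
    case False
    from gaussian_tendsto_0[OF this]
    have "(\<lambda>n. exp (- (real n * d)\<^sup>2 / 2)) \<longlonglongrightarrow> 0" .
    from tendsto_of_real[OF this] show ?thesis using False by simp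
  qed simp
  have "(\<lambda>n. complex_of_real (LINT \<omega>|P. exp (- (real n * (Z \<omega> - d))\<^sup>2 / 2))) \<longlonglongrightarrow> (LINT x|?N. 0) + complex_of_real a * (if d = 0 then 1 else 0)"
    unfolding eq2 by (intro tendsto_intros 2 3)
  moreover have "(\<lambda>n. complex_of_real (LINT \<omega>|P. exp (- (real n * (Z \<omega> - d))\<^sup>2 / 2))) \<longlonglongrightarrow> complex_of_real (LINT \<omega>|P. indicator {\<omega>\<in>space P. Z \<omega> = d} \<omega>)"
    by (intro tendsto_of_real 1)
  ultimately have "complex_of_real (LINT \<omega>|P. indicator {\<omega>\<in>space P. Z \<omega> = d} \<omega>) = (LINT x|?N. 0) + complex_of_real a * (if d = 0 then 1 else 0)"
    by (rule LIMSEQ_unique[rotated])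
  also have "(LINT \<omega>|P. indicator {\<omega>\<in>space P. Z \<omega> = d} \<omega>) = measure P {\<omega>\<in>space P. Z \<omega> = d}"
    by simp
  finally have "complex_of_real (measure P {\<omega>\<in>space P. Z \<omega> = d}) = complex_of_real (if d = 0 then a else 0)" by simp
  then show ?thesis by (simp only: of_real_eq_iff)
qed

section \<open>Cadlag paths sampled on a grid\<close>

text \<open>One-sided limits make the path bounded near each point; bisection makes it bounded on the interval.\<close>

lemma cadlag_bounded_abs:
  fixes x :: "real \<Rightarrow> real"
  assumes rc: "\<And>t. 0 \<le> t \<Longrightarrow> (x \<longlongrightarrow> x t) (at_right t)"
    and ll: "\<And>t. 0 < t \<Longrightarrow> \<exists>l. (x \<longlongrightarrow> l) (at_left t)"
    and t: "0 \<le> t"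
  shows "\<exists>B. \<forall>s\<in>{0..t}. \<bar>x s\<bar> \<le> B"
proof -
  define Q where "Q a b \<longleftrightarrow> (\<exists>B. \<forall>s\<in>{max 0 a..b}. \<bar>x s\<bar> \<le> B)" for a b
  \<comment> \<open>Only times in \<open>{0..}\<close> are controlled, hence \<open>max 0 a\<close> in \<open>Q\<close>; at time 0 there is no left limit to use.\<close>
  have "Q 0 t"
  proof (rule Bolzano[OF t])
    fix a b c assume Q: "Q a b" "Q b c" and o: "a \<le> b" "b \<le> c"
    then obtain B C where B: "\<forall>s\<in>{max 0 a..b}. \<bar>x s\<bar> \<le> B" and C: "\<forall>s\<in>{max 0 b..c}. \<bar>x s\<bar> \<le> C"
      unfolding Q_def by auto
    have "\<bar>x s\<bar> \<le> max B C" if "s \<in> {max 0 a..c}" for s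
    proof (cases "s \<le> b")
      case True then show ?thesis using B that by (meson atLeastAtMost_iff le_max_iff_disj)
    next
      case False then have "s \<in> {max 0 b..c}" using that o by auto
      then show ?thesis using C by (meson le_max_iff_disj)
    qed
    then show "Q a c" unfolding Q_def by blast
  next
    fix s assume s: "0 \<le> s" "s \<le> t"
    have "eventually (\<lambda>r. \<bar>x r - x s\<bar> < 1) (at_right s)"
      using tendstoD[OF rc[OF s(1)], of 1] by (simp add: dist_real_def)
    then obtain b where b: "b > s" "\<And>r. s < r \<Longrightarrow> r < b \<Longrightarrow> \<bar>x r - x s\<bar> < 1"
      unfolding eventually_at_right_field by blast
    obtain d l where d: "d < s" "\<And>r. 0 \<le> r \<Longrightarrow> d < r \<Longrightarrow> r < s \<Longrightarrow> \<bar>x r - l\<bar> < 1"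
    proof (cases "s = 0")
      case True
      show ?thesis by (rule that[of "-1" 0]) (use True in auto)
    next
      case False
      then obtain l where "(x \<longlongrightarrow> l) (at_left s)" using ll[of s] s by auto
      from tendstoD[OF this, of 1] have "eventually (\<lambda>r. \<bar>x r - l\<bar> < 1) (at_left s)"
        by (simp add: dist_real_def)
      then obtain d where "d < s" "\<And>r. d < r \<Longrightarrow> r < s \<Longrightarrow> \<bar>x r - l\<bar> < 1"
        unfolding eventually_at_left_field by blast
      then show ?thesis using that[of d l] by auto
    qed
    define B where "B = \<bar>x s\<bar> + \<bar>l\<bar> + 1"
    have B: "\<bar>x r\<bar> \<le> B" if "0 \<le> r" "d < r" "r < b" for r
    proof -
      consider "r < s" | "r = s" | "r > s" by linarith
      then show ?thesis
      proof cases
        case 1 then show ?thesis using d(2)[of r] that unfolding B_def by linarith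
      next
        case 2 then show ?thesis unfolding B_def by simp
      next
        case 3 then show ?thesis using b(2)[of r] that unfolding B_def by linarith
      qed
    qed
    show "\<exists>\<delta>>0. \<forall>a' b'. a' \<le> s \<and> s \<le> b' \<and> b' - a' < \<delta> \<longrightarrow> Q a' b'"
    proof (intro exI[of _ "min (b - s) (s - d)"] conjI allI impI)
      show "0 < min (b - s) (s - d)" using b(1) d(1) by simp
      fix a' b' assume "a' \<le> s \<and> s \<le> b' \<and> b' - a' < min (b - s) (s - d)"
      then have "\<forall>r\<in>{max 0 a'..b'}. \<bar>x r\<bar> \<le> B" by (intro ballI B) auto
      then show "Q a' b'" unfolding Q_def by blast
    qed
  qed
  then show ?thesis unfolding Q_def by simp
qed

text \<open>The index of the first point at or after \<open>t\<close> in the grid of mesh \<open>1 / Suc m\<close>. Rounding up matters: a right-continuous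
  path is then sampled on the side where it converges.\<close>

definition grid :: "nat \<Rightarrow> real \<Rightarrow> nat" where
  "grid m t = nat \<lceil>t * real (Suc m)\<rceil>"

lemma grid_bounds:
  assumes "0 \<le> t"
  shows "t \<le> real (grid m t) / real (Suc m)" "real (grid m t) / real (Suc m) < t + 1 / real (Suc m)"
proof -
  have c: "0 \<le> t * real (Suc m)" using assms by simp
  then have e: "real (grid m t) = of_int \<lceil>t * real (Suc m)\<rceil>" unfolding grid_def by simp
  have "t * real (Suc m) \<le> real (grid m t)" unfolding e by linarith
  then show "t \<le> real (grid m t) / real (Suc m)" by (subst pos_le_divide_eq) auto
  have "real (grid m t) < t * real (Suc m) + 1" unfolding e by linarith
  then have "real (grid m t) / real (Suc m) < (t * real (Suc m) + 1) / real (Suc m)"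
    by (intro divide_strict_right_mono) auto
  also have "\<dots> = t + 1 / real (Suc m)" by (simp add: add_divide_distrib del: of_nat_Suc)
  finally show "real (grid m t) / real (Suc m) < t + 1 / real (Suc m)" .
qed

lemma grid_mono: "s \<le> t \<Longrightarrow> grid m s \<le> grid m t"
  unfolding grid_def by (intro nat_mono ceiling_mono mult_right_mono) auto

lemma right_continuous_grid:
  fixes x :: "real \<Rightarrow> real"
  assumes rc: "(x \<longlongrightarrow> x t) (at_right t)" and t: "0 \<le> t"
  shows "(\<lambda>m. x (real (grid m t) / real (Suc m))) \<longlonglongrightarrow> x t"
proof -
  have 1: "(\<lambda>m. real (grid m t) / real (Suc m)) \<longlonglongrightarrow> t"
  proof (rule tendsto_sandwich[of "\<lambda>_. t"])
    show "(\<lambda>m. t + 1 / real (Suc m)) \<longlonglongrightarrow> t"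
      using tendsto_add[OF tendsto_const LIMSEQ_Suc[OF lim_1_over_n], of t] by simp
  qed (use grid_bounds[OF t] in \<open>auto intro!: always_eventually less_imp_le simp del: of_nat_Suc\<close>)
  show ?thesis
  proof (rule tendstoI)
    fix e :: real assume "e > 0"
    from tendstoD[OF rc this] obtain b where b: "b > t" "\<And>r. t < r \<Longrightarrow> r < b \<Longrightarrow> dist (x r) (x t) < e"
      unfolding eventually_at_right_field by blast
    have "eventually (\<lambda>m. real (grid m t) / real (Suc m) < b) sequentially"
      using 1 b(1) by (rule order_tendstoD(2))
    then show "eventually (\<lambda>m. dist (x (real (grid m t) / real (Suc m))) (x t) < e) sequentially"
    proof eventually_elim
      case (elim m)
      then show ?case using b(2)[of "real (grid m t) / real (Suc m)"] grid_bounds(1)[OF t, of m] \<open>e > 0\<close>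
        by (cases "t = real (grid m t) / real (Suc m)") (auto simp del: of_nat_Suc)
    qed
  qed
qed

text \<open>From below, a near-maximiser \<open>s \<le> t\<close> is approached from the right by grid points whose index does not exceed that of \<open>t\<close>. From above, the
  grid overshoots \<open>t\<close> by less than one mesh, where right continuity at \<open>t\<close> bounds the path.\<close>

lemma grid_Max_tendsto:
  fixes x :: "real \<Rightarrow> real"
  assumes rc: "\<And>t. 0 \<le> t \<Longrightarrow> (x \<longlongrightarrow> x t) (at_right t)"
    and bdd: "bdd_above (x ` {0..t})" and t: "0 \<le> t"
  shows "(\<lambda>m. Max ((\<lambda>j. x (real j / real (Suc m))) ` {..grid m t})) \<longlonglongrightarrow> (SUP s\<in>{0..t}. x s)"
proof (rule order_tendstoI)
  let ?S = "SUP s\<in>{0..t}. x s"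
  fix a assume "a < ?S"
  then obtain s where s: "s \<in> {0..t}" "a < x s"
    using less_cSUP_iff[of "{0..t}" x a] bdd t by auto
  have "eventually (\<lambda>m. a < x (real (grid m s) / real (Suc m))) sequentially"
    using right_continuous_grid[OF rc[of s]] s by (intro order_tendstoD(1)) auto
  then show "eventually (\<lambda>m. a < Max ((\<lambda>j. x (real j / real (Suc m))) ` {..grid m t})) sequentially"
  proof eventually_elim
    case (elim m)
    also have "x (real (grid m s) / real (Suc m)) \<le> Max ((\<lambda>j. x (real j / real (Suc m))) ` {..grid m t})"
      using grid_mono[of s t m] s by (intro Max_ge) auto
    finally show ?case .
  qed
next
  let ?S = "SUP s\<in>{0..t}. x s"
  fix a assume a: "?S < a"
  have le: "x s \<le> ?S" if "0 \<le> s" "s \<le> t" for s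
    using that by (intro cSUP_upper bdd) auto
  have "x t < a" using le[of t] t a by simp
  then obtain b where b: "b > t" "\<And>r. t < r \<Longrightarrow> r < b \<Longrightarrow> x r < a"
    using order_tendstoD(2)[OF rc[OF t]] unfolding eventually_at_right_field by blast
  have "(\<lambda>m. t + 1 / real (Suc m)) \<longlonglongrightarrow> t"
    using tendsto_add[OF tendsto_const LIMSEQ_Suc[OF lim_1_over_n], of t] by simp
  from order_tendstoD(2)[OF this b(1)]
  show "eventually (\<lambda>m. Max ((\<lambda>j. x (real j / real (Suc m))) ` {..grid m t}) < a) sequentially"
  proof eventually_elim
    case (elim m)
    have "x (real j / real (Suc m)) < a" if "j \<le> grid m t" for j
    proof (cases "real j / real (Suc m) \<le> t")
      case True then show ?thesis using le[of "real j / real (Suc m)"] a by simp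
    next
      case False
      have "real j / real (Suc m) \<le> real (grid m t) / real (Suc m)"
        using that by (intro divide_right_mono) auto
      then show ?thesis using False b(2) grid_bounds(2)[OF t, of m] elim by force
    qed
    then show ?case by (subst Max_less_iff) auto
  qed
qed

lemma grid_Min_tendsto:
  fixes x :: "real \<Rightarrow> real"
  assumes rc: "\<And>t. 0 \<le> t \<Longrightarrow> (x \<longlongrightarrow> x t) (at_right t)"
    and bdd: "bdd_below (x ` {0..t})" and t: "0 \<le> t"
  shows "(\<lambda>m. Min ((\<lambda>j. x (real j / real (Suc m))) ` {..grid m t})) \<longlonglongrightarrow> (INF s\<in>{0..t}. x s)"
proof -
  have "bdd_above ((\<lambda>s. - x s) ` {0..t})"
    using bdd by (auto simp: bdd_above_def bdd_below_def) (metis neg_le_iff_le)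
  then have "(\<lambda>m. - Max ((\<lambda>j. - x (real j / real (Suc m))) ` {..grid m t})) \<longlonglongrightarrow> - (SUP s\<in>{0..t}. - x s)"
    using rc by (intro tendsto_minus grid_Max_tendsto t) auto
  moreover have "- Max ((\<lambda>j. - x (real j / real (Suc m))) ` {..grid m t}) = Min ((\<lambda>j. x (real j / real (Suc m))) ` {..grid m t})" for m
    by (subst minus_Max_eq_Min) (auto simp: image_image)
  moreover have "- (SUP s\<in>{0..t}. - x s) = (INF s\<in>{0..t}. x s)"
    by (simp add: Inf_real_def image_image)
  ultimately show ?thesis by simp
qed

section \<open>The maximum of a random walk at a geometric time\<close>

definition psum :: "(nat \<Rightarrow> real) \<Rightarrow> nat \<Rightarrow> real" where
  "psum v n = (\<Sum>i<n. v i)"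

definition walk_max :: "nat \<Rightarrow> (nat \<Rightarrow> real) \<Rightarrow> real" where
  "walk_max n v = Max (psum v ` {..n})"

definition walk_min :: "nat \<Rightarrow> (nat \<Rightarrow> real) \<Rightarrow> real" where
  "walk_min n v = Min (psum v ` {..n})"

text \<open>Time \<open>k\<close> is a strict record of the walk; together with \<open>nonpos\<close> for the path after \<open>k\<close> this says that \<open>k\<close> is the first time of
  the maximum.\<close>

definition ladder :: "nat \<Rightarrow> (nat \<Rightarrow> real) \<Rightarrow> bool" where
  "ladder k v \<longleftrightarrow> (\<forall>j<k. psum v j < psum v k)"

definition nonpos :: "nat \<Rightarrow> (nat \<Rightarrow> real) \<Rightarrow> bool" where
  "nonpos m v \<longleftrightarrow> (\<forall>j\<le>m. psum v j \<le> 0)"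

lemma psum_shift: "psum (\<lambda>i. v (k + i)) j = psum v (k + j) - psum v k"
  unfolding psum_def by (induction j) auto

lemma psum_reverse: "j \<le> n \<Longrightarrow> psum (\<lambda>i. v (n - 1 - i)) j = psum v n - psum v (n - j)"
proof (induction j)
  case (Suc j)
  then have "n - j = Suc (n - Suc j)" by simp
  then have "psum v (n - j) = psum v (n - Suc j) + v (n - Suc j)" unfolding psum_def by simp
  with Suc show ?case unfolding psum_def by simp
qed (simp add: psum_def)

lemma psum_restrict: "n \<le> m \<Longrightarrow> psum (\<lambda>i\<in>{..<m}. v i) n = psum v n"
  unfolding psum_def by (intro sum.cong) auto

text \<open>The event that the first maximum is at \<open>k\<close> factors into one about the steps before \<open>k\<close> and one about
  the steps after \<open>k\<close>; this is where independence enters.\<close>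

lemma first_maximum_iff:
  assumes "k \<le> n"
  shows "ladder k v \<and> nonpos (n - k) (\<lambda>i. v (k + i)) \<longleftrightarrow>
    k = (LEAST k. k \<le> n \<and> psum v k = walk_max n v)"
proof -
  let ?Q = "\<lambda>k. k \<le> n \<and> psum v k = walk_max n v"
  have le: "psum v j \<le> walk_max n v" if "j \<le> n" for j
    unfolding walk_max_def using that by (intro Max_ge) auto
  have "walk_max n v \<in> psum v ` {..n}" unfolding walk_max_def by (intro Max_in) auto
  then have ex: "\<exists>k. ?Q k" by auto
  show ?thesis
  proof
    assume A: "ladder k v \<and> nonpos (n - k) (\<lambda>i. v (k + i))"
    have ub: "psum v j \<le> psum v k" if "j \<le> n" for j
    proof (cases "j < k")
      case True then show ?thesis using A unfolding ladder_def by auto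
    next
      case False
      then have "psum v (k + (j - k)) - psum v k \<le> 0"
        using A that unfolding nonpos_def psum_shift by (metis diff_le_mono)
      then show ?thesis using False by simp
    qed
    have "walk_max n v \<le> psum v k" unfolding walk_max_def using ub by (subst Max_le_iff) auto
    then have "?Q k" using le[OF assms] assms by simp
    then show "k = (LEAST k. ?Q k)"
    proof (intro Least_equality[symmetric])
      fix j assume "?Q k" "?Q j"
      then show "k \<le> j" using A unfolding ladder_def by (metis less_irrefl not_le)
    qed
  next
    assume k: "k = (LEAST k. ?Q k)"
    have Q: "?Q k" unfolding k using LeastI_ex[OF ex] .
    have "psum v j < psum v k" if "j < k" for j
      using not_less_Least[of j ?Q] that k le[of j] Q assms by force
    moreover have "psum v (k + j) - psum v k \<le> 0" if "j \<le> n - k" for j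
      using le[of "k + j"] Q that assms by simp
    ultimately show "ladder k v \<and> nonpos (n - k) (\<lambda>i. v (k + i))"
      unfolding ladder_def nonpos_def psum_shift by auto
  qed
qed

lemma walk_max_decomposition:
  fixes g h :: "real \<Rightarrow> real"
  shows "g (walk_max n v) * h (psum v n - walk_max n v) =
    (\<Sum>k\<le>n. (of_bool (ladder k v) * g (psum v k)) *
       (of_bool (nonpos (n - k) (\<lambda>i. v (k + i))) * h (psum (\<lambda>i. v (k + i)) (n - k))))"
proof -
  let ?Q = "\<lambda>k. k \<le> n \<and> psum v k = walk_max n v"
  have "walk_max n v \<in> psum v ` {..n}" unfolding walk_max_def by (intro Max_in) auto
  then have "\<exists>k. ?Q k" by auto
  from LeastI_ex[OF this] have Q: "?Q (LEAST k. ?Q k)" .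
  define t where "t = (LEAST k. ?Q k)"
  have "(\<Sum>k\<le>n. (of_bool (ladder k v) * g (psum v k)) *
       (of_bool (nonpos (n - k) (\<lambda>i. v (k + i))) * h (psum (\<lambda>i. v (k + i)) (n - k))))
     = (\<Sum>k\<le>n. if k = t then g (psum v k) * h (psum v n - psum v k) else 0)"
    using first_maximum_iff[of _ n v, folded t_def]
    by (intro sum.cong refl) (auto simp: psum_shift)
  also have "\<dots> = g (psum v t) * h (psum v n - psum v t)" using Q unfolding t_def[symmetric] by simp
  also have "psum v t = walk_max n v" using Q unfolding t_def[symmetric] by simp
  finally show ?thesis ..
qed

text \<open>The partial sums of the reversed steps are the increments of the walk up to its final time.\<close>

lemma walk_reversal: "psum v n - walk_max n v = walk_min n (\<lambda>i. v (n - 1 - i))"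
proof -
  have "psum v n - walk_max n v = - Max ((\<lambda>j. psum v j + - psum v n) ` {..n})"
    unfolding walk_max_def by (subst Max_add_commute) auto
  also have "\<dots> = Min (uminus ` (\<lambda>j. psum v j + - psum v n) ` {..n})"
    by (subst minus_Max_eq_Min) auto
  also have "uminus ` (\<lambda>j. psum v j + - psum v n) ` {..n} = (\<lambda>j. psum v n - psum v j) ` {..n}"
    by (auto simp: image_image)
  also have "\<dots> = (\<lambda>j. psum v n - psum v (n - j)) ` {..n}"
  proof (intro equalityI subsetI)
    fix y assume "y \<in> (\<lambda>j. psum v n - psum v j) ` {..n}"
    then obtain j where "j \<le> n" "y = psum v n - psum v j" by auto
    then show "y \<in> (\<lambda>j. psum v n - psum v (n - j)) ` {..n}" by (intro image_eqI[of _ _ "n - j"]) auto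
  qed auto
  also have "\<dots> = psum (\<lambda>i. v (n - 1 - i)) ` {..n}" by (intro image_cong refl) (simp only: psum_reverse atMost_iff)
  finally show ?thesis unfolding walk_min_def .
qed

locale iid_steps = prob_space M for M :: "'a measure" +
  fixes Y :: "nat \<Rightarrow> 'a \<Rightarrow> real"
  assumes indep: "indep_vars (\<lambda>_. borel) Y UNIV"
    and ident: "distr M borel (Y i) = distr M borel (Y 0)"
begin

lemma measurable_Y[measurable]: "Y i \<in> borel_measurable M"
  using indep unfolding indep_vars_def by auto

text \<open>Any selection of distinct steps has the law of the first ones. This covers both the shift past a record and the time
  reversal.\<close>

lemma distr_steps:
  assumes f: "inj_on f I"
  shows "distr M (Pi\<^sub>M I (\<lambda>_. borel)) (\<lambda>\<omega>. \<lambda>i\<in>I. Y (f i) \<omega>) = Pi\<^sub>M I (\<lambda>_. distr M borel (Y 0))"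
proof -
  have U: "distr M (Pi\<^sub>M UNIV (\<lambda>_. borel)) (\<lambda>\<omega>. \<lambda>i\<in>UNIV. Y i \<omega>) = Pi\<^sub>M UNIV (\<lambda>i. distr M borel (Y i))"
    using indep by (subst indep_vars_iff_distr_eq_PiM[symmetric]) auto
  have s1: "sets (Pi\<^sub>M UNIV (\<lambda>i. distr M borel (Y i))) = sets (Pi\<^sub>M UNIV (\<lambda>_. borel))"
    and s2: "sets (Pi\<^sub>M I (\<lambda>i. distr M borel (Y (f i)))) = sets (Pi\<^sub>M I (\<lambda>_. borel))"
    by (intro sets_PiM_cong; simp)+
  have mf: "(\<lambda>v. \<lambda>n\<in>I. v (f n)) \<in> Pi\<^sub>M UNIV (\<lambda>_. borel) \<rightarrow>\<^sub>M Pi\<^sub>M I (\<lambda>_. borel)"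
    by (intro measurable_restrict measurable_component_singleton) auto
  have my: "(\<lambda>\<omega>. \<lambda>i\<in>UNIV. Y i \<omega>) \<in> M \<rightarrow>\<^sub>M Pi\<^sub>M UNIV (\<lambda>_. borel)"
    by (intro measurable_restrict measurable_Y)
  have "distr M (Pi\<^sub>M I (\<lambda>_. borel)) (\<lambda>\<omega>. \<lambda>i\<in>I. Y (f i) \<omega>)
      = distr (distr M (Pi\<^sub>M UNIV (\<lambda>_. borel)) (\<lambda>\<omega>. \<lambda>i\<in>UNIV. Y i \<omega>)) (Pi\<^sub>M I (\<lambda>_. borel)) (\<lambda>v. \<lambda>n\<in>I. v (f n))"
    by (subst distr_distr[OF mf my]) (simp add: comp_def)
  also have "\<dots> = distr (Pi\<^sub>M UNIV (\<lambda>i. distr M borel (Y i))) (Pi\<^sub>M I (\<lambda>i. distr M borel (Y (f i)))) (\<lambda>v. \<lambda>n\<in>I. v (f n))"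
    unfolding U by (intro distr_cong s2[symmetric] refl)
  also have "\<dots> = Pi\<^sub>M I (\<lambda>i. distr M borel (Y (f i)))"
    using f by (intro distr_PiM_reindex prob_space_distr) auto
  also have "\<dots> = Pi\<^sub>M I (\<lambda>_. distr M borel (Y 0))" by (simp add: ident[of "f _"])
  finally show ?thesis .
qed

lemma expectation_steps_reindex:
  fixes G :: "(nat \<Rightarrow> real) \<Rightarrow> real"
  assumes f: "inj_on f I" and G: "G \<in> borel_measurable (Pi\<^sub>M I (\<lambda>_. borel))"
  shows "expectation (\<lambda>\<omega>. G (\<lambda>i\<in>I. Y (f i) \<omega>)) = expectation (\<lambda>\<omega>. G (\<lambda>i\<in>I. Y i \<omega>))"
proof -
  have "expectation (\<lambda>\<omega>. G (\<lambda>i\<in>I. Y (f i) \<omega>)) = (LINT v|distr M (Pi\<^sub>M I (\<lambda>_. borel)) (\<lambda>\<omega>. \<lambda>i\<in>I. Y (f i) \<omega>). G v)"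
    by (intro integral_distr[symmetric] measurable_restrict measurable_Y G)
  also have "\<dots> = (LINT v|distr M (Pi\<^sub>M I (\<lambda>_. borel)) (\<lambda>\<omega>. \<lambda>i\<in>I. Y i \<omega>). G v)"
    using distr_steps[OF f] distr_steps[of "\<lambda>i. i" I] by simp
  also have "\<dots> = expectation (\<lambda>\<omega>. G (\<lambda>i\<in>I. Y i \<omega>))"
    by (intro integral_distr measurable_restrict measurable_Y G)
  finally show ?thesis .
qed

end

text \<open>Measurability is stated for functions of the coordinates in \<open>I\<close> only, so that independence of disjoint blocks of
  steps can be applied.\<close>

lemma measurable_psum:
  assumes "\<And>i. i < n \<Longrightarrow> f i \<in> I"
  shows "(\<lambda>v. psum (\<lambda>i. v (f i)) n) \<in> borel_measurable (Pi\<^sub>M I (\<lambda>_. borel))"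
  unfolding psum_def using assms by (intro borel_measurable_sum measurable_component_singleton) auto

lemma ladder_ball: "ladder k v \<longleftrightarrow> (\<forall>j\<in>{..<k}. psum v j < psum v k)"
  and nonpos_ball: "nonpos m v \<longleftrightarrow> (\<forall>j\<in>{..m}. psum v j \<le> 0)"
  by (auto simp: ladder_def nonpos_def)

lemma measurable_ladder:
  assumes f: "\<And>i. i < n \<Longrightarrow> f i \<in> I" and g: "g \<in> borel_measurable borel"
  shows "(\<lambda>v. of_bool (ladder n (\<lambda>i. v (f i))) * (g (psum (\<lambda>i. v (f i)) n) :: real)) \<in> borel_measurable (Pi\<^sub>M I (\<lambda>_. borel))"
proof -
  have m: "(\<lambda>v. psum (\<lambda>i. v (f i)) j) \<in> borel_measurable (Pi\<^sub>M I (\<lambda>_. borel))" if "j \<le> n" for j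
    using that f by (intro measurable_psum) auto
  have [measurable]: "Measurable.pred (Pi\<^sub>M I (\<lambda>_. borel)) (\<lambda>v. \<forall>j\<in>{..<n}. psum (\<lambda>i. v (f i)) j < psum (\<lambda>i. v (f i)) n)"
    by (intro pred_intros_finite borel_measurable_pred_less m) auto
  have [measurable]: "(\<lambda>v. g (psum (\<lambda>i. v (f i)) n)) \<in> borel_measurable (Pi\<^sub>M I (\<lambda>_. borel))"
    by (rule measurable_compose[OF m g]) simp
  have "(\<lambda>v. of_bool (\<forall>j\<in>{..<n}. psum (\<lambda>i. v (f i)) j < psum (\<lambda>i. v (f i)) n) * g (psum (\<lambda>i. v (f i)) n))
     \<in> borel_measurable (Pi\<^sub>M I (\<lambda>_. borel))"
    by measurable
  then show ?thesis unfolding ladder_ball .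
qed

lemma measurable_nonpos:
  assumes f: "\<And>i. i < n \<Longrightarrow> f i \<in> I" and g: "g \<in> borel_measurable borel"
  shows "(\<lambda>v. of_bool (nonpos n (\<lambda>i. v (f i))) * (g (psum (\<lambda>i. v (f i)) n) :: real)) \<in> borel_measurable (Pi\<^sub>M I (\<lambda>_. borel))"
proof -
  have m: "(\<lambda>v. psum (\<lambda>i. v (f i)) j) \<in> borel_measurable (Pi\<^sub>M I (\<lambda>_. borel))" if "j \<le> n" for j
    using that f by (intro measurable_psum) auto
  have p: "Measurable.pred (Pi\<^sub>M I (\<lambda>_. borel)) (\<lambda>v. psum (\<lambda>i. v (f i)) j \<le> 0)" if "j \<le> n" for j
    using m[OF that] by measurable
  have [measurable]: "Measurable.pred (Pi\<^sub>M I (\<lambda>_. borel)) (\<lambda>v. \<forall>j\<in>{..n}. psum (\<lambda>i. v (f i)) j \<le> 0)"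
    by (intro pred_intros_finite p) auto
  have [measurable]: "(\<lambda>v. g (psum (\<lambda>i. v (f i)) n)) \<in> borel_measurable (Pi\<^sub>M I (\<lambda>_. borel))"
    by (rule measurable_compose[OF m g]) simp
  have "(\<lambda>v. of_bool (\<forall>j\<in>{..n}. psum (\<lambda>i. v (f i)) j \<le> 0) * g (psum (\<lambda>i. v (f i)) n))
     \<in> borel_measurable (Pi\<^sub>M I (\<lambda>_. borel))"
    by measurable
  then show ?thesis unfolding nonpos_ball .
qed

lemma measurable_walk_min:
  "(\<lambda>v. walk_min n v) \<in> borel_measurable (Pi\<^sub>M {..<n} (\<lambda>_. borel))"
proof -
  have "(\<lambda>v. Min ((\<lambda>j. psum v j) ` {..n})) \<in> borel_measurable (Pi\<^sub>M {..<n} (\<lambda>_. borel))"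
    by (rule borel_measurable_Min) (use measurable_psum[of _ "\<lambda>i. i" "{..<n}"] in auto)
  then show ?thesis unfolding walk_min_def .
qed

lemma ladder_restrict: "n \<le> m \<Longrightarrow> ladder n (\<lambda>i\<in>{..<m}. v i) = ladder n v"
  unfolding ladder_def by (intro all_cong) (simp add: psum_restrict)

lemma nonpos_restrict: "n \<le> m \<Longrightarrow> nonpos n (\<lambda>i\<in>{..<m}. v i) = nonpos n v"
  unfolding nonpos_def by (intro all_cong) (simp add: psum_restrict)

lemma walk_min_restrict: "walk_min n (\<lambda>i\<in>{..<n}. v i) = walk_min n v"
  unfolding walk_min_def by (intro arg_cong[of _ _ Min] image_cong) (auto simp: psum_restrict)

context iid_steps begin

lemma measurable_walk[measurable]:
  "(\<lambda>\<omega>. psum (\<lambda>i. Y i \<omega>) n) \<in> borel_measurable M"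
  "(\<lambda>\<omega>. walk_max n (\<lambda>i. Y i \<omega>)) \<in> borel_measurable M"
  "(\<lambda>\<omega>. walk_min n (\<lambda>i. Y i \<omega>)) \<in> borel_measurable M"
proof -
  show 1: "(\<lambda>\<omega>. psum (\<lambda>i. Y i \<omega>) n) \<in> borel_measurable M" for n
    unfolding psum_def by (intro borel_measurable_sum measurable_Y)
  have "(\<lambda>\<omega>. Max ((\<lambda>j. psum (\<lambda>i. Y i \<omega>) j) ` {..n})) \<in> borel_measurable M"
    by (rule borel_measurable_Max) (use 1 in auto)
  then show "(\<lambda>\<omega>. walk_max n (\<lambda>i. Y i \<omega>)) \<in> borel_measurable M" by (simp add: walk_max_def)
  have "(\<lambda>\<omega>. Min ((\<lambda>j. psum (\<lambda>i. Y i \<omega>) j) ` {..n})) \<in> borel_measurable M"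
    by (rule borel_measurable_Min) (use 1 in auto)
  then show "(\<lambda>\<omega>. walk_min n (\<lambda>i. Y i \<omega>)) \<in> borel_measurable M" by (simp add: walk_min_def)
qed

definition ladder_mean :: "(real \<Rightarrow> real) \<Rightarrow> nat \<Rightarrow> real" where
  "ladder_mean g k = expectation (\<lambda>\<omega>. of_bool (ladder k (\<lambda>i. Y i \<omega>)) * g (psum (\<lambda>i. Y i \<omega>) k))"

definition nonpos_mean :: "(real \<Rightarrow> real) \<Rightarrow> nat \<Rightarrow> real" where
  "nonpos_mean h m = expectation (\<lambda>\<omega>. of_bool (nonpos m (\<lambda>i. Y i \<omega>)) * h (psum (\<lambda>i. Y i \<omega>) m))"

text \<open>The two factors depend on the disjoint blocks of steps before and after \<open>k\<close>, and the second block has the law of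
  the first \<open>n - k\<close> steps.\<close>

lemma expectation_split:
  assumes g: "g \<in> borel_measurable borel" "\<And>x. \<bar>g x\<bar> \<le> C"
    and h: "h \<in> borel_measurable borel" "\<And>x. \<bar>h x\<bar> \<le> C" and k: "k \<le> n"
  defines "U \<equiv> \<lambda>\<omega>. of_bool (ladder k (\<lambda>i. Y i \<omega>)) * g (psum (\<lambda>i. Y i \<omega>) k)"
    and "V \<equiv> \<lambda>\<omega>. of_bool (nonpos (n - k) (\<lambda>i. Y (k + i) \<omega>)) * h (psum (\<lambda>i. Y (k + i) \<omega>) (n - k))"
  shows "integrable M (\<lambda>\<omega>. U \<omega> * V \<omega>)" and "expectation (\<lambda>\<omega>. U \<omega> * V \<omega>) = ladder_mean g k * nonpos_mean h (n - k)"
    and "\<bar>ladder_mean g k\<bar> \<le> C" "\<bar>nonpos_mean h (n - k)\<bar> \<le> C"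
proof -
  have C0: "C \<ge> 0" using g(2)[of 0] by linarith
  define G where "G v = of_bool (ladder k v) * g (psum v k)" for v
  define H where "H v = of_bool (nonpos (n - k) (\<lambda>i. v (k + i))) * h (psum (\<lambda>i. v (k + i)) (n - k))" for v
  define H' where "H' v = of_bool (nonpos (n - k) v) * h (psum v (n - k))" for v
  have mG: "G \<in> borel_measurable (Pi\<^sub>M {..<k} (\<lambda>_. borel))"
    unfolding G_def by (rule measurable_ladder[where f="\<lambda>i. i"]) (auto simp: g)
  have mH: "H \<in> borel_measurable (Pi\<^sub>M {k..<n} (\<lambda>_. borel))"
    unfolding H_def by (rule measurable_nonpos[where f="\<lambda>i. k + i"]) (auto simp: h)
  have mH': "H' \<in> borel_measurable (Pi\<^sub>M {..<n - k} (\<lambda>_. borel))"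
    unfolding H'_def by (rule measurable_nonpos[where f="\<lambda>i. i"]) (auto simp: h)
  have U: "U = G \<circ> (\<lambda>\<omega>. \<lambda>i\<in>{..<k}. Y i \<omega>)"
    unfolding U_def G_def by (simp add: fun_eq_iff ladder_restrict psum_restrict)
  have V: "V = H \<circ> (\<lambda>\<omega>. \<lambda>i\<in>{k..<n}. Y i \<omega>)"
  proof -
    have ps: "psum (\<lambda>i. (\<lambda>i\<in>{k..<n}. Y i \<omega>) (k + i)) j = psum (\<lambda>i. Y (k + i) \<omega>) j" if "j \<le> n - k" for j \<omega>
      unfolding psum_def using that by (intro sum.cong) auto
    show ?thesis unfolding V_def H_def nonpos_def comp_def using ps by (intro ext) (auto intro!: arg_cong2[where f="(*)"])
  qed
  have iv: "indep_var (Pi\<^sub>M {..<k} (\<lambda>_. borel)) (\<lambda>\<omega>. \<lambda>i\<in>{..<k}. Y i \<omega>) (Pi\<^sub>M {k..<n} (\<lambda>_. borel)) (\<lambda>\<omega>. \<lambda>i\<in>{k..<n}. Y i \<omega>)"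
    by (rule indep_var_restrict[OF indep]) auto
  have ind: "indep_var borel U borel V"
    unfolding U V by (rule indep_var_compose[OF iv mG mH])
  have mU: "U \<in> borel_measurable M" and mV: "V \<in> borel_measurable M"
    using ind unfolding indep_var_eq by auto
  have bU: "\<bar>U \<omega>\<bar> \<le> C" and bV: "\<bar>V \<omega>\<bar> \<le> C" for \<omega>
    unfolding U_def V_def using g(2) h(2) C0 by (auto simp: abs_mult)
  have iU: "integrable M U" and iV: "integrable M V"
    by (rule integrable_const_bound[where B=C]; use bU bV mU mV in auto)+
  show "integrable M (\<lambda>\<omega>. U \<omega> * V \<omega>)" by (rule indep_var_integrable[OF ind iU iV])
  have "expectation (\<lambda>\<omega>. U \<omega> * V \<omega>) = expectation U * expectation V"
    by (rule indep_var_lebesgue_integral[OF ind iU iV])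
  moreover have "expectation U = ladder_mean g k" unfolding U_def ladder_mean_def ..
  moreover have EV: "expectation V = nonpos_mean h (n - k)"
  proof -
    have VH: "V = (\<lambda>\<omega>. H' (\<lambda>i\<in>{..<n - k}. Y (k + i) \<omega>))"
      unfolding V_def H'_def by (simp add: nonpos_restrict psum_restrict)
    have "expectation V = expectation (\<lambda>\<omega>. H' (\<lambda>i\<in>{..<n - k}. Y i \<omega>))"
      unfolding VH by (rule expectation_steps_reindex[OF _ mH']) simp
    also have "\<dots> = nonpos_mean h (n - k)" unfolding nonpos_mean_def H'_def by (simp add: nonpos_restrict psum_restrict)
    finally show ?thesis .
  qed
  ultimately show "expectation (\<lambda>\<omega>. U \<omega> * V \<omega>) = ladder_mean g k * nonpos_mean h (n - k)" by simp
  have b: "\<bar>expectation W\<bar> \<le> C" if "W \<in> borel_measurable M" "\<And>\<omega>. \<bar>W \<omega>\<bar> \<le> C" for W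
  proof -
    have "\<bar>expectation W\<bar> \<le> expectation (\<lambda>\<omega>. \<bar>W \<omega>\<bar>)" by (rule integral_abs_bound)
    also have "\<dots> \<le> expectation (\<lambda>\<omega>. C)"
      by (intro integral_mono_AE integrable_const_bound[where B=C] AE_I2) (use that C0 in auto)
    finally show ?thesis by (simp add: prob_space)
  qed
  show "\<bar>ladder_mean g k\<bar> \<le> C" using b[OF mU bU] unfolding U_def ladder_mean_def .
  show "\<bar>nonpos_mean h (n - k)\<bar> \<le> C" using b[OF mV bV] unfolding EV .
qed

text \<open>The mean of \<open>g\<close> of the maximum times \<open>h\<close> of the drawdown from it when the walk is stopped at an
  independent time \<open>N\<close> with \<open>P (N = n) = (1 - p) * p ^ n\<close>.\<close>

definition mean_at_geometric_time :: "real \<Rightarrow> (real \<Rightarrow> real) \<Rightarrow> (real \<Rightarrow> real) \<Rightarrow> real" where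
  "mean_at_geometric_time p g h = (1 - p) * (\<Sum>n. p ^ n * expectation (\<lambda>\<omega>.
     g (walk_max n (\<lambda>i. Y i \<omega>)) * h (psum (\<lambda>i. Y i \<omega>) n - walk_max n (\<lambda>i. Y i \<omega>))))"

lemma mean_at_geometric_time_eq:
  assumes p: "0 \<le> p" "p < 1"
    and g: "g \<in> borel_measurable borel" "\<And>x. \<bar>g x\<bar> \<le> C"
    and h: "h \<in> borel_measurable borel" "\<And>x. \<bar>h x\<bar> \<le> C"
  shows "mean_at_geometric_time p g h = (1 - p) * (\<Sum>k. p ^ k * ladder_mean g k) * (\<Sum>k. p ^ k * nonpos_mean h k)"
proof -
  have "expectation (\<lambda>\<omega>. g (walk_max n (\<lambda>i. Y i \<omega>)) * h (psum (\<lambda>i. Y i \<omega>) n - walk_max n (\<lambda>i. Y i \<omega>)))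
     = (\<Sum>k\<le>n. ladder_mean g k * nonpos_mean h (n - k))" for n
    unfolding walk_max_decomposition using expectation_split(1,2)[OF g h]
    by (subst Bochner_Integration.integral_sum) auto
  then have eq: "p ^ n * expectation (\<lambda>\<omega>. g (walk_max n (\<lambda>i. Y i \<omega>)) * h (psum (\<lambda>i. Y i \<omega>) n - walk_max n (\<lambda>i. Y i \<omega>)))
     = (\<Sum>k\<le>n. (p ^ k * ladder_mean g k) * (p ^ (n - k) * nonpos_mean h (n - k)))" for n
    by (auto simp: sum_distrib_left power_add[symmetric] intro!: sum.cong)
  have s: "summable (\<lambda>k. norm (p ^ k * a k))" if "\<And>k. \<bar>a k\<bar> \<le> C" for a
  proof (rule summable_comparison_test')
    show "summable (\<lambda>k. C * p ^ k)" using p by (intro summable_mult summable_geometric) auto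
    show "norm (norm (p ^ k * a k)) \<le> C * p ^ k" if "0 \<le> k" for k
      using p \<open>\<And>k. \<bar>a k\<bar> \<le> C\<close>[of k] by (simp add: abs_mult mult.commute mult_right_mono)
  qed
  have "\<bar>ladder_mean g k\<bar> \<le> C" for k using expectation_split(3)[OF g h, of k k] by simp
  moreover have "\<bar>nonpos_mean h k\<bar> \<le> C" for k using expectation_split(4)[OF g h, of 0 k] by simp
  ultimately show ?thesis
    unfolding mean_at_geometric_time_def eq using Cauchy_product_sums[OF s s] by (simp add: sums_iff mult.assoc)
qed

text \<open>By the Cauchy product the mean is \<open>(1 - p) * a g * b h\<close>. The constant function 1 gives \<open>(1 - p) * a 1 * b 1 = 1\<close>, which
  eliminates the unknown normalisations.\<close>

theorem geometric_time_factorization: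
  assumes p: "0 \<le> p" "p < 1"
    and g: "g \<in> borel_measurable borel" "\<And>x. \<bar>g x\<bar> \<le> C"
    and h: "h \<in> borel_measurable borel" "\<And>x. \<bar>h x\<bar> \<le> C"
  shows "mean_at_geometric_time p g h = mean_at_geometric_time p g (\<lambda>_. 1) * mean_at_geometric_time p (\<lambda>_. 1) h"
proof -
  define D where "D = max C 1"
  have gh: "\<And>x. \<bar>g x\<bar> \<le> D" "\<And>x. \<bar>h x\<bar> \<le> D" "\<And>x::real. \<bar>1\<bar> \<le> D"
    using g(2) h(2) unfolding D_def by (auto simp: le_max_iff_disj)
  have 1: "(\<lambda>_. 1::real) \<in> borel_measurable borel" by simp
  define a b where "a g = (\<Sum>k. p ^ k * ladder_mean g k)" and "b h = (\<Sum>k. p ^ k * nonpos_mean h k)" for g h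
  have "mean_at_geometric_time p (\<lambda>_. 1) (\<lambda>_. 1) = (1 - p) * (\<Sum>n. p ^ n)"
    unfolding mean_at_geometric_time_def by (simp add: prob_space)
  also have "\<dots> = 1" using p by (subst suminf_geometric) auto
  finally have one: "(1 - p) * a (\<lambda>_. 1) * b (\<lambda>_. 1) = 1"
    using mean_at_geometric_time_eq[OF p 1 gh(3) 1 gh(3)] unfolding a_def b_def by simp
  have "mean_at_geometric_time p g h = (1 - p) * a g * b h * ((1 - p) * a (\<lambda>_. 1) * b (\<lambda>_. 1))"
    using mean_at_geometric_time_eq[OF p g(1) gh(1) h(1) gh(2)] one unfolding a_def b_def by simp
  also have "\<dots> = ((1 - p) * a g * b (\<lambda>_. 1)) * ((1 - p) * a (\<lambda>_. 1) * b h)" by simp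
  finally show ?thesis
    using mean_at_geometric_time_eq[OF p g(1) gh(1) 1 gh(3)] mean_at_geometric_time_eq[OF p 1 gh(3) h(1) gh(2)]
    unfolding a_def b_def by simp
qed

lemma expectation_walk_reversal:
  assumes h: "h \<in> borel_measurable borel"
  shows "expectation (\<lambda>\<omega>. h (psum (\<lambda>i. Y i \<omega>) n - walk_max n (\<lambda>i. Y i \<omega>)))
       = expectation (\<lambda>\<omega>. h (walk_min n (\<lambda>i. Y i \<omega>)) :: real)"
proof -
  have m: "(\<lambda>v. h (walk_min n v)) \<in> borel_measurable (Pi\<^sub>M {..<n} (\<lambda>_. borel))"
    by (rule measurable_compose[OF measurable_walk_min h])
  have "expectation (\<lambda>\<omega>. h (walk_min n (\<lambda>i\<in>{..<n}. Y (n - 1 - i) \<omega>))) = expectation (\<lambda>\<omega>. h (walk_min n (\<lambda>i\<in>{..<n}. Y i \<omega>)))"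
    by (rule expectation_steps_reindex[OF _ m]) (auto simp: inj_on_def)
  then show ?thesis unfolding walk_min_restrict walk_reversal[of "\<lambda>i. Y i _"] .
qed

end

section \<open>Independence and equality of laws from continuous test functions\<close>

lemma cts_step_bounds: "a < b \<Longrightarrow> 0 \<le> cts_step a b x \<and> cts_step a b x \<le> 1"
  unfolding cts_step_def by (auto simp: field_simps)

lemma continuous_cts_step: "a < b \<Longrightarrow> continuous_on UNIV (cts_step a b)"
  using cts_step_uniformly_continuous uniformly_continuous_imp_continuous by blast

lemma cts_step_tendsto_indicator:
  "(\<lambda>n. cts_step a (a + 1 / real (Suc n)) x) \<longlonglongrightarrow> indicator {..a} x"
proof (cases "x \<le> a")
  case True
  then show ?thesis by (simp add: cts_step_def)
next
  case False
  have "(\<lambda>n. a + 1 / real (Suc n)) \<longlonglongrightarrow> a"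
    using tendsto_add[OF tendsto_const LIMSEQ_Suc[OF lim_1_over_n], of a] by simp
  from order_tendstoD(2)[OF this, of x] False
  have "eventually (\<lambda>n. cts_step a (a + 1 / real (Suc n)) x = indicator {..a} x) sequentially"
    by (auto elim!: eventually_mono simp: cts_step_def)
  then show ?thesis by (rule tendsto_eventually)
qed

context prob_space begin

lemma expectation_cts_step_tendsto:
  assumes [measurable]: "S \<in> borel_measurable M" "Z \<in> borel_measurable M"
  shows "(\<lambda>n. expectation (\<lambda>\<omega>. cts_step a (a + 1 / real (Suc n)) (S \<omega>) * cts_step b (b + 1 / real (Suc n)) (Z \<omega>)))
      \<longlonglongrightarrow> prob {\<omega>\<in>space M. S \<omega> \<le> a \<and> Z \<omega> \<le> b}"
    and "(\<lambda>n. expectation (\<lambda>\<omega>. cts_step a (a + 1 / real (Suc n)) (S \<omega>))) \<longlonglongrightarrow> prob {\<omega>\<in>space M. S \<omega> \<le> a}"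
proof -
  have m[measurable]: "cts_step c (c + 1 / real (Suc n)) \<in> borel_measurable borel" for c n
    by (intro borel_measurable_continuous_onI continuous_cts_step) auto
  have b: "0 \<le> cts_step c (c + 1 / real (Suc n)) x" "cts_step c (c + 1 / real (Suc n)) x \<le> 1" for c n x
    using cts_step_bounds[of c "c + 1 / real (Suc n)" x] by auto
  have "(\<lambda>n. expectation (\<lambda>\<omega>. cts_step a (a + 1 / real (Suc n)) (S \<omega>) * cts_step b (b + 1 / real (Suc n)) (Z \<omega>)))
      \<longlonglongrightarrow> expectation (\<lambda>\<omega>. indicator {..a} (S \<omega>) * indicator {..b} (Z \<omega>))"
  proof (rule integral_dominated_convergence)
    show "integrable M (\<lambda>_. 1::real)" by simp
    show "AE \<omega> in M. norm (cts_step a (a + 1 / real (Suc n)) (S \<omega>) * cts_step b (b + 1 / real (Suc n)) (Z \<omega>)) \<le> 1" for n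
      using b by (intro AE_I2) (auto simp: abs_mult intro!: mult_le_one)
    show "AE \<omega> in M. (\<lambda>n. cts_step a (a + 1 / real (Suc n)) (S \<omega>) * cts_step b (b + 1 / real (Suc n)) (Z \<omega>)) \<longlonglongrightarrow> indicator {..a} (S \<omega>) * indicator {..b} (Z \<omega>)"
      by (intro AE_I2 tendsto_mult cts_step_tendsto_indicator)
  qed measurable
  also have "expectation (\<lambda>\<omega>. indicator {..a} (S \<omega>) * indicator {..b} (Z \<omega>) :: real) =
      expectation (indicator {\<omega>\<in>space M. S \<omega> \<le> a \<and> Z \<omega> \<le> b})"
    by (intro Bochner_Integration.integral_cong) (auto simp: indicator_def)
  finally show "(\<lambda>n. expectation (\<lambda>\<omega>. cts_step a (a + 1 / real (Suc n)) (S \<omega>) * cts_step b (b + 1 / real (Suc n)) (Z \<omega>)))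
      \<longlonglongrightarrow> prob {\<omega>\<in>space M. S \<omega> \<le> a \<and> Z \<omega> \<le> b}" by simp
  have "(\<lambda>n. expectation (\<lambda>\<omega>. cts_step a (a + 1 / real (Suc n)) (S \<omega>)))
      \<longlonglongrightarrow> expectation (\<lambda>\<omega>. indicator {..a} (S \<omega>))"
  proof (rule integral_dominated_convergence)
    show "integrable M (\<lambda>_. 1::real)" by simp
    show "AE \<omega> in M. norm (cts_step a (a + 1 / real (Suc n)) (S \<omega>)) \<le> 1" for n
      using b by (intro AE_I2) auto
    show "AE \<omega> in M. (\<lambda>n. cts_step a (a + 1 / real (Suc n)) (S \<omega>)) \<longlonglongrightarrow> indicator {..a} (S \<omega>)"
      by (intro AE_I2 cts_step_tendsto_indicator)
  qed measurable
  also have "expectation (\<lambda>\<omega>. indicator {..a} (S \<omega>) :: real) = expectation (indicator {\<omega>\<in>space M. S \<omega> \<le> a})"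
    by (intro Bochner_Integration.integral_cong) (auto simp: indicator_def)
  finally show "(\<lambda>n. expectation (\<lambda>\<omega>. cts_step a (a + 1 / real (Suc n)) (S \<omega>))) \<longlonglongrightarrow> prob {\<omega>\<in>space M. S \<omega> \<le> a}" by simp
qed

text \<open>Continuous steps decrease to indicators of half-lines, which form a generator of the Borel sets that is closed under
  intersection. Continuous test functions are what a limit of discretised paths can deliver.\<close>

lemma indep_var_of_continuous_expectations:
  fixes S Z :: "'a \<Rightarrow> real"
  assumes S: "S \<in> borel_measurable M" and Z: "Z \<in> borel_measurable M"
    and prod: "\<And>g h :: real \<Rightarrow> real. continuous_on UNIV g \<Longrightarrow> continuous_on UNIV h \<Longrightarrow>
      (\<And>x. \<bar>g x\<bar> \<le> 1) \<Longrightarrow> (\<And>x. \<bar>h x\<bar> \<le> 1) \<Longrightarrow>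
      expectation (\<lambda>\<omega>. g (S \<omega>) * h (Z \<omega>)) = expectation (\<lambda>\<omega>. g (S \<omega>)) * expectation (\<lambda>\<omega>. h (Z \<omega>))"
  shows "indep_var borel S borel Z"
proof -
  have pr: "prob {\<omega>\<in>space M. S \<omega> \<le> a \<and> Z \<omega> \<le> b} = prob {\<omega>\<in>space M. S \<omega> \<le> a} * prob {\<omega>\<in>space M. Z \<omega> \<le> b}" for a b
  proof -
    have "(\<lambda>n. expectation (\<lambda>\<omega>. cts_step a (a + 1 / real (Suc n)) (S \<omega>) * cts_step b (b + 1 / real (Suc n)) (Z \<omega>)))
      \<longlonglongrightarrow> prob {\<omega>\<in>space M. S \<omega> \<le> a} * prob {\<omega>\<in>space M. Z \<omega> \<le> b}"
    proof (subst prod)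
      show "\<bar>cts_step c (c + 1 / real (Suc n)) x\<bar> \<le> 1" for c n x
        using cts_step_bounds[of c "c + 1 / real (Suc n)" x] by auto
      then show "\<bar>cts_step c (c + 1 / real (Suc n)) x\<bar> \<le> 1" for c n x .
      show "(\<lambda>n. expectation (\<lambda>\<omega>. cts_step a (a + 1 / real (Suc n)) (S \<omega>)) * expectation (\<lambda>\<omega>. cts_step b (b + 1 / real (Suc n)) (Z \<omega>)))
        \<longlonglongrightarrow> prob {\<omega>\<in>space M. S \<omega> \<le> a} * prob {\<omega>\<in>space M. Z \<omega> \<le> b}"
        by (intro tendsto_mult expectation_cts_step_tendsto(2)[OF S Z] expectation_cts_step_tendsto(2)[OF Z S])
    qed (auto intro!: continuous_cts_step)
    with expectation_cts_step_tendsto(1)[OF S Z] show ?thesis by (rule LIMSEQ_unique)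
  qed
  define F where "F W = {W -` {..a} \<inter> space M | a. True}" for W :: "'a \<Rightarrow> real"
  have F: "sigma_sets (space M) {W -` A \<inter> space M | A. A \<in> sets borel} = sigma_sets (space M) (F W)" for W :: "'a \<Rightarrow> real"
  proof -
    have "{W -` A \<inter> space M | A. A \<in> sets borel} = sigma_sets (space M) {W -` A \<inter> space M | A. A \<in> range atMost}"
      unfolding borel_eq_atMost by (subst sets_measure_of) (auto simp: sigma_sets_vimage_commute)
    also have "{W -` A \<inter> space M | A. A \<in> range atMost} = F W" unfolding F_def by auto
    finally show ?thesis
      by (simp only:) (rule sigma_sets_sigma_sets_eq, auto simp: F_def)
  qed
  have Fs: "Int_stable (F W)" for W
  proof (rule Int_stableI)
    fix A B assume "A \<in> F W" "B \<in> F W"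
    then obtain a b where "A = W -` {..a} \<inter> space M" "B = W -` {..b} \<inter> space M" unfolding F_def by auto
    then have "A \<inter> B = W -` {..min a b} \<inter> space M" by auto
    then show "A \<inter> B \<in> F W" unfolding F_def by blast
  qed
  have "indep_set (F S) (F Z)"
  proof (rule indep_setI)
    show "F S \<subseteq> events" "F Z \<subseteq> events" using S Z unfolding F_def by auto
    fix A B assume "A \<in> F S" "B \<in> F Z"
    then obtain a b where AB: "A = S -` {..a} \<inter> space M" "B = Z -` {..b} \<inter> space M" unfolding F_def by auto
    have "A \<inter> B = {\<omega>\<in>space M. S \<omega> \<le> a \<and> Z \<omega> \<le> b}" "A = {\<omega>\<in>space M. S \<omega> \<le> a}" "B = {\<omega>\<in>space M. Z \<omega> \<le> b}"
      unfolding AB by auto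
    then show "prob (A \<inter> B) = prob A * prob B" using pr by simp
  qed
  then show ?thesis unfolding indep_var_eq F using S Z Fs by (intro conjI indep_set_sigma_sets)
qed

lemma distr_eq_of_continuous_expectations:
  fixes I Z :: "'a \<Rightarrow> real"
  assumes I: "I \<in> borel_measurable M" and Z: "Z \<in> borel_measurable M"
    and eq: "\<And>h :: real \<Rightarrow> real. continuous_on UNIV h \<Longrightarrow> (\<And>x. \<bar>h x\<bar> \<le> 1) \<Longrightarrow>
      expectation (\<lambda>\<omega>. h (Z \<omega>)) = expectation (\<lambda>\<omega>. h (I \<omega>))"
  shows "distr M borel Z = distr M borel I"
proof (rule cdf_unique)
  show "real_distribution (distr M borel Z)" "real_distribution (distr M borel I)"
    using I Z by (auto intro: real_distribution_distr)
  show "cdf (distr M borel Z) = cdf (distr M borel I)"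
  proof
    fix a
    have "(\<lambda>n. expectation (\<lambda>\<omega>. cts_step a (a + 1 / real (Suc n)) (Z \<omega>))) \<longlonglongrightarrow> prob {\<omega>\<in>space M. I \<omega> \<le> a}"
    proof (subst eq)
      show "\<bar>cts_step a (a + 1 / real (Suc n)) x\<bar> \<le> 1" for n x
        using cts_step_bounds[of a "a + 1 / real (Suc n)" x] by auto
    qed (auto intro!: continuous_cts_step expectation_cts_step_tendsto(2)[OF I I] simp del: of_nat_Suc)
    with expectation_cts_step_tendsto(2)[OF Z Z, of a] have "prob {\<omega>\<in>space M. Z \<omega> \<le> a} = prob {\<omega>\<in>space M. I \<omega> \<le> a}"
      by (rule LIMSEQ_unique)
    moreover have "W -` {..a} \<inter> space M = {\<omega>\<in>space M. W \<omega> \<le> a}" for W :: "'a \<Rightarrow> real" by auto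
    ultimately show "cdf (distr M borel Z) a = cdf (distr M borel I) a"
      using I Z by (simp add: cdf_def measure_distr)
  qed
qed

end


section \<open>Wiener--Hopf factorisation at an exponential time\<close>

context levy_process begin

text \<open>This makes the supremum and the infimum in \<open>running_sup\<close> and \<open>running_inf\<close> genuine; on an unbounded set they would
  be default values.\<close>

lemma path_bounded:
  assumes "\<omega> \<in> space M"
  shows "bdd_above ((\<lambda>s. X s \<omega>) ` {0..t})" "bdd_below ((\<lambda>s. X s \<omega>) ` {0..t})"
proof -
  have "\<exists>B. \<forall>s\<in>{0..t}. \<bar>X s \<omega>\<bar> \<le> B"
  proof (cases "0 \<le> t")
    case True
    show ?thesis
      by (rule cadlag_bounded_abs[OF _ _ True]) (use assms right_continuous left_limits in auto)
  qed auto
  then obtain B where B: "\<forall>s\<in>{0..t}. \<bar>X s \<omega>\<bar> \<le> B" ..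
  then show "bdd_above ((\<lambda>s. X s \<omega>) ` {0..t})" "bdd_below ((\<lambda>s. X s \<omega>) ` {0..t})"
    using B by (force intro!: bdd_aboveI[of _ B] bdd_belowI[of _ "-B"])+
qed

definition increment :: "nat \<Rightarrow> nat \<Rightarrow> 'a \<Rightarrow> real" where
  "increment m i \<omega> = X (real (Suc i) / real (Suc m)) \<omega> - X (real i / real (Suc m)) \<omega>"

lemma iid_increments: "iid_steps M (increment m)"
proof
  have iv: "indep_vars (\<lambda>_. borel) (increment m) {..<n}" for n
    unfolding increment_def by (rule indep_increments) (auto intro!: divide_right_mono)
  show "indep_vars (\<lambda>_. borel) (increment m) UNIV"
    unfolding indep_vars_def2
  proof (intro conjI ballI)
    show "increment m i \<in> borel_measurable M" for i
      unfolding increment_def by (intro borel_measurable_diff measurable_X) auto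
    show "indep_sets (\<lambda>i. {increment m i -` A \<inter> space M |A. A \<in> sets borel}) UNIV"
    proof (subst indep_sets_finite_index_sets, intro allI impI)
      fix J :: "nat set" assume "finite J"
      then have "J \<subseteq> {..<Suc (Max (insert 0 J))}" by (auto simp: less_Suc_eq_le)
      then show "indep_sets (\<lambda>i. {increment m i -` A \<inter> space M |A. A \<in> sets borel}) J"
        using iv[of "Suc (Max (insert 0 J))"] unfolding indep_vars_def2 by (blast intro: indep_sets_mono_index)
    qed
  qed
  have "distr M borel (increment m i) = distr M borel (X (1 / real (Suc m)))" for i
  proof -
    have "real (Suc i) / real (Suc m) = real i / real (Suc m) + 1 / real (Suc m)" by (simp add: field_simps)
    then show ?thesis
      using stationary_increments[of "real i / real (Suc m)" "1 / real (Suc m)"]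
      unfolding increment_def by simp
  qed
  then show "distr M borel (increment m i) = distr M borel (increment m 0)" for i by metis
qed

lemma psum_increment:
  assumes "\<omega> \<in> space M"
  shows "psum (\<lambda>i. increment m i \<omega>) n = X (real n / real (Suc m)) \<omega>"
  using assms by (induction n) (simp_all add: psum_def increment_def start_zero)

lemma walk_increment:
  assumes "\<omega> \<in> space M"
  shows "walk_max n (\<lambda>i. increment m i \<omega>) = Max ((\<lambda>j. X (real j / real (Suc m)) \<omega>) ` {..n})"
    and "walk_min n (\<lambda>i. increment m i \<omega>) = Min ((\<lambda>j. X (real j / real (Suc m)) \<omega>) ` {..n})"
  unfolding walk_max_def walk_min_def psum_increment[OF assms, abs_def] by auto

lemma grid_limits:
  assumes "\<omega> \<in> space M" and t: "0 \<le> t"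
  shows "(\<lambda>m. X (real (grid m t) / real (Suc m)) \<omega>) \<longlonglongrightarrow> X t \<omega>"
    and "(\<lambda>m. walk_max (grid m t) (\<lambda>i. increment m i \<omega>)) \<longlonglongrightarrow> running_sup X t \<omega>"
    and "(\<lambda>m. walk_min (grid m t) (\<lambda>i. increment m i \<omega>)) \<longlonglongrightarrow> running_inf X t \<omega>"
proof -
  have rc: "((\<lambda>s. X s \<omega>) \<longlongrightarrow> X s \<omega>) (at_right s)" if "0 \<le> s" for s
    by (rule right_continuous[OF assms(1) that])
  show "(\<lambda>m. X (real (grid m t) / real (Suc m)) \<omega>) \<longlonglongrightarrow> X t \<omega>"
    by (rule right_continuous_grid[OF rc[OF t] t])
  show "(\<lambda>m. walk_max (grid m t) (\<lambda>i. increment m i \<omega>)) \<longlonglongrightarrow> running_sup X t \<omega>"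
    unfolding walk_increment[OF assms(1)] running_sup_def
    by (rule grid_Max_tendsto[OF rc path_bounded(1)[OF assms(1)] t])
  show "(\<lambda>m. walk_min (grid m t) (\<lambda>i. increment m i \<omega>)) \<longlonglongrightarrow> running_inf X t \<omega>"
    unfolding walk_increment[OF assms(1)] running_inf_def
    by (rule grid_Min_tendsto[OF rc path_bounded(2)[OF assms(1)] t])
qed

text \<open>Position, running supremum and running infimum at a time that is itself a coordinate of the sample space. Truncation at 0 makes
  them limits of grid approximations everywhere, hence jointly measurable; the exponential law does not charge negative times.\<close>

definition XT :: "real \<times> 'a \<Rightarrow> real" where "XT p = X (max 0 (fst p)) (snd p)"
definition ST :: "real \<times> 'a \<Rightarrow> real" where "ST p = running_sup X (max 0 (fst p)) (snd p)"
definition IT :: "real \<times> 'a \<Rightarrow> real" where "IT p = running_inf X (max 0 (fst p)) (snd p)"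

lemma measurable_at_grid:
  assumes f: "\<And>n. f n \<in> borel_measurable N"
  shows "(\<lambda>p. f (grid m (max 0 (fst p))) (snd p) :: real) \<in> borel_measurable (borel \<Otimes>\<^sub>M N)"
proof (rule measurable_compose_countable)
  show "(\<lambda>p. grid m (max 0 (fst p))) \<in> measurable (borel \<Otimes>\<^sub>M N) (count_space UNIV)"
    unfolding grid_def by measurable
  show "(\<lambda>p. f n (snd p)) \<in> borel_measurable (borel \<Otimes>\<^sub>M N)" for n
    by (rule measurable_compose[OF measurable_snd f])
qed

text \<open>The \<open>\<sigma>\<close>-algebra is arbitrary because measurability is needed once for \<open>M\<close> and once for the \<open>\<sigma>\<close>-algebra generated by the process,
  from which the exponential time is independent.\<close>

lemma measurable_randomized_time:
  assumes N: "space N = space M" and X: "\<And>t. 0 \<le> t \<Longrightarrow> X t \<in> borel_measurable N"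
  shows "XT \<in> borel_measurable (borel \<Otimes>\<^sub>M N)" "ST \<in> borel_measurable (borel \<Otimes>\<^sub>M N)"
    "IT \<in> borel_measurable (borel \<Otimes>\<^sub>M N)"
proof -
  have sp: "snd p \<in> space M" if "p \<in> space (borel \<Otimes>\<^sub>M N)" for p :: "real \<times> 'a"
    using that unfolding space_pair_measure N by auto
  have i: "increment m i \<in> borel_measurable N" for m i
    unfolding increment_def by (intro borel_measurable_diff X) auto
  have ps: "(\<lambda>\<omega>. psum (\<lambda>i. increment m i \<omega>) j) \<in> borel_measurable N" for m j
    unfolding psum_def by (intro borel_measurable_sum i)
  have mx: "(\<lambda>\<omega>. walk_max n (\<lambda>i. increment m i \<omega>)) \<in> borel_measurable N" for m n
    unfolding walk_max_def by (rule borel_measurable_Max) (auto intro: ps)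
  have mn: "(\<lambda>\<omega>. walk_min n (\<lambda>i. increment m i \<omega>)) \<in> borel_measurable N" for m n
    unfolding walk_min_def by (rule borel_measurable_Min) (auto intro: ps)
  show "XT \<in> borel_measurable (borel \<Otimes>\<^sub>M N)"
  proof (rule borel_measurable_LIMSEQ_real)
    show "(\<lambda>m. X (real (grid m (max 0 (fst p))) / real (Suc m)) (snd p)) \<longlonglongrightarrow> XT p" if "p \<in> space (borel \<Otimes>\<^sub>M N)" for p
      unfolding XT_def by (intro grid_limits sp that) auto
    show "(\<lambda>p. X (real (grid m (max 0 (fst p))) / real (Suc m)) (snd p)) \<in> borel_measurable (borel \<Otimes>\<^sub>M N)" for m
      by (rule measurable_at_grid[where f="\<lambda>n. X (real n / real (Suc m))"]) (auto intro: X)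
  qed
  show "ST \<in> borel_measurable (borel \<Otimes>\<^sub>M N)"
  proof (rule borel_measurable_LIMSEQ_real)
    show "(\<lambda>m. walk_max (grid m (max 0 (fst p))) (\<lambda>i. increment m i (snd p))) \<longlonglongrightarrow> ST p" if "p \<in> space (borel \<Otimes>\<^sub>M N)" for p
      unfolding ST_def by (intro grid_limits sp that) auto
    show "(\<lambda>p. walk_max (grid m (max 0 (fst p))) (\<lambda>i. increment m i (snd p))) \<in> borel_measurable (borel \<Otimes>\<^sub>M N)" for m
      by (rule measurable_at_grid[where f="\<lambda>n \<omega>. walk_max n (\<lambda>i. increment m i \<omega>)"]) (rule mx)
  qed
  show "IT \<in> borel_measurable (borel \<Otimes>\<^sub>M N)"
  proof (rule borel_measurable_LIMSEQ_real)
    show "(\<lambda>m. walk_min (grid m (max 0 (fst p))) (\<lambda>i. increment m i (snd p))) \<longlonglongrightarrow> IT p" if "p \<in> space (borel \<Otimes>\<^sub>M N)" for p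
      unfolding IT_def by (intro grid_limits sp that) auto
    show "(\<lambda>p. walk_min (grid m (max 0 (fst p))) (\<lambda>i. increment m i (snd p))) \<in> borel_measurable (borel \<Otimes>\<^sub>M N)" for m
      by (rule measurable_at_grid[where f="\<lambda>n \<omega>. walk_min n (\<lambda>i. increment m i \<omega>)"]) (rule mn)
  qed
qed

end

abbreviation exp_law :: "real \<Rightarrow> real measure" where
  "exp_law q \<equiv> density lborel (exponential_density q)"

lemma exp_law_cdf:
  assumes q: "0 < q" and a: "0 \<le> a"
  shows "measure (exp_law q) {..a} = 1 - exp (- (a * q))"
proof -
  interpret E: prob_space "exp_law q" by (rule prob_space_exponential_density[OF q])
  have "distr (exp_law q) lborel (\<lambda>x. x) = exp_law q"
    by (rule distr_id2) simp
  then have "distributed (exp_law q) lborel (\<lambda>x. x) (exponential_density q)"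
    unfolding distributed_def by simp
  from E.exponential_distributedD_le[OF this a q] show ?thesis by (simp add: atMost_def)
qed

lemma grid_eq_iff: "grid m t = 0 \<longleftrightarrow> t \<le> 0" "grid m t = Suc k \<longleftrightarrow> t \<in> {real k / real (Suc m)<..real (Suc k) / real (Suc m)}"
proof -
  have 1: "\<lceil>t * real (Suc m)\<rceil> \<le> 0 \<longleftrightarrow> t \<le> 0"
    by (simp add: ceiling_le_iff mult_le_0_iff not_le)
  then show "grid m t = 0 \<longleftrightarrow> t \<le> 0" unfolding grid_def by (simp del: of_nat_Suc)
  have "grid m t = Suc k \<longleftrightarrow> \<lceil>t * real (Suc m)\<rceil> = int (Suc k)" unfolding grid_def by linarith
  also have "\<dots> \<longleftrightarrow> real k < t * real (Suc m) \<and> t * real (Suc m) \<le> real (Suc k)"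
    by (simp add: ceiling_eq_iff del: of_nat_Suc) (simp)
  also have "\<dots> \<longleftrightarrow> t \<in> {real k / real (Suc m)<..real (Suc k) / real (Suc m)}"
    by (simp add: pos_divide_less_eq pos_le_divide_eq del: of_nat_Suc)
  finally show "grid m t = Suc k \<longleftrightarrow> t \<in> {real k / real (Suc m)<..real (Suc k) / real (Suc m)}" .
qed

lemma measurable_grid[measurable]: "grid m \<in> measurable borel (count_space UNIV)"
  unfolding grid_def by measurable

text \<open>The grid index of an exponential time is geometric on \<open>{1, 2, ...}\<close>, while the factorisation is for a geometric
  time on \<open>{0, 1, ...}\<close>. The two sums differ by the term at 0 and a factor \<open>p\<close>, and \<open>p\<close> tends to 1.\<close>

lemma integral_exp_law_grid:
  fixes e :: "nat \<Rightarrow> real"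
  assumes q: "0 < q" and e: "\<And>n. \<bar>e n\<bar> \<le> C"
  defines "p m \<equiv> exp (- q / real (Suc m))"
  shows "(1 - p m) * (\<Sum>n. p m ^ n * e n) = (1 - p m) * e 0 + p m * (LINT t|exp_law q. e (grid m t))"
proof -
  interpret E: prob_space "exp_law q" by (rule prob_space_exponential_density[OF q])
  have p: "0 < p m" "p m < 1" for m unfolding p_def using q by auto
  define A where "A k = {t. grid m t = k}" for k
  have Am[measurable]: "A k \<in> sets borel" for k
  proof -
    have "A k = grid m -` {k} \<inter> space borel" unfolding A_def by auto
    then show ?thesis using measurable_sets[OF measurable_grid, of "{k}" m] by simp
  qed
  have UA: "(\<Union>k. A k) = UNIV" unfolding A_def by auto
  have me[measurable]: "(\<lambda>t. e (grid m t)) \<in> borel_measurable borel" by measurable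
  have ie: "integrable (exp_law q) (\<lambda>t. e (grid m t))"
    by (rule E.integrable_const_bound[where B=C]) (use e in auto)
  define w where "w k = measure (exp_law q) (A k)" for k
  \<comment> \<open>Index 0 means \<open>t \<le> 0\<close>, a null event.\<close>
  have w0: "w 0 = 0"
    unfolding w_def A_def grid_eq_iff using exp_law_cdf[OF q, of 0] by (simp add: atMost_def)
  have wS: "w (Suc k) = (1 - p m) * p m ^ k" for k
  proof -
    let ?a = "real k / real (Suc m)" and ?b = "real (Suc k) / real (Suc m)"
    have "A (Suc k) = {..?b} - {..?a}"
      unfolding A_def grid_eq_iff by (auto simp del: of_nat_Suc)
    then have "w (Suc k) = measure (exp_law q) {..?b} - measure (exp_law q) {..?a}"
      unfolding w_def using E.finite_measure_Diff[of "{..?b}" "{..?a}"] by (simp add: divide_right_mono)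
    also have "\<dots> = exp (- (?a * q)) - exp (- (?b * q))"
      using q by (simp add: exp_law_cdf)
    also have "exp (- (?a * q)) = p m ^ k"
      unfolding p_def by (simp add: exp_of_nat_mult[symmetric] mult.commute)
    also have "exp (- (?b * q)) = p m ^ Suc k"
      unfolding p_def exp_of_nat_mult[symmetric] by (simp add: mult.commute)
    finally show ?thesis by (simp add: algebra_simps)
  qed
  have "(LINT t|exp_law q. e (grid m t)) = set_lebesgue_integral (exp_law q) (\<Union>k. A k) (\<lambda>t. e (grid m t))"
    unfolding UA set_lebesgue_integral_def by simp
  also have "\<dots> = (\<Sum>k. set_lebesgue_integral (exp_law q) (A k) (\<lambda>t. e (grid m t)))"
    by (rule lebesgue_integral_countable_add) (use ie in \<open>auto simp: UA set_integrable_def A_def\<close>)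
  also have "\<dots> = (\<Sum>k. w k * e k)"
  proof (intro suminf_cong)
    fix k
    have "set_lebesgue_integral (exp_law q) (A k) (\<lambda>t. e (grid m t)) = (LINT t|exp_law q. indicator (A k) t * e k)"
      unfolding set_lebesgue_integral_def by (intro Bochner_Integration.integral_cong) (auto simp: A_def indicator_def)
    also have "\<dots> = w k * e k" unfolding w_def by simp
    finally show "set_lebesgue_integral (exp_law q) (A k) (\<lambda>t. e (grid m t)) = w k * e k" .
  qed
  finally have L: "(LINT t|exp_law q. e (grid m t)) = (\<Sum>k. w k * e k)" .
  have s: "summable (\<lambda>k. p m ^ k * a k)" if "\<And>k. \<bar>a k\<bar> \<le> C" for a
  proof (rule summable_comparison_test')
    show "summable (\<lambda>k. C * p m ^ k)" using p[of m] by (intro summable_mult summable_geometric) auto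
    show "norm (p m ^ k * a k) \<le> C * p m ^ k" if "0 \<le> k" for k
      using p[of m] \<open>\<And>k. \<bar>a k\<bar> \<le> C\<close>[of k] by (simp add: abs_mult mult.commute mult_right_mono)
  qed
  have s1: "summable (\<lambda>k. p m ^ k * e (Suc k))" and s0: "summable (\<lambda>k. p m ^ k * e k)"
    by (intro s e)+
  have "summable (\<lambda>k. w (Suc k) * e (Suc k))"
    unfolding wS using summable_mult[OF s1, of "1 - p m"] by (simp add: mult.assoc)
  then have sw: "summable (\<lambda>k. w k * e k)" by (subst (asm) summable_Suc_iff)
  have "(\<Sum>k. w k * e k) = (\<Sum>k. w (Suc k) * e (Suc k))"
    using suminf_split_head[OF sw] w0 by simp
  also have "\<dots> = (1 - p m) * (\<Sum>k. p m ^ k * e (Suc k))"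
    unfolding wS by (subst suminf_mult[OF s1, symmetric]) (simp add: mult.assoc)
  finally have "p m * (LINT t|exp_law q. e (grid m t)) = (1 - p m) * (p m * (\<Sum>k. p m ^ k * e (Suc k)))"
    unfolding L by simp
  also have "p m * (\<Sum>k. p m ^ k * e (Suc k)) = (\<Sum>k. p m ^ Suc k * e (Suc k))"
    by (subst suminf_mult[OF s1, symmetric]) (simp add: mult.assoc)
  also have "\<dots> = (\<Sum>k. p m ^ k * e k) - e 0"
    using suminf_split_head[OF s0] by simp
  finally show ?thesis by (simp add: algebra_simps)
qed

context levy_process begin

lemma prob_space_randomized:
  assumes "0 < q"
  shows "prob_space (exp_law q \<Otimes>\<^sub>M M)"
  by (intro prob_space_pair prob_space_exponential_density assms prob_space_axioms)

lemma measurable_randomized: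
  "XT \<in> borel_measurable (exp_law q \<Otimes>\<^sub>M M)" "ST \<in> borel_measurable (exp_law q \<Otimes>\<^sub>M M)"
  "IT \<in> borel_measurable (exp_law q \<Otimes>\<^sub>M M)"
proof -
  have "sets (exp_law q \<Otimes>\<^sub>M M) = sets (borel \<Otimes>\<^sub>M M)" by (intro sets_pair_measure_cong) auto
  then have "borel_measurable (exp_law q \<Otimes>\<^sub>M M) = (borel_measurable (borel \<Otimes>\<^sub>M M) :: (real \<times> 'a \<Rightarrow> real) set)"
    by (rule measurable_cong_sets) simp
  note eq = this
  show "XT \<in> borel_measurable (exp_law q \<Otimes>\<^sub>M M)" "ST \<in> borel_measurable (exp_law q \<Otimes>\<^sub>M M)"
    "IT \<in> borel_measurable (exp_law q \<Otimes>\<^sub>M M)"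
    unfolding eq by (rule measurable_randomized_time[OF refl measurable_X], assumption)+
qed

lemma AE_randomized_nonneg:
  assumes q: "0 < q"
  shows "AE p in exp_law q \<Otimes>\<^sub>M M. 0 \<le> fst p \<and> snd p \<in> space M"
proof -
  interpret E: prob_space "exp_law q" by (rule prob_space_exponential_density[OF q])
  interpret EM: pair_sigma_finite "exp_law q" M ..
  have "AE t in exp_law q. 0 \<le> t"
    by (subst AE_density) (auto intro!: AE_I2 simp: exponential_density_def)
  then have "AE t in exp_law q. AE \<omega> in M. 0 \<le> t"
    by (rule eventually_mono) simp
  then have "AE p in exp_law q \<Otimes>\<^sub>M M. 0 \<le> fst p"
  proof (intro EM.AE_pair_measure)
    have "{p \<in> space (borel \<Otimes>\<^sub>M M). (0::real) \<le> fst p} \<in> sets (borel \<Otimes>\<^sub>M M)" by measurable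
    moreover have "sets (exp_law q \<Otimes>\<^sub>M M) = sets (borel \<Otimes>\<^sub>M M)" by (intro sets_pair_measure_cong) auto
    ultimately show "{p \<in> space (exp_law q \<Otimes>\<^sub>M M). 0 \<le> fst p} \<in> sets (exp_law q \<Otimes>\<^sub>M M)"
      by (simp add: space_pair_measure)
  qed auto
  moreover have "AE p in exp_law q \<Otimes>\<^sub>M M. snd p \<in> space M"
    by (rule AE_I2) (auto simp: space_pair_measure)
  ultimately show ?thesis by eventually_elim simp
qed

lemma geometric_limit:
  fixes D :: "nat \<Rightarrow> nat \<Rightarrow> 'a \<Rightarrow> real"
  assumes q: "0 < q" and D: "\<And>m n. D m n \<in> borel_measurable M" "\<And>m n \<omega>. \<bar>D m n \<omega>\<bar> \<le> 1"
    and lim: "\<And>t \<omega>. 0 \<le> t \<Longrightarrow> \<omega> \<in> space M \<Longrightarrow> (\<lambda>m. D m (grid m t) \<omega>) \<longlonglongrightarrow> L (t, \<omega>)"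
    and L: "L \<in> borel_measurable (exp_law q \<Otimes>\<^sub>M M)"
  shows "(\<lambda>m. (1 - exp (- q / real (Suc m))) * (\<Sum>n. exp (- q / real (Suc m)) ^ n * expectation (D m n)))
     \<longlonglongrightarrow> (LINT p|(exp_law q \<Otimes>\<^sub>M M). L p)"
proof -
  interpret E: prob_space "exp_law q" by (rule prob_space_exponential_density[OF q])
  interpret P: prob_space "exp_law q \<Otimes>\<^sub>M M" by (rule prob_space_randomized[OF q])
  interpret EM: pair_sigma_finite "exp_law q" M ..
  define p where "p m = exp (- q / real (Suc m))" for m
  have ED: "\<bar>expectation (D m n)\<bar> \<le> 1" for m n
  proof -
    have "\<bar>expectation (D m n)\<bar> \<le> expectation (\<lambda>\<omega>. \<bar>D m n \<omega>\<bar>)" by (rule integral_abs_bound)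
    also have "\<dots> \<le> expectation (\<lambda>\<omega>. 1)"
      by (intro integral_mono_AE integrable_const_bound[where B=1] AE_I2) (use D in auto)
    finally show ?thesis by (simp add: prob_space)
  qed
  have sets: "sets (exp_law q \<Otimes>\<^sub>M M) = sets (borel \<Otimes>\<^sub>M M)" by (intro sets_pair_measure_cong) auto
  have mD: "(\<lambda>x. D m (grid m (max 0 (fst x))) (snd x)) \<in> borel_measurable (exp_law q \<Otimes>\<^sub>M M)" for m
    using measurable_at_grid[of "D m" M m, OF D(1)] unfolding measurable_cong_sets[OF sets refl] .
  have 1: "(\<lambda>m. LINT x|(exp_law q \<Otimes>\<^sub>M M). D m (grid m (max 0 (fst x))) (snd x)) \<longlonglongrightarrow> (LINT x|(exp_law q \<Otimes>\<^sub>M M). L x)"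
  proof (rule integral_dominated_convergence)
    show "integrable (exp_law q \<Otimes>\<^sub>M M) (\<lambda>_. 1::real)" by simp
    show "AE x in exp_law q \<Otimes>\<^sub>M M. (\<lambda>m. D m (grid m (max 0 (fst x))) (snd x)) \<longlonglongrightarrow> L x"
      using AE_randomized_nonneg[OF q]
    proof eventually_elim
      case (elim x)
      then show ?case using lim[of "fst x" "snd x"] by (simp add: max_absorb2)
    qed
  qed (use D mD L in auto)
  have grid0: "grid m (max 0 t) = grid m t" for m t
    unfolding grid_def by (cases "0 \<le> t") (auto simp: max_def mult_le_0_iff ceiling_le_iff)
  have eq: "(LINT x|(exp_law q \<Otimes>\<^sub>M M). D m (grid m (max 0 (fst x))) (snd x)) = (LINT t|exp_law q. expectation (D m (grid m t)))" for m
    using EM.integral_fst'[of "\<lambda>x. D m (grid m (max 0 (fst x))) (snd x)"] D mD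
    by (subst EM.integral_fst'[symmetric]) (auto intro!: P.integrable_const_bound[where B=1] simp: grid0)
  have plim: "p \<longlonglongrightarrow> 1"
  proof -
    have "(\<lambda>m. - q * (1 / real (Suc m))) \<longlonglongrightarrow> - q * 0"
      by (intro tendsto_mult tendsto_const LIMSEQ_Suc[OF lim_1_over_n])
    then have "(\<lambda>m. exp (- q * (1 / real (Suc m)))) \<longlonglongrightarrow> exp (- q * 0)" by (rule tendsto_exp)
    then show ?thesis unfolding p_def by simp
  qed
  have "(\<lambda>m. (1 - p m) * expectation (D m 0)) \<longlonglongrightarrow> 0"
  proof (rule tendsto_rabs_zero_cancel, rule tendsto_sandwich[of "\<lambda>_. 0"])
    show "(\<lambda>m. \<bar>1 - p m\<bar>) \<longlonglongrightarrow> 0"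
      using tendsto_diff[OF tendsto_const plim, of 1] by (intro tendsto_rabs_zero) simp
    show "\<forall>\<^sub>F m in sequentially. \<bar>(1 - p m) * expectation (D m 0)\<bar> \<le> \<bar>1 - p m\<bar>"
      using ED by (intro always_eventually allI) (simp add: abs_mult mult_left_le)
  qed auto
  then have "(\<lambda>m. (1 - p m) * expectation (D m 0) + p m * (LINT t|exp_law q. expectation (D m (grid m t))))
      \<longlonglongrightarrow> 0 + 1 * (LINT x|(exp_law q \<Otimes>\<^sub>M M). L x)"
    using 1 unfolding eq by (intro tendsto_add tendsto_mult plim)
  then show ?thesis
    unfolding p_def using integral_exp_law_grid[OF q ED] by simp
qed

definition ZT :: "real \<times> 'a \<Rightarrow> real" where "ZT p = XT p - ST p"

text \<open>Both claims hold for the walk of grid values at a geometric time, by \<open>geometric_time_factorization\<close> and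
  \<open>expectation_walk_reversal\<close>, and pass to the limit for bounded continuous test functions.\<close>

theorem wiener_hopf:
  assumes q: "0 < q"
  shows "prob_space.indep_var (exp_law q \<Otimes>\<^sub>M M) borel ST borel ZT"
    and "distr (exp_law q \<Otimes>\<^sub>M M) borel ZT = distr (exp_law q \<Otimes>\<^sub>M M) borel IT"
proof -
  let ?P = "exp_law q \<Otimes>\<^sub>M M"
  interpret P: prob_space ?P by (rule prob_space_randomized[OF q])
  note [measurable] = measurable_randomized[of q]
  have [measurable]: "ZT \<in> borel_measurable ?P" unfolding ZT_def[abs_def] by measurable
  define p where "p m = exp (- q / real (Suc m))" for m
  have p: "0 \<le> p m" "p m < 1" for m unfolding p_def using q by auto
  have lim: "(\<lambda>m. iid_steps.mean_at_geometric_time M (increment m) (p m) g h) \<longlonglongrightarrow> (LINT x|?P. g (ST x) * h (ZT x))"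
    if g: "continuous_on UNIV g" "\<And>x. \<bar>g x\<bar> \<le> 1" and h: "continuous_on UNIV h" "\<And>x. \<bar>h x\<bar> \<le> 1" for g h
  proof -
    have [measurable]: "g \<in> borel_measurable borel" "h \<in> borel_measurable borel"
      using g h by (auto intro: borel_measurable_continuous_onI)
    have "(\<lambda>m. (1 - p m) * (\<Sum>n. p m ^ n * expectation (\<lambda>\<omega>. g (walk_max n (\<lambda>i. increment m i \<omega>)) *
          h (psum (\<lambda>i. increment m i \<omega>) n - walk_max n (\<lambda>i. increment m i \<omega>)))))
        \<longlonglongrightarrow> (LINT x|?P. g (ST x) * h (ZT x))"
      unfolding p_def
    proof (rule geometric_limit[OF q])
      fix m n
      interpret iid_steps M "increment m" by (rule iid_increments)
      show "(\<lambda>\<omega>. g (walk_max n (\<lambda>i. increment m i \<omega>)) * h (psum (\<lambda>i. increment m i \<omega>) n - walk_max n (\<lambda>i. increment m i \<omega>))) \<in> borel_measurable M"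
        by measurable
      fix \<omega>
      show "\<bar>g (walk_max n (\<lambda>i. increment m i \<omega>)) * h (psum (\<lambda>i. increment m i \<omega>) n - walk_max n (\<lambda>i. increment m i \<omega>))\<bar> \<le> 1"
        using g(2) h(2) by (auto simp: abs_mult intro!: mult_le_one)
    next
      fix t :: real and \<omega> assume t: "0 \<le> t" and w: "\<omega> \<in> space M"
      have cg: "isCont g x" and ch: "isCont h x" for x
        using g(1) h(1) by (auto simp: continuous_on_eq_continuous_at)
      have "(\<lambda>m. g (walk_max (grid m t) (\<lambda>i. increment m i \<omega>)) * h (X (real (grid m t) / real (Suc m)) \<omega> - walk_max (grid m t) (\<lambda>i. increment m i \<omega>)))
         \<longlonglongrightarrow> g (running_sup X t \<omega>) * h (X t \<omega> - running_sup X t \<omega>)"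
        by (intro tendsto_mult isCont_tendsto_compose[OF cg] isCont_tendsto_compose[OF ch] tendsto_diff grid_limits w t)
      then show "(\<lambda>m. g (walk_max (grid m t) (\<lambda>i. increment m i \<omega>)) * h (psum (\<lambda>i. increment m i \<omega>) (grid m t) - walk_max (grid m t) (\<lambda>i. increment m i \<omega>)))
         \<longlonglongrightarrow> g (ST (t, \<omega>)) * h (ZT (t, \<omega>))"
        unfolding psum_increment[OF w] ZT_def ST_def XT_def using t by (simp add: max_absorb2)
    qed measurable
    then show ?thesis unfolding iid_steps.mean_at_geometric_time_def[OF iid_increments] .
  qed
  have limI: "(\<lambda>m. iid_steps.mean_at_geometric_time M (increment m) (p m) (\<lambda>_. 1) h) \<longlonglongrightarrow> (LINT x|?P. h (IT x))"
    if h: "continuous_on UNIV h" "\<And>x. \<bar>h x\<bar> \<le> 1" for h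
  proof -
    have [measurable]: "h \<in> borel_measurable borel"
      using h by (auto intro: borel_measurable_continuous_onI)
    have "(\<lambda>m. (1 - p m) * (\<Sum>n. p m ^ n * expectation (\<lambda>\<omega>. h (walk_min n (\<lambda>i. increment m i \<omega>)))))
        \<longlonglongrightarrow> (LINT x|?P. h (IT x))"
      unfolding p_def
    proof (rule geometric_limit[OF q])
      fix m n
      interpret iid_steps M "increment m" by (rule iid_increments)
      show "(\<lambda>\<omega>. h (walk_min n (\<lambda>i. increment m i \<omega>))) \<in> borel_measurable M"
        by measurable
      fix \<omega>
      show "\<bar>h (walk_min n (\<lambda>i. increment m i \<omega>))\<bar> \<le> 1"
        using h(2) by auto
    next
      fix t :: real and \<omega> assume t: "0 \<le> t" and w: "\<omega> \<in> space M"
      have ch: "isCont h x" for x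
        using h(1) by (auto simp: continuous_on_eq_continuous_at)
      have "(\<lambda>m. h (walk_min (grid m t) (\<lambda>i. increment m i \<omega>))) \<longlonglongrightarrow> h (running_inf X t \<omega>)"
        by (intro isCont_tendsto_compose[OF ch] grid_limits w t)
      then show "(\<lambda>m. h (walk_min (grid m t) (\<lambda>i. increment m i \<omega>))) \<longlonglongrightarrow> h (IT (t, \<omega>))"
        unfolding IT_def using t by (simp add: max_absorb2)
    qed measurable
    then show ?thesis
      unfolding iid_steps.mean_at_geometric_time_def[OF iid_increments]
      using iid_steps.expectation_walk_reversal[OF iid_increments \<open>h \<in> borel_measurable borel\<close>] by simp
  qed
  have c1: "continuous_on UNIV (\<lambda>_::real. 1::real)" "\<And>x::real. \<bar>1::real\<bar> \<le> 1" by auto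
  show "P.indep_var borel ST borel ZT"
  proof (rule P.indep_var_of_continuous_expectations)
    fix g h :: "real \<Rightarrow> real"
    assume g: "continuous_on UNIV g" and h: "continuous_on UNIV h" and b: "\<And>x. \<bar>g x\<bar> \<le> 1" "\<And>x. \<bar>h x\<bar> \<le> 1"
    have mg: "g \<in> borel_measurable borel" and mh: "h \<in> borel_measurable borel"
      using g h by (auto intro: borel_measurable_continuous_onI)
    have "(\<lambda>m. iid_steps.mean_at_geometric_time M (increment m) (p m) g (\<lambda>_. 1) * iid_steps.mean_at_geometric_time M (increment m) (p m) (\<lambda>_. 1) h)
       \<longlonglongrightarrow> (LINT x|?P. g (ST x) * 1) * (LINT x|?P. 1 * h (ZT x))"
      using lim[OF g b(1) c1] lim[OF c1 h b(2)] by (intro tendsto_mult)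
    then have "(\<lambda>m. iid_steps.mean_at_geometric_time M (increment m) (p m) g h) \<longlonglongrightarrow> (LINT x|?P. g (ST x)) * (LINT x|?P. h (ZT x))"
      using iid_steps.geometric_time_factorization[OF iid_increments p mg b(1) mh b(2)] by simp
    with lim[OF g b(1) h b(2)] show "(LINT x|?P. g (ST x) * h (ZT x)) = (LINT x|?P. g (ST x)) * (LINT x|?P. h (ZT x))"
      by (rule LIMSEQ_unique)
  qed measurable
  show "distr ?P borel ZT = distr ?P borel IT"
  proof (rule P.distr_eq_of_continuous_expectations)
    fix h :: "real \<Rightarrow> real" assume h: "continuous_on UNIV h" "\<And>x. \<bar>h x\<bar> \<le> 1"
    from lim[OF c1 h] have "(\<lambda>m. iid_steps.mean_at_geometric_time M (increment m) (p m) (\<lambda>_. 1) h) \<longlonglongrightarrow> (LINT x|?P. h (ZT x))" by simp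
    then show "(LINT x|?P. h (ZT x)) = (LINT x|?P. h (IT x))" using limI[OF h] by (rule LIMSEQ_unique)
  qed measurable
qed

end

section \<open>Exponential integrals and exponential moments\<close>

lemma integrable_exp_atLeast:
  fixes k :: real
  assumes k: "k > 0"
  shows "integrable lborel (\<lambda>x. indicator {a..} x * exp (- k * x))"
proof (rule integrableI_nonneg)
  have "(\<integral>\<^sup>+ x. ennreal (exp (- k * x)) * indicator {a..} x \<partial>lborel) = ennreal (0 - (- exp (- k * a) / k))"
  proof (rule nn_integral_FTC_atLeast)
    show "DERIV (\<lambda>x. - exp (- k * x) / k) x :> exp (- k * x)" for x
      using k by (auto intro!: derivative_eq_intros)
    have "filterlim (\<lambda>x. - (k * x)) at_bot at_top"
      by (simp add: filterlim_uminus_at_bot filterlim_tendsto_pos_mult_at_top[OF tendsto_const k filterlim_ident])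
    then have "((\<lambda>x. exp (- k * x)) \<longlongrightarrow> 0) at_top"
      by (intro filterlim_compose[OF exp_at_bot]) simp
    from tendsto_divide[OF tendsto_minus[OF this] tendsto_const, of k] k
    show "((\<lambda>x. - exp (- k * x) / k) \<longlongrightarrow> 0) at_top" by simp
  qed auto
  moreover have "(\<integral>\<^sup>+ x. ennreal (indicator {a..} x * exp (- k * x)) \<partial>lborel) = (\<integral>\<^sup>+ x. ennreal (exp (- k * x)) * indicator {a..} x \<partial>lborel)"
    by (intro nn_integral_cong) (auto simp: indicator_def)
  ultimately show "(\<integral>\<^sup>+ x. ennreal (indicator {a..} x * exp (- k * x)) \<partial>lborel) < \<infinity>" by simp
qed auto

lemma integral_exp_Icc:
  fixes c :: complex
  assumes c: "c \<noteq> 0" and ab: "a \<le> b"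
  shows "(LINT x|lborel. indicator {a..b} x *\<^sub>R exp (- (c * complex_of_real x))) = (exp (- (c * a)) - exp (- (c * b))) / c"
proof -
  have "(LINT x|lborel. indicator {a..b} x *\<^sub>R exp (- (c * complex_of_real x))) = - exp (- (c * b)) / c - (- exp (- (c * a)) / c)"
  proof (rule integral_FTC_Icc[OF ab])
    fix x
    have "((\<lambda>z. - exp (- (c * z)) / c) has_field_derivative exp (- (c * complex_of_real x))) (at (complex_of_real x))"
      using c by (auto intro!: derivative_eq_intros)
    then show "((\<lambda>x. - exp (- (c * complex_of_real x)) / c) has_vector_derivative exp (- (c * complex_of_real x))) (at x within {a..b})"
      by (rule has_vector_derivative_real_field)
  qed (intro continuous_intros)
  then show ?thesis by (simp add: diff_divide_distrib)
qed

lemma integral_exp_atLeast: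
  fixes c :: complex
  assumes c: "Re c > 0"
  shows "integrable lborel (\<lambda>x. indicator {a..} x *\<^sub>R exp (- (c * complex_of_real x)))" (is ?int)
    and "(LINT x|lborel. indicator {a..} x *\<^sub>R exp (- (c * complex_of_real x))) = exp (- (c * a)) / c"
proof -
  have c0: "c \<noteq> 0" using c by auto
  show i: ?int
    by (rule Bochner_Integration.integrable_bound[OF integrable_exp_atLeast[OF c, of a]])
       (auto simp: norm_exp indicator_def intro!: AE_I2)
  have "((\<lambda>b. set_lebesgue_integral lborel {a..b} (\<lambda>x. exp (- (c * complex_of_real x)))) \<longlongrightarrow>
      set_lebesgue_integral lborel {a..} (\<lambda>x. exp (- (c * complex_of_real x)))) at_top"
    by (rule tendsto_set_lebesgue_integral_at_top) (use i in \<open>auto simp: set_integrable_def\<close>)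
  moreover have "((\<lambda>b. set_lebesgue_integral lborel {a..b} (\<lambda>x. exp (- (c * complex_of_real x)))) \<longlongrightarrow>
      (exp (- (c * a)) - 0) / c) at_top"
  proof (rule Lim_transform_eventually)
    have "filterlim (\<lambda>x. - (Re c * x)) at_bot at_top"
      by (simp add: filterlim_uminus_at_bot filterlim_tendsto_pos_mult_at_top[OF tendsto_const c filterlim_ident])
    then have "((\<lambda>x. exp (- (Re c * x))) \<longlongrightarrow> 0) at_top"
      by (intro filterlim_compose[OF exp_at_bot])
    then have "((\<lambda>x. norm (exp (- (c * complex_of_real x)))) \<longlongrightarrow> 0) at_top" by (simp add: norm_exp)
    then have "((\<lambda>x. exp (- (c * complex_of_real x))) \<longlongrightarrow> 0) at_top" by (rule tendsto_norm_zero_cancel)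
    then show "((\<lambda>b. (exp (- (c * a)) - exp (- (c * complex_of_real b))) / c) \<longlongrightarrow> (exp (- (c * a)) - 0) / c) at_top"
      by (intro tendsto_intros c0)
    show "\<forall>\<^sub>F b in at_top. (exp (- (c * a)) - exp (- (c * complex_of_real b))) / c =
        set_lebesgue_integral lborel {a..b} (\<lambda>x. exp (- (c * complex_of_real x)))"
      using eventually_ge_at_top[of a]
      by eventually_elim (simp add: set_lebesgue_integral_def integral_exp_Icc[OF c0])
  qed
  ultimately have "set_lebesgue_integral lborel {a..} (\<lambda>x. exp (- (c * complex_of_real x))) = (exp (- (c * a)) - 0) / c"
    by (rule tendsto_unique[OF trivial_limit_at_top_linorder])
  then show "(LINT x|lborel. indicator {a..} x *\<^sub>R exp (- (c * complex_of_real x))) = exp (- (c * a)) / c"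
    by (simp add: set_lebesgue_integral_def)
qed

lemma integral_exp_law_exp:
  fixes c :: complex
  assumes q: "0 < q" and c: "Re (q + c) > 0"
  shows "integrable (exp_law q) (\<lambda>t. exp (- (c * complex_of_real t)))"
    and "(LINT t|exp_law q. exp (- (c * complex_of_real t))) = q / (q + c)"
proof -
  have eq: "exponential_density q t *\<^sub>R exp (- (c * complex_of_real t)) = q *\<^sub>R (indicator {0..} t *\<^sub>R exp (- ((q + c) * complex_of_real t)))" for t
    unfolding exponential_density_def
    by (auto simp: scaleR_conv_of_real exp_of_real[symmetric] mult_exp_exp algebra_simps indicator_def)
  have nn: "AE t in lborel. 0 \<le> exponential_density q t"
    using exponential_density_nonneg[OF q] by auto
  show "integrable (exp_law q) (\<lambda>t. exp (- (c * complex_of_real t)))"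
    by (subst integrable_density[OF _ _ nn]) (use integral_exp_atLeast(1)[OF c, of 0] in \<open>auto simp: eq simp del: scaleR_scaleR\<close>)
  show "(LINT t|exp_law q. exp (- (c * complex_of_real t))) = q / (q + c)"
  proof (subst integral_density[OF _ _ nn])
    show "(LINT t|lborel. exponential_density q t *\<^sub>R exp (- (c * complex_of_real t))) = q / (q + c)"
      unfolding eq integral_scaleR_right using integral_exp_atLeast(2)[OF c, of 0]
      by (simp add: scaleR_conv_of_real)
  qed auto
qed

text \<open>By independence the mean of \<open>exp (a * (S + Z))\<close> is a product of two means in \<open>[0, \<infinity>]\<close>, neither of which vanishes. If
  the product is finite then so are the factors. In this way moments of the position control those of the extrema.\<close>

lemma (in prob_space) indep_var_integrable_exp:
  fixes S Z :: "'a \<Rightarrow> real"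
  assumes ind: "indep_var borel S borel Z" and int: "integrable M (\<lambda>\<omega>. exp (a * (S \<omega> + Z \<omega>)))"
  shows "integrable M (\<lambda>\<omega>. exp (a * S \<omega>))" "integrable M (\<lambda>\<omega>. exp (a * Z \<omega>))"
proof -
  have S[measurable]: "S \<in> borel_measurable M" and Z[measurable]: "Z \<in> borel_measurable M"
    and d: "distr M borel S \<Otimes>\<^sub>M distr M borel Z = distr M (borel \<Otimes>\<^sub>M borel) (\<lambda>\<omega>. (S \<omega>, Z \<omega>))"
    using ind unfolding indep_var_distribution_eq by auto
  interpret DS: prob_space "distr M borel S" by (rule prob_space_distr) measurable
  interpret DZ: prob_space "distr M borel Z" by (rule prob_space_distr) measurable
  interpret pair_sigma_finite "distr M borel S" "distr M borel Z" ..
  have "(\<integral>\<^sup>+\<omega>. ennreal (exp (a * (S \<omega> + Z \<omega>))) \<partial>M) = (\<integral>\<^sup>+p. ennreal (exp (a * (fst p + snd p))) \<partial>distr M (borel \<Otimes>\<^sub>M borel) (\<lambda>\<omega>. (S \<omega>, Z \<omega>)))"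
    by (subst nn_integral_distr) auto
  also have "\<dots> = (\<integral>\<^sup>+s. \<integral>\<^sup>+z. ennreal (exp (a * (s + z))) \<partial>distr M borel Z \<partial>distr M borel S)"
    unfolding d[symmetric] by (subst DZ.nn_integral_fst[symmetric]) auto
  also have "\<dots> = (\<integral>\<^sup>+s. \<integral>\<^sup>+z. ennreal (exp (a * s)) * ennreal (exp (a * z)) \<partial>distr M borel Z \<partial>distr M borel S)"
    by (simp add: distrib_left exp_add ennreal_mult)
  also have "\<dots> = (\<integral>\<^sup>+s. ennreal (exp (a * s)) \<partial>distr M borel S) * (\<integral>\<^sup>+z. ennreal (exp (a * z)) \<partial>distr M borel Z)"
    by (simp add: nn_integral_cmult nn_integral_multc)
  also have "\<dots> = (\<integral>\<^sup>+\<omega>. ennreal (exp (a * S \<omega>)) \<partial>M) * (\<integral>\<^sup>+\<omega>. ennreal (exp (a * Z \<omega>)) \<partial>M)"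
    by (simp add: nn_integral_distr)
  finally have eq: "(\<integral>\<^sup>+\<omega>. ennreal (exp (a * (S \<omega> + Z \<omega>))) \<partial>M) = (\<integral>\<^sup>+\<omega>. ennreal (exp (a * S \<omega>)) \<partial>M) * (\<integral>\<^sup>+\<omega>. ennreal (exp (a * Z \<omega>)) \<partial>M)" .
  have fin: "(\<integral>\<^sup>+\<omega>. ennreal (exp (a * (S \<omega> + Z \<omega>))) \<partial>M) < \<infinity>"
    using int by (subst nn_integral_eq_integral) auto
  have pos: "(\<integral>\<^sup>+\<omega>. ennreal (exp (a * W \<omega>)) \<partial>M) \<noteq> 0" if [measurable]: "W \<in> borel_measurable M" for W :: "'a \<Rightarrow> real"
  proof
    assume "(\<integral>\<^sup>+\<omega>. ennreal (exp (a * W \<omega>)) \<partial>M) = 0"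
    then have "AE \<omega> in M. ennreal (exp (a * W \<omega>)) = 0" by (subst (asm) nn_integral_0_iff_AE) auto
    then have "AE \<omega> in M. False" by eventually_elim (simp add: ennreal_eq_0_iff not_le)
    then show False using AE_False by simp
  qed
  have "(\<integral>\<^sup>+\<omega>. ennreal (exp (a * S \<omega>)) \<partial>M) < \<infinity> \<and> (\<integral>\<^sup>+\<omega>. ennreal (exp (a * Z \<omega>)) \<partial>M) < \<infinity>"
    using fin pos[OF S] pos[OF Z] unfolding eq
    by (metis ennreal_mult_eq_top_iff infinity_ennreal_def less_top mult.commute)
  then show "integrable M (\<lambda>\<omega>. exp (a * S \<omega>))" "integrable M (\<lambda>\<omega>. exp (a * Z \<omega>))"
    by (auto intro!: integrableI_nonneg)
qed

section \<open>The independent exponential time\<close>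

context levy_process begin

text \<open>The pair of the time and the sample point has a product law on the \<open>\<sigma>\<close>-algebra generated by the process, so the random time may be
  moved into a separate coordinate.\<close>

lemma expectation_independent_time:
  fixes \<phi> :: "real \<times> 'a \<Rightarrow> complex"
  assumes T: "independent_exponential_time M X q T" and q: "0 < q"
  defines "F \<equiv> sigma (space M) {X t -` B \<inter> space M | t B. 0 \<le> t \<and> B \<in> sets borel}"
  assumes \<phi>: "\<phi> \<in> borel_measurable (borel \<Otimes>\<^sub>M F)"
  shows "(LINT \<omega>|M. \<phi> (T \<omega>, \<omega>)) = (LINT p|(exp_law q \<Otimes>\<^sub>M M). \<phi> p)"
proof -
  let ?G = "{X t -` B \<inter> space M | t B. 0 \<le> t \<and> B \<in> sets borel}"
  interpret E: prob_space "exp_law q" by (rule prob_space_exponential_density[OF q])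
  have G: "?G \<subseteq> sets M" using measurable_X by (auto intro: measurable_sets)
  then have Gp: "?G \<subseteq> Pow (space M)" using sets.sets_into_space by blast
  have sF: "sets F = sigma_sets (space M) ?G" and spF: "space F = space M"
    unfolding F_def using Gp by (auto intro!: sets_measure_of space_measure_of)
  have FM: "sets F \<subseteq> sets M" unfolding sF using G by (rule sets.sigma_sets_subset)
  have idm: "(\<lambda>\<omega>. \<omega>) \<in> measurable M F"
    by (rule measurableI) (use FM spF sets.sets_into_space in \<open>auto simp: Int_absorb2\<close>)
  have dist: "distributed M lborel T (exponential_density q)" and ind: "indep_set {T -` B \<inter> space M | B. B \<in> sets borel} (sigma_sets (space M) ?G)"
    using T unfolding independent_exponential_time_def by auto
  have Tm: "T \<in> borel_measurable M" using distributed_measurable[OF dist] by simp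
  have dT: "distr M borel T = exp_law q"
    using dist unfolding distributed_def by (metis distr_cong sets_lborel)
  interpret DF: prob_space "distr M F (\<lambda>\<omega>. \<omega>)" by (rule prob_space_distr[OF idm])
  have m1: "(\<lambda>\<omega>. (T \<omega>, \<omega>)) \<in> measurable M (borel \<Otimes>\<^sub>M F)" by (intro measurable_Pair Tm idm)
  have d: "exp_law q \<Otimes>\<^sub>M distr M F (\<lambda>\<omega>. \<omega>) = distr M (borel \<Otimes>\<^sub>M F) (\<lambda>\<omega>. (T \<omega>, \<omega>))"
  proof (rule pair_measure_eqI)
    show "sigma_finite_measure (exp_law q)" "sigma_finite_measure (distr M F (\<lambda>\<omega>. \<omega>))" by unfold_locales
    show "sets (exp_law q \<Otimes>\<^sub>M distr M F (\<lambda>\<omega>. \<omega>)) = sets (distr M (borel \<Otimes>\<^sub>M F) (\<lambda>\<omega>. (T \<omega>, \<omega>)))"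
      unfolding sets_distr by (rule sets_pair_measure_cong) auto
    fix A B assume A: "A \<in> sets (exp_law q)" and B: "B \<in> sets (distr M F (\<lambda>\<omega>. \<omega>))"
    then have A': "A \<in> sets borel" and B': "B \<in> sets F" by auto
    have Bs: "B \<subseteq> space M" using sets.sets_into_space[OF B'] spF by simp
    have "emeasure (exp_law q) A = prob (T -` A \<inter> space M)"
      unfolding dT[symmetric] by (simp add: emeasure_distr[OF Tm A'] emeasure_eq_measure)
    moreover have "emeasure (distr M F (\<lambda>\<omega>. \<omega>)) B = prob B"
      using Bs by (simp add: emeasure_distr[OF idm B'] emeasure_eq_measure Int_absorb2)
    moreover have "emeasure (distr M (borel \<Otimes>\<^sub>M F) (\<lambda>\<omega>. (T \<omega>, \<omega>))) (A \<times> B) = prob ((T -` A \<inter> space M) \<inter> B)"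
    proof -
      have "(\<lambda>\<omega>. (T \<omega>, \<omega>)) -` (A \<times> B) \<inter> space M = (T -` A \<inter> space M) \<inter> B" using Bs by auto
      then show ?thesis using A' B' by (simp add: emeasure_distr[OF m1] emeasure_eq_measure)
    qed
    moreover have "prob ((T -` A \<inter> space M) \<inter> B) = prob (T -` A \<inter> space M) * prob B"
      by (rule indep_setD[OF ind]) (use A' B' in \<open>auto simp: sF\<close>)
    ultimately show "emeasure (exp_law q) A * emeasure (distr M F (\<lambda>\<omega>. \<omega>)) B =
        emeasure (distr M (borel \<Otimes>\<^sub>M F) (\<lambda>\<omega>. (T \<omega>, \<omega>))) (A \<times> B)"
      by (simp add: ennreal_mult)
  qed
  have d2: "exp_law q \<Otimes>\<^sub>M distr M F (\<lambda>\<omega>. \<omega>) = distr (exp_law q \<Otimes>\<^sub>M M) (borel \<Otimes>\<^sub>M F) (\<lambda>(x, y). (x, y))"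
  proof -
    have "distr (exp_law q) borel (\<lambda>x. x) = exp_law q" by (rule distr_id2) simp
    then show ?thesis
      using pair_measure_distr[of "\<lambda>x. x" "exp_law q" borel "\<lambda>\<omega>. \<omega>" M F] idm DF.sigma_finite_measure_axioms by simp
  qed
  have m2: "(\<lambda>(x, y). (x, y)) \<in> measurable (exp_law q \<Otimes>\<^sub>M M) (borel \<Otimes>\<^sub>M F)"
  proof -
    have "fst \<in> measurable (exp_law q \<Otimes>\<^sub>M M) borel" using measurable_fst[of "exp_law q" M] by simp
    moreover have "snd \<in> measurable (exp_law q \<Otimes>\<^sub>M M) F" using measurable_compose[OF measurable_snd idm] .
    ultimately have "(\<lambda>p. (fst p, snd p)) \<in> measurable (exp_law q \<Otimes>\<^sub>M M) (borel \<Otimes>\<^sub>M F)" by (rule measurable_Pair)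
    then show ?thesis by (simp add: case_prod_beta')
  qed
  have "(LINT \<omega>|M. \<phi> (T \<omega>, \<omega>)) = (LINT p|distr M (borel \<Otimes>\<^sub>M F) (\<lambda>\<omega>. (T \<omega>, \<omega>)). \<phi> p)"
    by (rule integral_distr[OF m1 \<phi>, symmetric])
  also have "\<dots> = (LINT p|(exp_law q \<Otimes>\<^sub>M M). \<phi> p)"
    unfolding d[symmetric] d2 by (subst integral_distr[OF m2 \<phi>]) (simp add: case_prod_beta')
  finally show ?thesis .
qed

lemma wh_eq_expectation:
  assumes T: "independent_exponential_time M X q T" and q: "0 < q"
  shows "wh_plus M X T \<xi> = (LINT p|(exp_law q \<Otimes>\<^sub>M M). exp (\<i> * \<xi> * complex_of_real (ST p)))"
    and "wh_minus M X T \<xi> = (LINT p|(exp_law q \<Otimes>\<^sub>M M). exp (\<i> * \<xi> * complex_of_real (ZT p)))"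
proof -
  define F where "F = sigma (space M) {X t -` B \<inter> space M | t B. 0 \<le> t \<and> B \<in> sets borel}"
  have Gp: "{X t -` B \<inter> space M | t B. 0 \<le> t \<and> B \<in> sets borel} \<subseteq> Pow (space M)" by auto
  have spF: "space F = space M" unfolding F_def by (rule space_measure_of[OF Gp])
  have XF: "X t \<in> borel_measurable F" if "0 \<le> t" for t
  proof (rule measurableI)
    fix A :: "real set" assume "A \<in> sets borel"
    then show "X t -` A \<inter> space F \<in> sets F"
      unfolding spF unfolding F_def sets_measure_of[OF Gp] using that by (intro sigma_sets.Basic) auto
  qed simp
  note [measurable] = measurable_randomized_time[OF spF XF]
  have dist: "distributed M lborel T (exponential_density q)"
    using T unfolding independent_exponential_time_def by auto
  then have Tm[measurable]: "T \<in> borel_measurable M" using distributed_measurable[OF dist] by simp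
  have pos: "AE \<omega> in M. 0 \<le> T \<omega>"
  proof -
    have "AE t in distr M lborel T. 0 \<le> t"
      unfolding distributed_distr_eq_density[OF dist]
      by (subst AE_density) (auto simp: exponential_density_def)
    then show ?thesis by (subst (asm) AE_distr_iff) auto
  qed
  have e[measurable]: "(\<lambda>x. exp (\<i> * \<xi> * complex_of_real x)) \<in> borel_measurable borel"
    by (intro borel_measurable_continuous_onI continuous_intros)
  have FM: "(\<lambda>\<omega>. (T \<omega>, \<omega>)) \<in> measurable M (borel \<Otimes>\<^sub>M M)" by measurable
  have SM: "(\<lambda>\<omega>. ST (T \<omega>, \<omega>)) \<in> borel_measurable M" and IM: "(\<lambda>\<omega>. IT (T \<omega>, \<omega>)) \<in> borel_measurable M"
    using measurable_compose[OF FM measurable_randomized_time(2)[OF refl measurable_X]]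
      measurable_compose[OF FM measurable_randomized_time(3)[OF refl measurable_X]] by auto
  note [measurable] = SM IM
  \<comment> \<open>At a negative time the extrema range over the empty set and take a default value; this has probability 0.\<close>
  have sup: "running_sup X (T \<omega>) \<omega> = (if 0 \<le> T \<omega> then ST (T \<omega>, \<omega>) else Sup {})"
    and inf: "running_inf X (T \<omega>) \<omega> = (if 0 \<le> T \<omega> then IT (T \<omega>, \<omega>) else Inf {})" for \<omega>
    by (auto simp: ST_def IT_def max_absorb2 running_sup_def running_inf_def)
  have "wh_plus M X T \<xi> = (LINT \<omega>|M. exp (\<i> * \<xi> * complex_of_real (ST (T \<omega>, \<omega>))))"
    unfolding wh_plus_def sup
    by (rule integral_cong_AE) (use pos in \<open>(measurable; fail) | (eventually_elim, simp)\<close>)+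
  also have "\<dots> = (LINT p|(exp_law q \<Otimes>\<^sub>M M). exp (\<i> * \<xi> * complex_of_real (ST p)))"
    by (rule expectation_independent_time[OF T q, of "\<lambda>p. exp (\<i> * \<xi> * complex_of_real (ST p))"])
      (unfold F_def[symmetric], measurable)
  finally show "wh_plus M X T \<xi> = (LINT p|(exp_law q \<Otimes>\<^sub>M M). exp (\<i> * \<xi> * complex_of_real (ST p)))" .
  have mr[measurable]: "ZT \<in> borel_measurable (exp_law q \<Otimes>\<^sub>M M)"
    unfolding ZT_def[abs_def] by (intro borel_measurable_diff measurable_randomized)
  have "wh_minus M X T \<xi> = (LINT \<omega>|M. exp (\<i> * \<xi> * complex_of_real (IT (T \<omega>, \<omega>))))"
    unfolding wh_minus_def inf
    by (rule integral_cong_AE) (use pos in \<open>(measurable; fail) | (eventually_elim, simp)\<close>)+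
  also have "\<dots> = (LINT p|(exp_law q \<Otimes>\<^sub>M M). exp (\<i> * \<xi> * complex_of_real (IT p)))"
    by (rule expectation_independent_time[OF T q, of "\<lambda>p. exp (\<i> * \<xi> * complex_of_real (IT p))"])
      (unfold F_def[symmetric], measurable)
  also have "\<dots> = (LINT y|distr (exp_law q \<Otimes>\<^sub>M M) borel IT. exp (\<i> * \<xi> * complex_of_real y))"
    by (rule integral_distr[OF measurable_randomized(3) e, symmetric])
  also have "\<dots> = (LINT p|(exp_law q \<Otimes>\<^sub>M M). exp (\<i> * \<xi> * complex_of_real (ZT p)))"
    unfolding wiener_hopf(2)[OF q, symmetric] by (rule integral_distr[OF mr e])
  finally show "wh_minus M X T \<xi> = (LINT p|(exp_law q \<Otimes>\<^sub>M M). exp (\<i> * \<xi> * complex_of_real (ZT p)))" .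
qed

text \<open>A mean that equals an exponential is not 0, so the integrand must be integrable: the exponent carries the exponential
  moments from time 1 to all times. The bound on the modulus of the characteristic function by its value at \<open>\<i> * Im \<xi>\<close>
  yields positivity of \<open>Re (q + \<psi> \<xi>)\<close>, so that the Laplace transform in time converges.\<close>

lemma randomized_characteristic_function:
  assumes psi: "characteristic_exponent M X \<psi>" and q: "0 < q"
    and mom: "integrable M (\<lambda>\<omega>. exp (- Im \<xi> * X 1 \<omega>))"
    and pos: "0 < q + Re (\<psi> (\<i> * complex_of_real (Im \<xi>)))"
  shows "integrable (exp_law q \<Otimes>\<^sub>M M) (\<lambda>p. exp (\<i> * \<xi> * complex_of_real (XT p)))"
    and "integrable (exp_law q \<Otimes>\<^sub>M M) (\<lambda>p. exp (- Im \<xi> * XT p))"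
    and "(LINT p|(exp_law q \<Otimes>\<^sub>M M). exp (\<i> * \<xi> * complex_of_real (XT p))) = q / (q + \<psi> \<xi>)"
    and "0 < Re (q + \<psi> \<xi>)"
proof -
  interpret E: prob_space "exp_law q" by (rule prob_space_exponential_density[OF q])
  interpret EM: pair_sigma_finite "exp_law q" M ..
  let ?g = "Im \<xi>" and ?ig = "\<i> * complex_of_real (Im \<xi>)"
  note [measurable] = measurable_randomized(1)[of q]
  \<comment> \<open>All points with the same imaginary part share the integrability condition in the definition of the exponent.\<close>
  have psiI: "(LINT \<omega>|M. exp (\<i> * z * complex_of_real (X t \<omega>))) = exp (- complex_of_real t * \<psi> z)"
    if "Im z = ?g" "0 \<le> t" for z t
    using psi mom that unfolding characteristic_exponent_def by auto
  have int: "integrable M (\<lambda>\<omega>. exp (\<i> * z * complex_of_real (X t \<omega>)))" if "Im z = ?g" "0 \<le> t" for z t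
    using psiI[OF that] not_integrable_integral_eq[of M "\<lambda>\<omega>. exp (\<i> * z * complex_of_real (X t \<omega>))"] by force
  have nrm: "norm (exp (\<i> * z * complex_of_real x)) = exp (- Im z * x)" for z x by (simp add: norm_exp)
  have re: "complex_of_real (exp (- ?g * x)) = exp (\<i> * ?ig * complex_of_real x)" for x
    by (simp add: exp_of_real[symmetric] mult.assoc[symmetric])
  have intr: "integrable M (\<lambda>\<omega>. exp (- ?g * X t \<omega>))" if "0 \<le> t" for t
    using integrable_norm[OF int[OF _ that, of \<xi>]] unfolding nrm by simp
  have Er: "(LINT \<omega>|M. exp (- ?g * X t \<omega>)) = exp (- t * Re (\<psi> ?ig))" if t: "0 \<le> t" for t
  proof -
    have "complex_of_real (LINT \<omega>|M. exp (- ?g * X t \<omega>)) = exp (- complex_of_real t * \<psi> ?ig)"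
      unfolding integral_complex_of_real[symmetric] re by (rule psiI[OF _ t]) simp
    then have "norm (complex_of_real (LINT \<omega>|M. exp (- ?g * X t \<omega>))) = exp (- t * Re (\<psi> ?ig))"
      by (simp add: norm_exp)
    moreover have "0 \<le> (LINT \<omega>|M. exp (- ?g * X t \<omega>))" by (rule integral_nonneg_AE) auto
    ultimately show ?thesis by (simp del: of_real_exp)
  qed
  show pos': "0 < Re (q + \<psi> \<xi>)"
  proof -
    have "norm (LINT \<omega>|M. exp (\<i> * \<xi> * complex_of_real (X 1 \<omega>))) \<le> (LINT \<omega>|M. norm (exp (\<i> * \<xi> * complex_of_real (X 1 \<omega>))))"
      by (rule integral_norm_bound)
    then have "exp (- Re (\<psi> \<xi>)) \<le> exp (- Re (\<psi> ?ig))"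
      using psiI[of \<xi> 1] Er[of 1] unfolding nrm by (simp add: norm_exp)
    then show ?thesis using pos by simp
  qed
  show ir: "integrable (exp_law q \<Otimes>\<^sub>M M) (\<lambda>p. exp (- ?g * XT p))"
  proof (rule EM.Fubini_integrable)
    have AEp: "AE t in exp_law q. 0 \<le> t"
      by (subst AE_density) (auto intro!: AE_I2 simp: exponential_density_def)
    have "integrable (exp_law q) (\<lambda>t. exp (- (complex_of_real (Re (\<psi> ?ig)) * complex_of_real t)))"
      by (rule integral_exp_law_exp[OF q]) (use pos in simp)
    from integrable_norm[OF this] have i: "integrable (exp_law q) (\<lambda>t. exp (- t * Re (\<psi> ?ig)))" by (simp add: norm_exp mult.commute)
    show "integrable (exp_law q) (\<lambda>t. LINT \<omega>|M. norm (exp (- ?g * XT (t, \<omega>))))"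
    proof (rule integrable_cong_AE_imp[OF i])
      show "(\<lambda>t. LINT \<omega>|M. norm (exp (- ?g * XT (t, \<omega>)))) \<in> borel_measurable (exp_law q)" by measurable
      show "AE t in exp_law q. exp (- t * Re (\<psi> ?ig)) = (LINT \<omega>|M. norm (exp (- ?g * XT (t, \<omega>))))"
        using AEp by eventually_elim (simp add: XT_def max_absorb2 Er[simplified])
    qed
    show "AE t in exp_law q. integrable M (\<lambda>\<omega>. exp (- ?g * XT (t, \<omega>)))"
      using AEp by eventually_elim (use intr in \<open>simp add: XT_def max_absorb2\<close>)
  qed measurable
  have em: "(\<lambda>x. exp (\<i> * \<xi> * complex_of_real x)) \<in> borel_measurable borel"
    by (intro borel_measurable_continuous_onI continuous_intros)
  show ic: "integrable (exp_law q \<Otimes>\<^sub>M M) (\<lambda>p. exp (\<i> * \<xi> * complex_of_real (XT p)))"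
    by (rule Bochner_Integration.integrable_bound[OF ir])
      (auto simp: nrm intro!: measurable_compose[OF _ em] measurable_randomized)
  have "(LINT p|(exp_law q \<Otimes>\<^sub>M M). exp (\<i> * \<xi> * complex_of_real (XT p))) =
     (LINT t|exp_law q. LINT \<omega>|M. exp (\<i> * \<xi> * complex_of_real (XT (t, \<omega>))))"
    by (rule EM.integral_fst'[OF ic, symmetric])
  also have "\<dots> = (LINT t|exp_law q. exp (- (\<psi> \<xi> * complex_of_real t)))"
  proof (rule integral_cong_AE)
    have "AE t in exp_law q. 0 \<le> t"
      by (subst AE_density) (auto intro!: AE_I2 simp: exponential_density_def)
    then show "AE t in exp_law q. (LINT \<omega>|M. exp (\<i> * \<xi> * complex_of_real (XT (t, \<omega>)))) = exp (- (\<psi> \<xi> * complex_of_real t))"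
      by eventually_elim (simp add: XT_def max_absorb2 psiI mult.commute)
    show "(\<lambda>t. LINT \<omega>|M. exp (\<i> * \<xi> * complex_of_real (XT (t, \<omega>)))) \<in> borel_measurable (exp_law q)"
      using borel_measurable_integrable[OF EM.integrable_fst'[OF ic]] by simp
  qed auto
  also have "\<dots> = q / (q + \<psi> \<xi>)" by (rule integral_exp_law_exp(2)[OF q pos'])
  finally show "(LINT p|(exp_law q \<Otimes>\<^sub>M M). exp (\<i> * \<xi> * complex_of_real (XT p))) = q / (q + \<psi> \<xi>)" .
qed

lemma laplace_value_eq_expectation:
  assumes q: "0 < q"
    and m: "(\<lambda>p. f (x1 + XT p) (max x2 (x1 + ST p))) \<in> borel_measurable (exp_law q \<Otimes>\<^sub>M M)"
    and int: "integrable (exp_law q \<Otimes>\<^sub>M M) (\<lambda>p. f (x1 + XT p) (max x2 (x1 + ST p)))"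
  shows "laplace_value M X f q x1 x2 = (LINT p|(exp_law q \<Otimes>\<^sub>M M). f (x1 + XT p) (max x2 (x1 + ST p))) / q"
proof -
  interpret E: prob_space "exp_law q" by (rule prob_space_exponential_density[OF q])
  interpret EM: pair_sigma_finite "exp_law q" M ..
  have nn: "AE t in lborel. 0 \<le> exponential_density q t"
    using exponential_density_nonneg[OF q] by auto
  define V where "V t = (LINT \<omega>|M. f (x1 + XT (t, \<omega>)) (max x2 (x1 + ST (t, \<omega>))))" for t
  have iV: "integrable (exp_law q) V" unfolding V_def by (rule EM.integrable_fst'[OF int])
  then have Vm: "V \<in> borel_measurable borel" using borel_measurable_integrable[OF iV] by simp
  have "(LINT p|(exp_law q \<Otimes>\<^sub>M M). f (x1 + XT p) (max x2 (x1 + ST p))) = (LINT t|exp_law q. V t)"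
    unfolding V_def by (rule EM.integral_fst'[OF int, symmetric])
  also have "\<dots> = (LINT t|lborel. exponential_density q t *\<^sub>R V t)"
    by (rule integral_density[OF _ _ nn]) (use Vm in auto)
  also have "\<dots> = (LINT t|lborel. q * (indicator {0..} t *\<^sub>R (exp (- q * t) * option_value M X f t x1 x2)))"
    by (intro Bochner_Integration.integral_cong refl)
      (auto simp: exponential_density_def V_def option_value_def XT_def ST_def max_absorb2 mult.commute)
  also have "\<dots> = q * laplace_value M X f q x1 x2"
    unfolding laplace_value_def set_lebesgue_integral_def by simp
  finally show ?thesis using q by simp
qed

end

section \<open>Inversion along a horizontal line\<close>

text \<open>The factors \<open>exp (- w * Z)\<close> and \<open>exp (w * y)\<close> move the real line to \<open>Im \<xi> = w\<close> and cancel in the mean.\<close>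

lemma line_inversion:
  fixes Z :: "'a \<Rightarrow> real" and c :: "'a \<Rightarrow> complex" and g :: "real \<Rightarrow> complex"
  assumes P: "sigma_finite_measure P" and Z[measurable]: "Z \<in> borel_measurable P"
    and c: "integrable P (\<lambda>\<omega>. c \<omega> * complex_of_real (exp (- w * Z \<omega>)))"
    and g: "integrable lborel (\<lambda>y. complex_of_real (exp (w * y)) * g y)"
    and gb: "\<And>y. norm (complex_of_real (exp (w * y)) * g y) \<le> C"
    and cont: "AE \<omega> in P. c \<omega> \<noteq> 0 \<longrightarrow> isCont g (Z \<omega>)"
    and H: "\<And>u. H u = (LINT \<omega>|P. c \<omega> * exp (\<i> * Complex u w * Z \<omega>))"
    and G: "\<And>u. G u = (LINT y|lborel. exp (- (\<i> * Complex u w * y)) * g y)"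
    and int: "integrable lborel (\<lambda>u. H u * G u)"
  shows "(LINT u|lborel. H u * G u) = 2 * pi * (LINT \<omega>|P. c \<omega> * g (Z \<omega>))"
proof -
  have e1: "c \<omega> * exp (\<i> * Complex u w * x) = c \<omega> * complex_of_real (exp (- w * x)) * iexp (u * x)" for \<omega> u x
  proof -
    have "\<i> * Complex u w * x = complex_of_real (- w * x) + \<i> * complex_of_real (u * x)"
      by (simp add: complex_eq_iff)
    then show ?thesis by (simp only: exp_add exp_of_real mult.assoc)
  qed
  have e2: "exp (- (\<i> * Complex u w * y)) * g y = iexp (- u * y) * (complex_of_real (exp (w * y)) * g y)" for u y
  proof -
    have "- (\<i> * Complex u w * y) = \<i> * complex_of_real (- u * y) + complex_of_real (w * y)"
      by (simp add: complex_eq_iff)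
    then show ?thesis by (simp only: exp_add exp_of_real mult.assoc)
  qed
  have ct: "AE \<omega> in P. c \<omega> * complex_of_real (exp (- w * Z \<omega>)) \<noteq> 0 \<longrightarrow> isCont (\<lambda>y. complex_of_real (exp (w * y)) * g y) (Z \<omega>)"
    using cont by eventually_elim (auto intro!: continuous_intros)
  have "(LINT u|lborel. H u * G u) = 2 * pi * (LINT \<omega>|P. (c \<omega> * complex_of_real (exp (- w * Z \<omega>))) * (complex_of_real (exp (w * Z \<omega>)) * g (Z \<omega>)))"
    unfolding H G e1 e2
    by (rule fourier_inversion[OF P Z c g gb ct]) (use int in \<open>simp only: H G e1 e2\<close>)
  also have "(\<lambda>\<omega>. (c \<omega> * complex_of_real (exp (- w * Z \<omega>))) * (complex_of_real (exp (w * Z \<omega>)) * g (Z \<omega>))) = (\<lambda>\<omega>. c \<omega> * g (Z \<omega>))"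
  proof
    fix \<omega>
    have "complex_of_real (exp (- w * Z \<omega>)) * complex_of_real (exp (w * Z \<omega>)) = 1"
      by (simp flip: of_real_mult exp_add)
    then show "(c \<omega> * complex_of_real (exp (- w * Z \<omega>))) * (complex_of_real (exp (w * Z \<omega>)) * g (Z \<omega>)) = c \<omega> * g (Z \<omega>)"
      by (metis (no_types, opaque_lifting) mult.assoc mult.right_neutral)
  qed
  finally show ?thesis .
qed

lemma truncated_integral_tendsto:
  fixes g :: "real \<Rightarrow> complex"
  assumes "integrable lborel g"
  shows "((\<lambda>R. LINT u:{-R..R}|lborel. g u) \<longlongrightarrow> (LINT u|lborel. g u)) at_top"
  unfolding set_lebesgue_integral_def
proof (rule integral_dominated_convergence_at_top)
  show "integrable lborel (\<lambda>u. norm (g u))" using assms by (rule integrable_norm)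
  show "AE u in lborel. ((\<lambda>R. indicator {-R..R} u *\<^sub>R g u) \<longlongrightarrow> g u) at_top"
  proof (rule AE_I2)
    fix u :: real
    have "\<forall>\<^sub>F R in at_top. indicator {-R..R} u *\<^sub>R g u = g u"
      using eventually_ge_at_top[of "\<bar>u\<bar>"] by eventually_elim (auto simp: indicator_def)
    then show "((\<lambda>R. indicator {-R..R} u *\<^sub>R g u) \<longlongrightarrow> g u) at_top" by (rule tendsto_eventually)
  qed
qed (use assms in \<open>auto simp: indicator_def\<close>)

lemma line_integral_eq:
  assumes "integrable lborel (\<lambda>u. g (Complex u w))"
  shows "line_integral w g = (LINT u|lborel. g (Complex u w))"
  unfolding line_integral_def
  by (rule tendsto_Lim) (auto intro: truncated_integral_tendsto assms)

lemma integrable_powr_decay: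
  fixes \<nu> :: real
  assumes nu: "\<nu> > 0"
  shows "integrable lborel (\<lambda>u. (1 + \<bar>u\<bar>) powr (- \<nu> - 1))"
proof -
  define h where "h u = indicator {0..} u * (1 + u) powr (- \<nu> - 1)" for u :: real
  have h: "integrable lborel h"
  proof (rule integrableI_nonneg)
    have hm: "(\<lambda>u. indicator {0..} u * \<bar>1 + u\<bar> powr (- \<nu> - 1)) \<in> borel_measurable borel" by measurable
    then show "h \<in> borel_measurable lborel" unfolding h_def by simp
    have "(\<integral>\<^sup>+ x. ennreal ((1 + x) powr (- \<nu> - 1)) * indicator {0..} x \<partial>lborel) = ennreal (0 - (- ((1 + 0) powr (- \<nu>)) / \<nu>))"
    proof (rule nn_integral_FTC_atLeast)
      show "DERIV (\<lambda>x. - ((1 + x) powr (- \<nu>)) / \<nu>) x :> (1 + x) powr (- \<nu> - 1)" if "0 \<le> x" for x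
        using nu that by (auto intro!: derivative_eq_intros simp: algebra_simps)
      have "filterlim (\<lambda>x::real. 1 + x) at_top at_top"
        by (rule filterlim_tendsto_add_at_top[OF tendsto_const filterlim_ident])
      then have "((\<lambda>x. (1 + x) powr (- \<nu>)) \<longlongrightarrow> 0) at_top"
        using nu by (intro tendsto_neg_powr) auto
      from tendsto_divide[OF tendsto_minus[OF this] tendsto_const, of \<nu>] nu
      show "((\<lambda>x. - ((1 + x) powr (- \<nu>)) / \<nu>) \<longlongrightarrow> 0) at_top" by simp
    qed auto
    moreover have "(\<integral>\<^sup>+ x. ennreal (h x) \<partial>lborel) = (\<integral>\<^sup>+ x. ennreal ((1 + x) powr (- \<nu> - 1)) * indicator {0..} x \<partial>lborel)"
      by (intro nn_integral_cong) (auto simp: indicator_def h_def)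
    ultimately show "(\<integral>\<^sup>+ x. ennreal (h x) \<partial>lborel) < \<infinity>" by simp
  qed (auto simp: h_def)
  have "integrable lborel (\<lambda>u. h u + h (- u))"
    using h lborel_integrable_real_affine_iff[of "-1" h 0] by auto
  then show ?thesis
    by (rule Bochner_Integration.integrable_bound) (auto simp: h_def indicator_def intro!: AE_I2)
qed

lemma integrable_decay:
  fixes g :: "real \<Rightarrow> complex"
  assumes nu: "\<nu> > 0" and [measurable]: "g \<in> borel_measurable borel"
    and b: "\<And>u. norm (g u) \<le> C * (1 + \<bar>u\<bar>) powr (- \<nu>) / (1 + \<bar>u\<bar>)"
  shows "integrable lborel g"
proof (rule Bochner_Integration.integrable_bound)
  show "integrable lborel (\<lambda>u. C * (1 + \<bar>u\<bar>) powr (- \<nu> - 1))"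
    using integrable_powr_decay[OF nu] by simp
  have "C * (1 + \<bar>u\<bar>) powr (- \<nu>) / (1 + \<bar>u\<bar>) = C * (1 + \<bar>u\<bar>) powr (- \<nu> - 1)" for u
  proof -
    have "(1 + \<bar>u\<bar>) powr (- \<nu> - 1) = (1 + \<bar>u\<bar>) powr (- \<nu>) / (1 + \<bar>u\<bar>) powr 1"
      using powr_diff[of "1 + \<bar>u\<bar>" "- \<nu>" 1] by simp
    then show ?thesis by simp
  qed
  then show "AE u in lborel. norm (g u) \<le> norm (C * (1 + \<bar>u\<bar>) powr (- \<nu> - 1))"
    using b by (intro AE_I2) (metis abs_ge_self order_trans real_norm_def)
qed measurable

text \<open>On a vertical line away from 0 a reciprocal decays like the reciprocal of the imaginary part. All integrability below rests on
  this gain of one power, with any \<open>\<nu> > 0\<close> added from the Wiener--Hopf factors.\<close>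

lemma inverse_norm_bound:
  fixes c :: complex
  assumes "Re c \<ge> \<kappa>" "\<kappa> > 0"
  shows "1 / norm c \<le> (1 + 1 / \<kappa>) / (1 + \<bar>Im c\<bar>)"
proof -
  have k: "\<kappa> \<le> norm c" using assms complex_Re_le_cmod[of c] by linarith
  then have "1 \<le> norm c / \<kappa>" using assms by (simp add: pos_le_divide_eq)
  then have "1 + \<bar>Im c\<bar> \<le> (1 + 1 / \<kappa>) * norm c"
    using abs_Im_le_cmod[of c] by (simp add: algebra_simps)
  moreover define A where "A = 1 + 1 / \<kappa>"
  ultimately have "1 + \<bar>Im c\<bar> \<le> A * norm c" by simp
  moreover have "norm c > 0" using k assms by linarith
  ultimately show ?thesis unfolding A_def[symmetric]
    by (simp add: pos_le_divide_eq pos_divide_le_eq)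
qed

section \<open>The exchange payoff and the gain from a rising supremum\<close>

lemma payoff_eq:
  assumes b: "1 < \<beta>" and y: "0 \<le> y"
  shows "exchange_payoff \<beta> x y = indicator {y / \<beta>..y} x * (exp (\<beta> * x) - exp y)"
proof -
  have "exp y \<le> exp (\<beta> * x) \<longleftrightarrow> y / \<beta> \<le> x" using b by (simp add: pos_divide_le_eq mult.commute)
  then show ?thesis unfolding exchange_payoff_def by (auto simp: indicator_def max_def)
qed

lemma payoff_bounds:
  shows "0 \<le> exchange_payoff \<beta> x y" "exchange_payoff \<beta> x y \<le> exp (\<beta> * x)"
    "y < x \<Longrightarrow> exchange_payoff \<beta> x y = 0"
  unfolding exchange_payoff_def by (auto simp: indicator_def)

lemma payoff_le: "0 \<le> \<beta> \<Longrightarrow> exchange_payoff \<beta> x y \<le> exp (\<beta> * y)"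
  unfolding exchange_payoff_def by (auto simp: indicator_def max_def mult_left_mono intro: order_trans[of _ "exp (\<beta> * x)"])

lemma measurable_payoff[measurable]:
  assumes [measurable]: "f \<in> borel_measurable N" "g \<in> borel_measurable N"
  shows "(\<lambda>x. exchange_payoff \<beta> (f x) (g x)) \<in> borel_measurable N"
proof -
  have "(\<lambda>x. exchange_payoff \<beta> (f x) (g x)) = (\<lambda>x. max (exp (\<beta> * f x) - exp (g x)) 0 * of_bool (f x \<le> g x))"
    by (auto simp: exchange_payoff_def indicator_def)
  also have "\<dots> \<in> borel_measurable N" by measurable
  finally show ?thesis .
qed

lemma isCont_payoff:
  assumes f: "isCont f x" and g: "isCont g x" and ne: "f x \<noteq> g x"
  shows "isCont (\<lambda>x. exchange_payoff \<beta> (f x) (g x)) x"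
proof -
  have lim: "((\<lambda>r. g r - f r) \<longlongrightarrow> g x - f x) (nhds x)"
    using isCont_diff[OF g f] tendsto_at_iff_tendsto_nhds[of "\<lambda>r. g r - f r" x] unfolding isCont_def by simp
  show ?thesis
  proof (cases "f x < g x")
    case True
    with order_tendstoD(1)[OF lim, of 0]
    have ev: "\<forall>\<^sub>F r in nhds x. exchange_payoff \<beta> (f r) (g r) = max (exp (\<beta> * f r) - exp (g r)) 0"
      by (auto simp: exchange_payoff_def elim!: eventually_mono)
    have "isCont (\<lambda>r. max (exp (\<beta> * f r) - exp (g r)) 0) x" by (intro continuous_intros f g)
    then show ?thesis using isCont_cong[OF ev] by simp
  next
    case False
    with order_tendstoD(2)[OF lim, of 0] ne
    have ev: "\<forall>\<^sub>F r in nhds x. exchange_payoff \<beta> (f r) (g r) = 0"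
      by (auto simp: exchange_payoff_def elim!: eventually_mono)
    then show ?thesis using isCont_cong[OF ev] by simp
  qed
qed

lemma payoff_transform:
  fixes s :: complex
  assumes b: "1 < \<beta>" and y: "0 \<le> y" and s: "Re s < 0"
  shows "integrable lborel (\<lambda>x. exp (- (s * complex_of_real x)) * exchange_payoff \<beta> x y)"
    and "(LINT x|lborel. exp (- (s * complex_of_real x)) * exchange_payoff \<beta> x y)
       = exp ((\<beta> - s) * y) / (\<beta> - s) + \<beta> * (exp ((1 - s / \<beta>) * y) / ((\<beta> - s) * (- s))) - exp ((1 - s) * y) / (- s)"
proof -
  have s0: "s \<noteq> 0" "s - \<beta> \<noteq> 0" "\<beta> - s \<noteq> 0" using s b by (auto simp: complex_eq_iff)
  have yb: "y / \<beta> \<le> y" using b y by (simp add: divide_le_eq mult_left_le_one_le mult_le_cancel_left1)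
  have eq: "exp (- (s * complex_of_real x)) * exchange_payoff \<beta> x y =
      indicator {y / \<beta>..y} x *\<^sub>R exp (- ((s - \<beta>) * complex_of_real x)) -
      exp y * (indicator {y / \<beta>..y} x *\<^sub>R exp (- (s * complex_of_real x)))" for x
    unfolding payoff_eq[OF b y]
    by (auto simp: indicator_def exp_of_real[symmetric] mult_exp_exp algebra_simps)
  have i: "integrable lborel (\<lambda>x. indicator {y / \<beta>..y} x *\<^sub>R exp (- (c * complex_of_real x)))" for c :: complex
    by (intro borel_integrable_compact continuous_intros) auto
  show "integrable lborel (\<lambda>x. exp (- (s * complex_of_real x)) * exchange_payoff \<beta> x y)"
    unfolding eq by (intro Bochner_Integration.integrable_diff i integrable_mult_right)
  have "(LINT x|lborel. exp (- (s * complex_of_real x)) * exchange_payoff \<beta> x y) =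
     (exp (- ((s - \<beta>) * complex_of_real (y / \<beta>))) - exp (- ((s - \<beta>) * complex_of_real y))) / (s - \<beta>) -
     exp y * ((exp (- (s * complex_of_real (y / \<beta>))) - exp (- (s * complex_of_real y))) / s)"
    unfolding eq Bochner_Integration.integral_diff[OF i integrable_mult_right[OF i]] integral_mult_right_zero
      integral_exp_Icc[OF s0(2) yb] integral_exp_Icc[OF s0(1) yb] ..
  also have "exp (- ((s - \<beta>) * complex_of_real (y / \<beta>))) = exp ((1 - s / \<beta>) * y)"
    using b by (intro arg_cong[of _ _ exp]) (simp add: field_simps)
  also have "exp y * ((exp (- (s * complex_of_real (y / \<beta>))) - exp (- (s * complex_of_real y))) / s) = (exp ((1 - s / \<beta>) * y) - exp ((1 - s) * y)) / s"
    using b by (simp add: right_diff_distrib exp_of_real[symmetric] mult_exp_exp algebra_simps)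
  also have "exp (- ((s - \<beta>) * complex_of_real y)) = exp ((\<beta> - s) * y)" by (simp add: algebra_simps)
  also have "(exp ((1 - s / \<beta>) * y) - exp ((\<beta> - s) * y)) / (s - \<beta>) - (exp ((1 - s / \<beta>) * y) - exp ((1 - s) * y)) / s =
     exp ((\<beta> - s) * y) / (\<beta> - s) + \<beta> * (exp ((1 - s / \<beta>) * y) / ((\<beta> - s) * (- s))) - exp ((1 - s) * y) / (- s)"
  proof -
    have alg: "(A - B) / (- t) - (A - C) / s = B / t + (t + s) * (A / (t * (- s))) - C / (- s)" if "t \<noteq> 0" for A B C t :: complex
      using that s0(1) by (simp add: field_simps)
    show ?thesis using alg[OF s0(3), of "exp ((1 - s / \<beta>) * y)" "exp ((\<beta> - s) * y)" "exp ((1 - s) * y)"] by simp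
  qed
  finally show "(LINT x|lborel. exp (- (s * complex_of_real x)) * exchange_payoff \<beta> x y)
       = exp ((\<beta> - s) * y) / (\<beta> - s) + \<beta> * (exp ((1 - s / \<beta>) * y) / ((\<beta> - s) * (- s))) - exp ((1 - s) * y) / (- s)" .
qed


text \<open>The change of the payoff when the barrier moves from \<open>b\<close> to \<open>b + y\<close>, for a position \<open>z\<close> relative to the new
  barrier.\<close>

definition lookback_gain :: "real \<Rightarrow> real \<Rightarrow> real \<Rightarrow> real \<Rightarrow> real" where
  "lookback_gain \<beta> b y z = exchange_payoff \<beta> (b + y + z) (b + y) - exchange_payoff \<beta> (b + y + z) b"

text \<open>On the line of integration \<open>p = \<i> * \<eta>\<close>, this is the Fourier transform of the gain in the excess \<open>y\<close> of the supremum
  over the barrier.\<close>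

definition gain_transform :: "real \<Rightarrow> real \<Rightarrow> complex \<Rightarrow> real \<Rightarrow> complex" where
  "gain_transform \<beta> b p z = (LINT y|lborel. indicator {0..} y *\<^sub>R (exp (- (p * complex_of_real y)) * lookback_gain \<beta> b y z))"

lemma payoff_split:
  "exchange_payoff \<beta> (x1 + (s + z)) (max x2 (x1 + s)) =
     exchange_payoff \<beta> (x1 + (s + z)) x2 + indicator {x2 - x1..} s * lookback_gain \<beta> x2 (s - (x2 - x1)) z"
  by (auto simp: lookback_gain_def indicator_def max_def algebra_simps)

lemma measurable_lookback_gain[measurable]:
  assumes [measurable]: "f \<in> borel_measurable N" "g \<in> borel_measurable N"
  shows "(\<lambda>x. lookback_gain \<beta> b (f x) (g x)) \<in> borel_measurable N"
  unfolding lookback_gain_def by measurable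

lemma lookback_gain_bound:
  assumes "0 \<le> \<beta>" "0 \<le> y"
  shows "\<bar>lookback_gain \<beta> b y z\<bar> \<le> exp (\<beta> * (b + y))"
proof -
  have "exchange_payoff \<beta> (b + y + z) b \<le> exp (\<beta> * b)" by (rule payoff_le[OF assms(1)])
  also have "\<dots> \<le> exp (\<beta> * (b + y))" using assms by (simp add: mult_left_mono)
  finally show ?thesis
    using payoff_le[OF assms(1), of "b + y + z" "b + y"] payoff_bounds(1)[of \<beta> "b + y + z"]
    unfolding lookback_gain_def by (smt (verit))
qed

lemma lookback_gain_pos: "0 \<le> y \<Longrightarrow> 0 < z \<Longrightarrow> lookback_gain \<beta> b y z = 0"
  unfolding lookback_gain_def by (simp add: payoff_bounds(3))

context
  fixes \<beta> b :: real and p :: complex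
  assumes beta: "1 < \<beta>" and b: "0 \<le> b" and p: "\<beta> < Re p"
begin

lemma integrable_gain_majorant:
  "integrable lborel (\<lambda>y. indicator {0..} y * (exp (- Re p * y) * exp (\<beta> * (b + y))))"
proof -
  have eq: "indicator {0..} y * (exp (- Re p * y) * exp (\<beta> * (b + y))) = exp (\<beta> * b) * (indicator {0..} y * exp (- (Re p - \<beta>) * y))" for y
    by (simp add: mult_exp_exp algebra_simps)
  show ?thesis unfolding eq by (intro integrable_mult_right integrable_exp_atLeast) (use p in simp)
qed

lemma gain_integrand_bound:
  "norm (indicator {0..} y *\<^sub>R (exp (- (p * complex_of_real y)) * lookback_gain \<beta> b y z))
    \<le> indicator {0..} y * (exp (- Re p * y) * exp (\<beta> * (b + y)))"
proof (cases "0 \<le> y")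
  case True
  then show ?thesis using lookback_gain_bound[of \<beta> y b z] beta
    by (simp add: norm_mult norm_exp mult_left_mono)
qed simp

lemma gain_transform_pos: "0 < z \<Longrightarrow> gain_transform \<beta> b p z = 0"
proof -
  assume "0 < z"
  then have eq: "indicator {0..} y *\<^sub>R (exp (- (p * complex_of_real y)) * lookback_gain \<beta> b y z) = 0" for y
    using lookback_gain_pos[of y z \<beta> b] by (cases "0 \<le> y") auto
  show ?thesis unfolding gain_transform_def eq by simp
qed

lemma measurable_gain_transform[measurable]: "gain_transform \<beta> b p \<in> borel_measurable borel"
  unfolding gain_transform_def[abs_def] by measurable

text \<open>For fixed \<open>z \<noteq> 0\<close> the gain jumps in \<open>z\<close> only for the single excess \<open>y = - z\<close>, where the position sits at the old barrier.
  At \<open>z = 0\<close> the position sits at the new barrier for every \<open>y\<close>; that is the jump which the atom term \<open>I2\<close> accounts for.\<close>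

lemma isCont_gain_transform:
  assumes z: "z \<noteq> 0"
  shows "isCont (gain_transform \<beta> b p) z"
  unfolding continuous_at_sequentially
proof (intro allI impI)
  fix v :: "nat \<Rightarrow> real" assume v: "v \<longlonglongrightarrow> z"
  have "(\<lambda>n. gain_transform \<beta> b p (v n)) \<longlonglongrightarrow> gain_transform \<beta> b p z"
    unfolding gain_transform_def
  proof (rule integral_dominated_convergence[OF _ _ integrable_gain_majorant])
    show "AE y in lborel. norm (indicator {0..} y *\<^sub>R (exp (- (p * complex_of_real y)) * lookback_gain \<beta> b y (v n)))
        \<le> indicator {0..} y * (exp (- Re p * y) * exp (\<beta> * (b + y)))" for n
      using gain_integrand_bound by (intro AE_I2)
    have "AE y in lborel. y \<noteq> - z" by (rule AE_lborel_singleton)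
    then show "AE y in lborel. (\<lambda>n. indicator {0..} y *\<^sub>R (exp (- (p * complex_of_real y)) * lookback_gain \<beta> b y (v n)))
         \<longlonglongrightarrow> indicator {0..} y *\<^sub>R (exp (- (p * complex_of_real y)) * lookback_gain \<beta> b y z)"
    proof eventually_elim
      case (elim y)
      have "isCont (\<lambda>z. lookback_gain \<beta> b y z) z"
        unfolding lookback_gain_def using elim z
        by (intro continuous_intros isCont_payoff) auto
      then show ?case by (intro tendsto_intros isCont_tendsto_compose[OF _ v])
    qed
  qed measurable
  then show "(gain_transform \<beta> b p \<circ> v) \<longlonglongrightarrow> gain_transform \<beta> b p z" by (simp add: comp_def)
qed

text \<open>The payoff is a difference of exponentials on a half-line of excesses, so its transform has closed form, and decay of order
  \<open>1 / norm p\<close> uniformly in \<open>z\<close>.\<close>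

lemma moving_barrier_transform:
  assumes z: "z \<le> 0"
  shows "norm (LINT y|lborel. indicator {0..} y *\<^sub>R (exp (- (p * complex_of_real y)) * exchange_payoff \<beta> (b + y + z) (b + y)))
     \<le> exp (\<beta> * b) * (1 / norm (p - \<beta>) + 1 / norm (p - 1))"
    and "integrable lborel (\<lambda>y. indicator {0..} y *\<^sub>R (exp (- (p * complex_of_real y)) * exchange_payoff \<beta> (b + y + z) (b + y)))"
    and "z = 0 \<Longrightarrow> (LINT y|lborel. indicator {0..} y *\<^sub>R (exp (- (p * complex_of_real y)) * exchange_payoff \<beta> (b + y + z) (b + y)))
      = exp (\<beta> * b) / (p - \<beta>) - exp b / (p - 1)"
proof -
  define a where "a = max 0 (- (z * \<beta> / (\<beta> - 1)) - b)"
  have a0: "0 \<le> a" unfolding a_def by simp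
  have r1: "Re (p - \<beta>) > 0" and r2: "Re (p - 1) > 0" using p beta by auto
  have eq: "indicator {0..} y *\<^sub>R (exp (- (p * complex_of_real y)) * exchange_payoff \<beta> (b + y + z) (b + y)) =
     exp (\<beta> * (b + z)) * (indicator {a..} y *\<^sub>R exp (- ((p - \<beta>) * complex_of_real y)))
     - exp b * (indicator {a..} y *\<^sub>R exp (- ((p - 1) * complex_of_real y)))" for y
  proof -
    \<comment> \<open>The threshold \<open>a\<close> is where \<open>\<beta> * (b + y + z)\<close> reaches \<open>b + y\<close>, cut off at 0.\<close>
    have ay: "a \<le> y \<longleftrightarrow> 0 \<le> y \<and> b + y \<le> \<beta> * (b + y + z)"
    proof -
      have "- (z * \<beta> / (\<beta> - 1)) - b \<le> y \<longleftrightarrow> - (z * \<beta>) / (\<beta> - 1) \<le> y + b" by auto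
      also have "\<dots> \<longleftrightarrow> - (z * \<beta>) \<le> (y + b) * (\<beta> - 1)"
        by (rule pos_divide_le_eq) (use beta in simp)
      finally have "- (z * \<beta> / (\<beta> - 1)) - b \<le> y \<longleftrightarrow> - (z * \<beta>) \<le> (y + b) * (\<beta> - 1)" .
      then show ?thesis unfolding a_def by (auto simp: algebra_simps)
    qed
    show ?thesis
    proof (cases "a \<le> y")
      case True
      then have payoff: "exchange_payoff \<beta> (b + y + z) (b + y) = exp (\<beta> * (b + y + z)) - exp (b + y)"
        using ay z by (auto simp: exchange_payoff_def max_def)
      show ?thesis unfolding payoff using True ay
        by (simp add: exp_of_real[symmetric] right_diff_distrib mult_exp_exp algebra_simps)
    next
      case False
      then have "0 \<le> y \<Longrightarrow> exchange_payoff \<beta> (b + y + z) (b + y) = 0"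
        using ay z by (auto simp: exchange_payoff_def max_def)
      then show ?thesis using False by (auto simp: indicator_def)
    qed
  qed
  note i1 = integral_exp_atLeast[OF r1, of a] and i2 = integral_exp_atLeast[OF r2, of a]
  show "integrable lborel (\<lambda>y. indicator {0..} y *\<^sub>R (exp (- (p * complex_of_real y)) * exchange_payoff \<beta> (b + y + z) (b + y)))"
    unfolding eq by (intro Bochner_Integration.integrable_diff integrable_mult_right i1 i2)
  have I: "(LINT y|lborel. indicator {0..} y *\<^sub>R (exp (- (p * complex_of_real y)) * exchange_payoff \<beta> (b + y + z) (b + y)))
    = exp (\<beta> * (b + z)) * (exp (- ((p - \<beta>) * a)) / (p - \<beta>)) - exp b * (exp (- ((p - 1) * a)) / (p - 1))"
    unfolding eq Bochner_Integration.integral_diff[OF integrable_mult_right[OF i1(1)] integrable_mult_right[OF i2(1)]]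
      integral_mult_right_zero i1(2) i2(2) ..
  have n1: "norm (exp (- ((p - \<beta>) * a))) \<le> 1" and n2: "norm (exp (- ((p - 1) * a))) \<le> 1"
    using a0 r1 r2 by (auto simp: norm_exp)
  have e1: "norm (complex_of_real (exp (\<beta> * (b + z)))) \<le> exp (\<beta> * b)" and e2: "norm (complex_of_real (exp b)) \<le> exp (\<beta> * b)"
    using z beta b by (auto simp: mult_le_cancel_right1 mult_left_mono)
  have "norm (complex_of_real (exp (\<beta> * (b + z))) * (exp (- ((p - \<beta>) * a)) / (p - \<beta>))) \<le> exp (\<beta> * b) * (1 / norm (p - \<beta>))"
    unfolding norm_mult norm_divide using e1 n1 by (intro mult_mono divide_right_mono) auto
  moreover have "norm (complex_of_real (exp b) * (exp (- ((p - 1) * a)) / (p - 1))) \<le> exp (\<beta> * b) * (1 / norm (p - 1))"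
    unfolding norm_mult norm_divide using e2 n2 by (intro mult_mono divide_right_mono) auto
  ultimately show "norm (LINT y|lborel. indicator {0..} y *\<^sub>R (exp (- (p * complex_of_real y)) * exchange_payoff \<beta> (b + y + z) (b + y)))
     \<le> exp (\<beta> * b) * (1 / norm (p - \<beta>) + 1 / norm (p - 1))"
    unfolding I distrib_left by (intro order_trans[OF norm_triangle_ineq4]) linarith
  assume "z = 0"
  then have "a = 0" using b unfolding a_def by simp
  with \<open>z = 0\<close> show "(LINT y|lborel. indicator {0..} y *\<^sub>R (exp (- (p * complex_of_real y)) * exchange_payoff \<beta> (b + y + z) (b + y)))
      = exp (\<beta> * b) / (p - \<beta>) - exp b / (p - 1)"
    unfolding I by (simp add: exp_of_real[symmetric])
qed

text \<open>Here the payoff is supported on a bounded interval of excesses that shrinks to a point at \<open>z = 0\<close>.\<close>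

lemma fixed_barrier_transform:
  assumes z: "z \<le> 0"
  shows "norm (LINT y|lborel. indicator {0..} y *\<^sub>R (exp (- (p * complex_of_real y)) * exchange_payoff \<beta> (b + y + z) b))
     \<le> exp (\<beta> * b) * (2 / norm (p - \<beta>) + 2 / norm p)"
    and "integrable lborel (\<lambda>y. indicator {0..} y *\<^sub>R (exp (- (p * complex_of_real y)) * exchange_payoff \<beta> (b + y + z) b))"
    and "z = 0 \<Longrightarrow> (LINT y|lborel. indicator {0..} y *\<^sub>R (exp (- (p * complex_of_real y)) * exchange_payoff \<beta> (b + y + z) b)) = 0"
proof -
  define a where "a = max 0 (b / \<beta> - b - z)"
  have a0: "0 \<le> a" unfolding a_def by simp
  have bb: "b / \<beta> \<le> b" using beta b by (simp add: divide_le_eq mult_le_cancel_left1)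
  have az: "a \<le> - z" unfolding a_def using z bb by simp
  have r1: "Re (p - \<beta>) > 0" and r2: "Re p > 0" using p beta by auto
  then have p0: "p - \<beta> \<noteq> 0" "p \<noteq> 0" by auto
  have eq: "indicator {0..} y *\<^sub>R (exp (- (p * complex_of_real y)) * exchange_payoff \<beta> (b + y + z) b) =
     exp (\<beta> * (b + z)) * (indicator {a..-z} y *\<^sub>R exp (- ((p - \<beta>) * complex_of_real y)))
     - exp b * (indicator {a..-z} y *\<^sub>R exp (- (p * complex_of_real y)))" for y
  proof (cases "y \<in> {a..-z}")
    case True
    then have "b + y + z \<in> {b / \<beta>..b}" "0 \<le> y" unfolding a_def by auto
    then show ?thesis using True unfolding payoff_eq[OF beta b]
      by (simp add: exp_of_real[symmetric] right_diff_distrib mult_exp_exp algebra_simps)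
  next
    case False
    then have "\<not> (b + y + z \<in> {b / \<beta>..b} \<and> 0 \<le> y)" unfolding a_def by auto
    then show ?thesis using False unfolding payoff_eq[OF beta b] by (auto simp: indicator_def)
  qed
  have i: "integrable lborel (\<lambda>x. indicator {a..-z} x *\<^sub>R exp (- (c * complex_of_real x)))" for c :: complex
    by (intro borel_integrable_compact continuous_intros) auto
  show "integrable lborel (\<lambda>y. indicator {0..} y *\<^sub>R (exp (- (p * complex_of_real y)) * exchange_payoff \<beta> (b + y + z) b))"
    unfolding eq by (intro Bochner_Integration.integrable_diff integrable_mult_right i)
  have I: "(LINT y|lborel. indicator {0..} y *\<^sub>R (exp (- (p * complex_of_real y)) * exchange_payoff \<beta> (b + y + z) b))
    = exp (\<beta> * (b + z)) * ((exp (- ((p - \<beta>) * a)) - exp (- ((p - \<beta>) * complex_of_real (- z)))) / (p - \<beta>))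
      - exp b * ((exp (- (p * a)) - exp (- (p * complex_of_real (- z)))) / p)"
    unfolding eq Bochner_Integration.integral_diff[OF integrable_mult_right[OF i] integrable_mult_right[OF i]]
      integral_mult_right_zero integral_exp_Icc[OF p0(1) az] integral_exp_Icc[OF p0(2) az] ..
  have n: "norm (exp (- (c * a)) - exp (- (c * complex_of_real (- z)))) \<le> 2" if "Re c > 0" for c
  proof -
    have "norm (exp (- (c * a))) \<le> 1" "norm (exp (- (c * complex_of_real (- z)))) \<le> 1"
      using that a0 z by (auto simp: norm_exp mult_nonneg_nonpos)
    then show ?thesis by (intro order_trans[OF norm_triangle_ineq4]) linarith
  qed
  have e1: "norm (complex_of_real (exp (\<beta> * (b + z)))) \<le> exp (\<beta> * b)" and e2: "norm (complex_of_real (exp b)) \<le> exp (\<beta> * b)"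
    using z beta b by (auto simp: mult_le_cancel_right1 mult_left_mono)
  have "norm (complex_of_real (exp (\<beta> * (b + z))) * ((exp (- ((p - \<beta>) * a)) - exp (- ((p - \<beta>) * complex_of_real (- z)))) / (p - \<beta>))) \<le> exp (\<beta> * b) * (2 / norm (p - \<beta>))"
    unfolding norm_mult[of "complex_of_real (exp (\<beta> * (b + z)))"] norm_divide using e1 n[OF r1] by (intro mult_mono divide_right_mono) auto
  moreover have "norm (complex_of_real (exp b) * ((exp (- (p * a)) - exp (- (p * complex_of_real (- z)))) / p)) \<le> exp (\<beta> * b) * (2 / norm p)"
    unfolding norm_mult[of "complex_of_real (exp b)"] norm_divide using e2 n[OF r2] by (intro mult_mono divide_right_mono) auto
  ultimately show "norm (LINT y|lborel. indicator {0..} y *\<^sub>R (exp (- (p * complex_of_real y)) * exchange_payoff \<beta> (b + y + z) b))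
     \<le> exp (\<beta> * b) * (2 / norm (p - \<beta>) + 2 / norm p)"
    unfolding I distrib_left by (intro order_trans[OF norm_triangle_ineq4]) linarith
  assume "z = 0"
  then have "a = 0" using bb unfolding a_def by simp
  with \<open>z = 0\<close> show "(LINT y|lborel. indicator {0..} y *\<^sub>R (exp (- (p * complex_of_real y)) * exchange_payoff \<beta> (b + y + z) b)) = 0"
    unfolding I by simp
qed

lemma gain_transform_eq:
  assumes "z \<le> 0"
  shows "gain_transform \<beta> b p z =
    (LINT y|lborel. indicator {0..} y *\<^sub>R (exp (- (p * complex_of_real y)) * exchange_payoff \<beta> (b + y + z) (b + y))) -
    (LINT y|lborel. indicator {0..} y *\<^sub>R (exp (- (p * complex_of_real y)) * exchange_payoff \<beta> (b + y + z) b))"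
  unfolding gain_transform_def lookback_gain_def
    Bochner_Integration.integral_diff[OF moving_barrier_transform(2)[OF assms] fixed_barrier_transform(2)[OF assms], symmetric]
  by (intro Bochner_Integration.integral_cong) (auto simp: algebra_simps)

lemma gain_transform_0: "gain_transform \<beta> b p 0 = exp (\<beta> * b) / (p - \<beta>) - exp b / (p - 1)"
  unfolding gain_transform_eq[OF order_refl] moving_barrier_transform(3)[OF order_refl refl] fixed_barrier_transform(3)[OF order_refl refl] by simp

lemma gain_transform_bound:
  "norm (gain_transform \<beta> b p z) \<le> 6 * exp (\<beta> * b) * (1 + 1 / (Re p - \<beta>)) / (1 + \<bar>Im p\<bar>)"
proof (cases "z \<le> 0")
  case True
  define m where "m = (1 + 1 / (Re p - \<beta>)) / (1 + \<bar>Im p\<bar>)"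
  have m: "1 / norm (p - complex_of_real c) \<le> m" if "0 \<le> c" "c \<le> \<beta>" for c
  proof -
    have "1 / norm (p - complex_of_real c) \<le> (1 + 1 / (Re p - \<beta>)) / (1 + \<bar>Im (p - complex_of_real c)\<bar>)"
      by (rule inverse_norm_bound) (use that p in auto)
    then show ?thesis unfolding m_def by simp
  qed
  have m3: "1 / norm (p - \<beta>) \<le> m" "1 / norm (p - 1) \<le> m" "1 / norm p \<le> m"
    using m[of \<beta>] m[of 1] m[of 0] beta by auto
  have "norm (gain_transform \<beta> b p z) \<le> exp (\<beta> * b) * (1 / norm (p - \<beta>) + 1 / norm (p - 1)) + exp (\<beta> * b) * (2 / norm (p - \<beta>) + 2 / norm p)"
    unfolding gain_transform_eq[OF True]
    by (rule order_trans[OF norm_triangle_ineq4 add_mono[OF moving_barrier_transform(1)[OF True] fixed_barrier_transform(1)[OF True]]])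
  also have "\<dots> = exp (\<beta> * b) * (3 * (1 / norm (p - \<beta>)) + 1 / norm (p - 1) + 2 * (1 / norm p))"
    by (simp add: algebra_simps)
  also have "\<dots> \<le> exp (\<beta> * b) * (6 * m)" using m3 by (intro mult_left_mono) auto
  also have "\<dots> = 6 * exp (\<beta> * b) * (1 + 1 / (Re p - \<beta>)) / (1 + \<bar>Im p\<bar>)"
    unfolding m_def by (simp only: times_divide_eq_right mult_ac)
  finally show ?thesis .
next
  case False
  then show ?thesis using gain_transform_pos p by simp
qed

end

section \<open>Fourier transform of the gain\<close>

lemma integrable_exp_atMost:
  fixes k :: real
  assumes k: "k > 0"
  shows "integrable lborel (\<lambda>x. indicator {..0} x * exp (k * x))"
proof -
  have "(\<lambda>x. indicator {0..} (0 + (-1) * x) * exp (- k * (0 + (-1) * x))) = (\<lambda>x. indicator {..0} x * exp (k * x))"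
    by (auto simp: fun_eq_iff indicator_def)
  then show ?thesis
    using integrable_exp_atLeast[OF k, of 0]
      lborel_integrable_real_affine_iff[of "-1" "\<lambda>x. indicator {0..} x * exp (- k * x)" 0] by simp
qed

text \<open>The transform of the payoff with barrier \<open>y\<close> at \<open>s = \<i> * \<xi>\<close>, multiplied by \<open>exp (s * y)\<close>. At \<open>y = x2\<close> it is the
  bracket in \<open>I1\<close>.\<close>

definition recentred_transform :: "real \<Rightarrow> complex \<Rightarrow> real \<Rightarrow> complex" where
  "recentred_transform \<beta> s y = exp (y * \<beta>) / (\<beta> - s)
     + \<beta> * (exp (y * (1 + s * (1 - 1 / \<beta>))) / ((\<beta> - s) * (- s))) - exp y / (- s)"

lemma shifted_payoff_transform:
  assumes b: "1 < \<beta>" and y: "0 \<le> y" and s: "Re s < 0"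
  shows "integrable lborel (\<lambda>z. exp (- (s * complex_of_real z)) * exchange_payoff \<beta> (t + z) y)"
    and "(LINT z|lborel. exp (- (s * complex_of_real z)) * exchange_payoff \<beta> (t + z) y)
      = exp (s * complex_of_real (t - y)) * recentred_transform \<beta> s y"
proof -
  let ?h = "\<lambda>x. exp (- (s * complex_of_real x)) * exchange_payoff \<beta> x y"
  have eq: "exp (- (s * complex_of_real z)) * exchange_payoff \<beta> (t + z) y = exp (s * t) * ?h (t + 1 * z)" for z
    by (simp add: mult_exp_exp algebra_simps)
  have "integrable lborel (\<lambda>z. ?h (t + 1 * z))"
    using payoff_transform(1)[OF b y s] by (subst lborel_integrable_real_affine_iff) auto
  then show "integrable lborel (\<lambda>z. exp (- (s * complex_of_real z)) * exchange_payoff \<beta> (t + z) y)"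
    unfolding eq by (rule integrable_mult_right)
  have "(LINT z|lborel. exp (- (s * complex_of_real z)) * exchange_payoff \<beta> (t + z) y) = exp (s * t) * (LINT z|lborel. ?h (t + 1 * z))"
    unfolding eq by simp
  also have "(LINT z|lborel. ?h (t + 1 * z)) = (LINT x|lborel. ?h x)"
    using lborel_integral_real_affine[of 1 ?h t] by simp
  also have "exp (s * t) * (LINT x|lborel. ?h x) = exp (s * complex_of_real (t - y)) * (exp (s * y) * (LINT x|lborel. ?h x))"
    by (simp add: mult_exp_exp mult.assoc[symmetric] algebra_simps)
  also have "exp (s * y) * (LINT x|lborel. ?h x) = recentred_transform \<beta> s y"
  proof -
    have e1: "exp (s * y) * exp ((\<beta> - s) * y) = exp (complex_of_real y * complex_of_real \<beta>)"
      and e2: "exp (s * y) * exp ((1 - s) * y) = exp (complex_of_real y)"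
      by (simp_all add: mult_exp_exp algebra_simps)
    have e3: "exp (s * y) * exp ((1 - s / \<beta>) * y) = exp (y * (1 + s * (1 - 1 / \<beta>)))"
      using b by (simp add: mult_exp_exp field_simps)
    have alg: "E * (A / u + k * (C / v) - D / w) = E * A / u + k * (E * C / v) - E * D / w" for E A C D k u v w :: complex
      by (simp add: ring_distribs mult.left_commute)
    show ?thesis
      unfolding payoff_transform(2)[OF b y s] recentred_transform_def alg e1 e2 e3 by simp
  qed
  finally show "(LINT z|lborel. exp (- (s * complex_of_real z)) * exchange_payoff \<beta> (t + z) y)
      = exp (s * complex_of_real (t - y)) * recentred_transform \<beta> s y" .
qed

context
  fixes \<beta> b :: real and p s :: complex
  assumes beta: "1 < \<beta>" and b: "0 \<le> b" and p: "\<beta> < Re p" and s: "Re s < 0"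
begin

lemma integrable_gain_double:
  "integrable (lborel \<Otimes>\<^sub>M lborel) (\<lambda>(z, y). exp (- (s * complex_of_real z)) *
      (indicator {0..} y *\<^sub>R (exp (- (p * complex_of_real y)) * lookback_gain \<beta> b y z)))"
proof (rule Bochner_Integration.integrable_bound)
  let ?m = "\<lambda>y. indicator {0..} y * (exp (- Re p * y) * exp (\<beta> * (b + y)))"
  let ?n = "\<lambda>z. indicator {..0} z * exp (- Re s * z)"
  show "integrable (lborel \<Otimes>\<^sub>M lborel) (\<lambda>q. complex_of_real (?n (fst q)) * complex_of_real (?m (snd q)))"
    by (rule integrable_mult_pair)
      (use integrable_gain_majorant[OF beta b p] integrable_exp_atMost[of "- Re s"] s lborel_pair.pair_sigma_finite_axioms in
        \<open>auto simp del: of_real_mult intro!: integrable_of_real\<close>)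
  show "AE q in lborel \<Otimes>\<^sub>M lborel. norm (case q of (z, y) \<Rightarrow> exp (- (s * complex_of_real z)) *
      (indicator {0..} y *\<^sub>R (exp (- (p * complex_of_real y)) * lookback_gain \<beta> b y z)))
      \<le> norm (complex_of_real (?n (fst q)) * complex_of_real (?m (snd q)))"
  proof (rule AE_I2, clarify)
    fix z y :: real
    show "norm (exp (- (s * complex_of_real z)) * (indicator {0..} y *\<^sub>R (exp (- (p * complex_of_real y)) * lookback_gain \<beta> b y z)))
      \<le> norm (complex_of_real (?n (fst (z, y))) * complex_of_real (?m (snd (z, y))))"
    proof (cases "z \<le> 0 \<or> y < 0")
      case True
      have "norm (exp (- (s * complex_of_real z)) * (indicator {0..} y *\<^sub>R (exp (- (p * complex_of_real y)) * lookback_gain \<beta> b y z)))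
         \<le> exp (- Re s * z) * ?m y"
        unfolding norm_mult[of "exp (- (s * complex_of_real z))"]
        by (rule mult_mono) (use gain_integrand_bound[OF beta b p] in \<open>auto simp: norm_exp\<close>)
      then show ?thesis using True by (auto simp: norm_mult abs_mult indicator_def)
    next
      case False
      then show ?thesis using lookback_gain_pos[of y z \<beta> b] by simp
    qed
  qed
qed measurable

text \<open>Interchange the integrals. For a fixed excess the transform in \<open>z\<close> is a difference of two recentred payoff transforms, a
  sum of exponentials in \<open>y\<close>. Each exponential pairs with the exponential \<open>exp (s * y)\<close> of the fixed barrier, and
  \<open>1 / x - 1 / (p - s) = (p - s - x) / (x * (p - s))\<close> produces the common factor \<open>1 / (p - s)\<close>.\<close>

lemma gain_transform_fourier:
  "(LINT z|lborel. exp (- (s * complex_of_real z)) * gain_transform \<beta> b p z) =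
    1 / (p - s) * (exp (\<beta> * b) / (p - \<beta>)
        + \<beta> * exp ((1 + s * (1 - 1 / \<beta>)) * b) * (1 - s / \<beta>) / ((\<beta> - s) * (- s) * (p - 1 - s * (1 - 1 / \<beta>)))
        - exp b * (1 - s) / ((- s) * (p - 1)))"
proof -
  let ?d = "1 - 1 / \<beta>"
  have d: "0 < ?d" "?d < 1" using beta by auto
  define A1 A2 A3 :: complex where "A1 = exp (\<beta> * b) / (\<beta> - s)" and "A2 = \<beta> * (exp ((1 + s * ?d) * b) / ((\<beta> - s) * (- s)))" and "A3 = exp b / (- s)"
  have Y: "recentred_transform \<beta> s (b + y) = A1 * exp (\<beta> * y) + A2 * exp ((1 + s * ?d) * y) - A3 * exp y" for y
    unfolding recentred_transform_def A1_def A2_def A3_def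
    by (simp add: exp_of_real[symmetric] mult_exp_exp algebra_simps)
  have r: "Re (p - \<beta>) > 0" "Re (p - 1 - s * ?d) > 0" "Re (p - 1) > 0" "Re (p - s) > 0"
  proof -
    have "Re s * ?d < 0" using s d by (intro mult_neg_pos)
    then show "Re (p - 1 - s * ?d) > 0" using p beta by (simp add: algebra_simps)
  qed (use p s beta in auto)
  have inner: "(LINT z|lborel. exp (- (s * complex_of_real z)) * lookback_gain \<beta> b y z)
      = recentred_transform \<beta> s (b + y) - exp (s * y) * recentred_transform \<beta> s b" if y: "0 \<le> y" for y
  proof -
    have bY: "0 \<le> b + y" using b y by simp
    have "(LINT z|lborel. exp (- (s * complex_of_real z)) * lookback_gain \<beta> b y z) =
      (LINT z|lborel. exp (- (s * complex_of_real z)) * exchange_payoff \<beta> ((b + y) + z) (b + y)) -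
      (LINT z|lborel. exp (- (s * complex_of_real z)) * exchange_payoff \<beta> ((b + y) + z) b)"
      unfolding lookback_gain_def
      by (subst Bochner_Integration.integral_diff[symmetric])
        (use shifted_payoff_transform(1)[OF beta bY s, of "b + y"] shifted_payoff_transform(1)[OF beta b s, of "b + y"] in \<open>auto simp: algebra_simps\<close>)
    then show ?thesis
      unfolding shifted_payoff_transform(2)[OF beta bY s] shifted_payoff_transform(2)[OF beta b s] by simp
  qed
  have eq: "(LINT z|lborel. exp (- (s * complex_of_real z)) * (indicator {0..} y *\<^sub>R (exp (- (p * complex_of_real y)) * lookback_gain \<beta> b y z)))
      = A1 * (indicator {0..} y *\<^sub>R exp (- ((p - \<beta>) * complex_of_real y)))
      + A2 * (indicator {0..} y *\<^sub>R exp (- ((p - 1 - s * ?d) * complex_of_real y)))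
      - A3 * (indicator {0..} y *\<^sub>R exp (- ((p - 1) * complex_of_real y)))
      - recentred_transform \<beta> s b * (indicator {0..} y *\<^sub>R exp (- ((p - s) * complex_of_real y)))" for y
  proof (cases "0 \<le> y")
    case True
    have "(LINT z|lborel. exp (- (s * complex_of_real z)) * (indicator {0..} y *\<^sub>R (exp (- (p * complex_of_real y)) * lookback_gain \<beta> b y z)))
       = exp (- (p * complex_of_real y)) * (LINT z|lborel. exp (- (s * complex_of_real z)) * lookback_gain \<beta> b y z)"
      using True by (subst integral_mult_right_zero[symmetric]) (simp add: mult_ac)
    also have "\<dots> = exp (- (p * complex_of_real y)) * (A1 * exp (\<beta> * y) + A2 * exp ((1 + s * ?d) * y) - A3 * exp y - exp (s * y) * recentred_transform \<beta> s b)"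
      unfolding inner[OF True] unfolding Y ..
    finally show ?thesis using True
      by (simp add: exp_of_real[symmetric] mult_exp_exp algebra_simps)
  qed simp
  have "(LINT z|lborel. exp (- (s * complex_of_real z)) * gain_transform \<beta> b p z) =
     (LINT z|lborel. LINT y|lborel. exp (- (s * complex_of_real z)) * (indicator {0..} y *\<^sub>R (exp (- (p * complex_of_real y)) * lookback_gain \<beta> b y z)))"
    unfolding gain_transform_def by (simp only: integral_mult_right_zero)
  also have "\<dots> = (LINT y|lborel. LINT z|lborel. exp (- (s * complex_of_real z)) * (indicator {0..} y *\<^sub>R (exp (- (p * complex_of_real y)) * lookback_gain \<beta> b y z)))"
    by (rule lborel_pair.Fubini_integral[OF integrable_gain_double, symmetric])
  also have "\<dots> = A1 / (p - \<beta>) + A2 / (p - 1 - s * ?d) - A3 / (p - 1) - recentred_transform \<beta> s b / (p - s)"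
  proof -
    note i = integral_exp_atLeast[OF r(1), of 0] integral_exp_atLeast[OF r(2), of 0] integral_exp_atLeast[OF r(3), of 0] integral_exp_atLeast[OF r(4), of 0]
    note j = i(1)[THEN integrable_mult_right, of A1] i(3)[THEN integrable_mult_right, of A2] i(5)[THEN integrable_mult_right, of A3]
       i(7)[THEN integrable_mult_right, of "recentred_transform \<beta> s b"]
    show ?thesis
      unfolding eq
        Bochner_Integration.integral_diff[OF Bochner_Integration.integrable_diff[OF Bochner_Integration.integrable_add[OF j(1) j(2)] j(3)] j(4)]
        Bochner_Integration.integral_diff[OF Bochner_Integration.integrable_add[OF j(1) j(2)] j(3)]
        Bochner_Integration.integral_add[OF j(1) j(2)]
        integral_mult_right_zero i(2) i(4) i(6) i(8) by simp
  qed
  also have "recentred_transform \<beta> s b = A1 + A2 - A3" using Y[of 0] by simp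
  also have "A1 / (p - \<beta>) + A2 / (p - 1 - s * ?d) - A3 / (p - 1) - (A1 + A2 - A3) / (p - s)
      = 1 / (p - s) * (A1 * (\<beta> - s) / (p - \<beta>) + A2 * (1 - s / \<beta>) / (p - 1 - s * ?d) - A3 * (1 - s) / (p - 1))"
  proof -
    have frac0: "a / x - a / q = 1 / q * (a * (q - x) / x)" if "x \<noteq> 0" "q \<noteq> 0" for a x q :: complex
      using that by (simp add: field_simps)
    have "p - s \<noteq> 0" using r(4) by auto
    note frac = frac0[OF _ this]
    have nz: "p - \<beta> \<noteq> 0" "p - 1 - s * ?d \<noteq> 0" "p - 1 \<noteq> 0" using r by (metis less_irrefl zero_complex.sel(1))+
    have "A1 / (p - \<beta>) + A2 / (p - 1 - s * ?d) - A3 / (p - 1) - (A1 + A2 - A3) / (p - s)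
      = (A1 / (p - \<beta>) - A1 / (p - s)) + (A2 / (p - 1 - s * ?d) - A2 / (p - s)) - (A3 / (p - 1) - A3 / (p - s))"
      by (simp add: add_divide_distrib diff_divide_distrib)
    also have "\<dots> = 1 / (p - s) * (A1 * (\<beta> - s) / (p - \<beta>)) + 1 / (p - s) * (A2 * (1 - s / \<beta>) / (p - 1 - s * ?d)) - 1 / (p - s) * (A3 * (1 - s) / (p - 1))"
      unfolding frac[OF nz(1)] frac[OF nz(2)] frac[OF nz(3)] by (simp add: algebra_simps)
    finally show ?thesis by (simp only: distrib_left right_diff_distrib)
  qed
  also have "A1 * (\<beta> - s) = exp (\<beta> * b)" unfolding A1_def using s beta by (auto simp: complex_eq_iff)
  finally show ?thesis unfolding A2_def A3_def by simp
qed

lemma gain_transform_fourier_bound: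
  assumes w: "Re s = - w"
  shows "norm (1 / (p - s) * (exp (\<beta> * b) / (p - \<beta>)
        + \<beta> * exp ((1 + s * (1 - 1 / \<beta>)) * b) * (1 - s / \<beta>) / ((\<beta> - s) * (- s) * (p - 1 - s * (1 - 1 / \<beta>)))
        - exp b * (1 - s) / ((- s) * (p - 1))))
     \<le> (1 + 1 / (Re p + w)) * (1 + \<bar>Im p\<bar>) * (exp (\<beta> * b) / norm (p - \<beta>) + exp b / (w * (Re p - 1)) + exp b * (1 / w + 1) / norm (p - 1)) / (1 + \<bar>Im s\<bar>)"
proof -
  let ?d = "1 - 1 / \<beta>"
  have w0: "0 < w" using s w by simp
  have d: "0 < ?d" "?d < 1" using beta by auto
  have s0: "s \<noteq> 0" "\<beta> - s \<noteq> 0" using s beta by (auto simp: complex_eq_iff)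
  have sw: "w \<le> norm s" using complex_Re_le_cmod[of "- s"] w by simp
  have "1 / norm (p - s) \<le> (1 + 1 / (Re p + w)) / (1 + \<bar>Im (p - s)\<bar>)"
    by (rule inverse_norm_bound) (use w w0 p beta in auto)
  also have "\<dots> \<le> (1 + 1 / (Re p + w)) * ((1 + \<bar>Im p\<bar>) / (1 + \<bar>Im s\<bar>))"
  proof -
    have "1 + \<bar>Im s\<bar> \<le> (1 + \<bar>Im p\<bar>) + \<bar>Im (p - s)\<bar>" by simp
    also have "\<dots> \<le> (1 + \<bar>Im p\<bar>) * (1 + \<bar>Im (p - s)\<bar>)" by (simp add: algebra_simps)
    finally have "1 / (1 + \<bar>Im (p - s)\<bar>) \<le> (1 + \<bar>Im p\<bar>) / (1 + \<bar>Im s\<bar>)"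
      by (simp add: field_simps)
    then show ?thesis using w0 p beta
      by (subst divide_inverse) (intro mult_left_mono, auto simp: inverse_eq_divide)
  qed
  finally have 1: "norm (1 / (p - s)) \<le> (1 + 1 / (Re p + w)) * ((1 + \<bar>Im p\<bar>) / (1 + \<bar>Im s\<bar>))" by (simp add: norm_divide)
  have n2: "norm (\<beta> * exp ((1 + s * ?d) * b) * (1 - s / \<beta>) / ((\<beta> - s) * (- s) * (p - 1 - s * ?d))) \<le> exp b / (w * (Re p - 1))"
  proof -
    have "\<beta> * (1 - s / \<beta>) = \<beta> - s" using beta by (simp add: field_simps)
    then have "\<beta> * exp ((1 + s * ?d) * b) * (1 - s / \<beta>) / ((\<beta> - s) * (- s) * (p - 1 - s * ?d)) = exp ((1 + s * ?d) * b) / ((- s) * (p - 1 - s * ?d))"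
      using s0(2)
    proof -
      assume B: "\<beta> * (1 - s / \<beta>) = \<beta> - s" and D: "\<beta> - s \<noteq> 0"
      have "k * x * t / (D * e * f) = x / (e * f)" if "k * t = D" "D \<noteq> 0" for k x t D e f :: complex
        using that by (auto simp: mult.assoc mult.left_commute[of k])
      from this[OF B D] show ?thesis .
    qed
    moreover have "norm (exp ((1 + s * ?d) * b)) \<le> exp b"
    proof -
      have "Re s * ?d * b \<le> 0" using s d b by (intro mult_nonpos_nonneg) auto
      then show ?thesis by (simp add: norm_exp algebra_simps)
    qed
    moreover have "Re p - 1 \<le> norm (p - 1 - s * ?d)"
    proof -
      have "Re s * ?d \<le> 0" using s d by (intro mult_nonpos_nonneg) auto
      then show ?thesis using complex_Re_le_cmod[of "p - 1 - s * ?d"] by (simp add: algebra_simps)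
    qed
    ultimately show ?thesis
      using sw w0 p beta by (simp only: norm_divide norm_mult norm_minus_cancel) (intro frac_le mult_mono, auto)
  qed
  have n3: "norm (exp b * (1 - s) / ((- s) * (p - 1))) \<le> exp b * (1 / w + 1) / norm (p - 1)"
  proof -
    have "norm (1 - s) \<le> 1 + norm s" using norm_triangle_ineq4[of 1 s] by simp
    then have "norm (1 - s) / norm s \<le> 1 / norm s + 1" using s0 by (simp add: field_simps)
    also have "\<dots> \<le> 1 / w + 1" using sw w0 by (simp add: frac_le)
    finally have "exp b * (norm (1 - s) / norm s) / norm (p - 1) \<le> exp b * (1 / w + 1) / norm (p - 1)"
      by (intro divide_right_mono mult_left_mono) auto
    then show ?thesis by (simp add: norm_divide norm_mult)
  qed
  have "norm (exp (\<beta> * b) / (p - \<beta>)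
        + \<beta> * exp ((1 + s * ?d) * b) * (1 - s / \<beta>) / ((\<beta> - s) * (- s) * (p - 1 - s * ?d))
        - exp b * (1 - s) / ((- s) * (p - 1)))
     \<le> exp (\<beta> * b) / norm (p - \<beta>) + exp b / (w * (Re p - 1)) + exp b * (1 / w + 1) / norm (p - 1)"
    by (rule order_trans[OF norm_triangle_ineq4 add_mono[OF order_trans[OF norm_triangle_ineq add_mono[OF _ n2]] n3]])
      (simp add: norm_divide exp_of_real[symmetric] del: of_real_mult)
  from mult_mono[OF 1 this] show ?thesis
    using w0 p beta by (subst norm_mult) (simp add: mult_ac)
qed

end

section \<open>Line integrals of simple poles\<close>

lemma integrable_x_exp:
  fixes k :: real
  assumes k: "k > 0"
  shows "integrable lborel (\<lambda>x. indicator {0..} x * (x * exp (- k * x)))"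
proof (rule Bochner_Integration.integrable_bound)
  show "integrable lborel (\<lambda>x. 2 / k * (indicator {0..} x * exp (- (k / 2) * x)))"
    by (intro integrable_mult_right integrable_exp_atLeast) (use k in simp)
  have "x * exp (- k * x) \<le> 2 / k * exp (- (k / 2) * x)" if "0 \<le> x" for x
  proof -
    have "k * x / 2 \<le> exp (k * x / 2)" using exp_ge_add_one_self[of "k * x / 2"] by linarith
    then have "x \<le> 2 / k * exp (k / 2 * x)" using k by (simp add: field_simps)
    then have "x * exp (- k * x) \<le> 2 / k * exp (k / 2 * x) * exp (- k * x)" by (intro mult_right_mono) auto
    also have "\<dots> = 2 / k * exp (- (k / 2) * x)" by (simp add: mult.assoc mult_exp_exp)
    finally show ?thesis .
  qed
  then show "AE x in lborel. norm (indicator {0..} x * (x * exp (- k * x))) \<le> norm (2 / k * (indicator {0..} x * exp (- (k / 2) * x)))"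
    using k by (intro AE_I2) (auto simp: indicator_def)
qed measurable

lemma integral_x_exp:
  fixes c :: complex
  assumes c: "Re c > 0"
  shows "(LINT x|lborel. indicator {0..} x *\<^sub>R (complex_of_real x * exp (- (c * complex_of_real x)))) = 1 / c\<^sup>2"
proof -
  have c0: "c \<noteq> 0" using c by auto
  let ?f = "\<lambda>x. complex_of_real x * exp (- (c * complex_of_real x))"
  let ?F = "\<lambda>x. - (complex_of_real x / c + 1 / c\<^sup>2) * exp (- (c * complex_of_real x))"
  have i: "set_integrable lborel {0..} ?f"
    unfolding set_integrable_def
    by (rule Bochner_Integration.integrable_bound[OF integrable_x_exp[OF c]])
      (auto simp: norm_mult norm_exp indicator_def intro!: AE_I2)
  have "((\<lambda>b. set_lebesgue_integral lborel {0..b} ?f) \<longlongrightarrow> set_lebesgue_integral lborel {0..} ?f) at_top"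
    by (rule tendsto_set_lebesgue_integral_at_top[OF _ i]) auto
  moreover have "((\<lambda>b. set_lebesgue_integral lborel {0..b} ?f) \<longlongrightarrow> 0 - (- (1 / c\<^sup>2))) at_top"
  proof (rule Lim_transform_eventually)
    have "((\<lambda>x. exp (- (Re c * x))) \<longlongrightarrow> 0) at_top" "((\<lambda>x. x * exp (- (Re c * x))) \<longlongrightarrow> 0) at_top"
      using c by real_asymp+
    then have "((\<lambda>x. norm (exp (- (c * complex_of_real x)))) \<longlongrightarrow> 0) at_top"
      "((\<lambda>x. norm (?f x)) \<longlongrightarrow> 0) at_top"
    proof -
      show "((\<lambda>x. norm (exp (- (c * complex_of_real x)))) \<longlongrightarrow> 0) at_top"
        using \<open>((\<lambda>x. exp (- (Re c * x))) \<longlongrightarrow> 0) at_top\<close> by (simp add: norm_exp)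
      show "((\<lambda>x. norm (?f x)) \<longlongrightarrow> 0) at_top"
      proof (rule Lim_transform_eventually[OF \<open>((\<lambda>x. x * exp (- (Re c * x))) \<longlongrightarrow> 0) at_top\<close>])
        show "\<forall>\<^sub>F x in at_top. x * exp (- (Re c * x)) = norm (?f x)"
          using eventually_ge_at_top[of 0] by eventually_elim (simp add: norm_mult norm_exp)
      qed
    qed
    then have l: "((\<lambda>x. exp (- (c * complex_of_real x))) \<longlongrightarrow> 0) at_top" "(?f \<longlongrightarrow> 0) at_top"
      by (auto intro: tendsto_norm_zero_cancel)
    have "((\<lambda>x. - (?f x / c) - 1 / c\<^sup>2 * exp (- (c * complex_of_real x))) \<longlongrightarrow> - (0 / c) - 1 / c\<^sup>2 * 0) at_top"
      by (intro tendsto_intros l c0)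
    moreover have "(\<lambda>x. - (?f x / c) - 1 / c\<^sup>2 * exp (- (c * complex_of_real x))) = ?F"
      by (auto simp: fun_eq_iff algebra_simps)
    ultimately have "(?F \<longlongrightarrow> 0) at_top" by simp
    then show "((\<lambda>b. ?F b - (- (1 / c\<^sup>2))) \<longlongrightarrow> 0 - (- (1 / c\<^sup>2))) at_top"
      by (intro tendsto_diff tendsto_const)
    show "\<forall>\<^sub>F b in at_top. ?F b - (- (1 / c\<^sup>2)) = set_lebesgue_integral lborel {0..b} ?f"
      using eventually_ge_at_top[of 0]
    proof eventually_elim
      case (elim b)
      have "(LINT x|lborel. indicator {0..b} x *\<^sub>R ?f x) = ?F b - ?F 0"
      proof (rule integral_FTC_Icc[OF elim])
        fix x
        have "((\<lambda>z. - (z / c + 1 / c\<^sup>2) * exp (- (c * z))) has_field_derivative ?f x) (at (complex_of_real x))"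
          using c0 by (auto intro!: derivative_eq_intros simp: field_simps power2_eq_square)
        then show "(?F has_vector_derivative ?f x) (at x within {0..b})"
          by (rule has_vector_derivative_real_field)
      qed (intro continuous_intros)
      then show ?case by (simp add: set_lebesgue_integral_def)
    qed
  qed
  ultimately have "set_lebesgue_integral lborel {0..} ?f = 0 - (- (1 / c\<^sup>2))"
    by (rule tendsto_unique[OF trivial_limit_at_top_linorder])
  then show ?thesis by (simp add: set_lebesgue_integral_def)
qed

lemma point_line_inversion:
  fixes g :: "real \<Rightarrow> complex"
  assumes g: "integrable lborel (\<lambda>y. complex_of_real (exp (w * y)) * g y)"
    and gb: "\<And>y. norm (complex_of_real (exp (w * y)) * g y) \<le> C"
    and cont: "isCont g d"
    and G: "\<And>u. G u = (LINT y|lborel. exp (- (\<i> * Complex u w * y)) * g y)"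
    and int: "integrable lborel G"
  shows "(LINT u|lborel. exp (\<i> * Complex u w * d) * G u) = 2 * pi * g d"
proof -
  let ?P = "return (count_space (UNIV :: unit set)) ()"
  interpret P: prob_space ?P by (rule prob_space_return) simp
  have [measurable]: "G \<in> borel_measurable borel" using int by auto
  have nrm: "norm (exp (\<i> * Complex u w * d)) = exp (- w * d)" for u by (simp add: norm_exp)
  have cm: "(\<lambda>u. exp (\<i> * Complex u w * d)) \<in> borel_measurable borel"
    unfolding Complex_eq by (intro borel_measurable_continuous_onI continuous_intros)
  have "(LINT u|lborel. exp (\<i> * Complex u w * d) * G u) = 2 * pi * (LINT \<omega>|?P. 1 * g d)"
  proof (rule line_inversion[OF _ _ _ g gb])
    show "sigma_finite_measure ?P" by unfold_locales
    show "AE \<omega> in ?P. (1::complex) \<noteq> 0 \<longrightarrow> isCont g d" using cont by simp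
    show "exp (\<i> * Complex u w * d) = (LINT \<omega>|?P. 1 * exp (\<i> * Complex u w * d))" for u
      using P.prob_space by simp
    show "integrable lborel (\<lambda>u. exp (\<i> * Complex u w * d) * G u)"
    proof (rule Bochner_Integration.integrable_bound)
      show "integrable lborel (\<lambda>u. exp (- w * d) *\<^sub>R G u)" using int by (rule integrable_scaleR_right)
      show "(\<lambda>u. exp (\<i> * Complex u w * d) * G u) \<in> borel_measurable lborel" using cm by measurable
    qed (auto simp: norm_mult norm_exp intro!: AE_I2)
  qed (auto simp: G)
  then show ?thesis using P.prob_space by simp
qed

text \<open>The integral converges only conditionally. Integration by parts trades the simple pole for a double one, whose integral is
  absolutely convergent and is the inversion of the continuous function \<open>- y * exp (k * y)\<close> on the negative half-line.\<close>

lemma truncated_pole_integral: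
  fixes k d :: real
  assumes k: "k > 0" and d: "d < 0"
  shows "((\<lambda>R. LINT u:{-R..R}|lborel. iexp (d * u) / (k - \<i> * u)) \<longlongrightarrow> 2 * pi * exp (k * d)) at_top"
proof -
  have kz: "complex_of_real k - \<i> * complex_of_real u \<noteq> 0" for u using k by (auto simp: complex_eq_iff)
  define G where "G u = 1 / (complex_of_real k - \<i> * complex_of_real u)\<^sup>2" for u
  define g where "g y = complex_of_real (indicator {0..} (- y) * (- y * exp (k * y)))" for y
  have Gm[measurable]: "G \<in> borel_measurable borel"
    unfolding G_def using kz by (intro borel_measurable_continuous_onI continuous_intros) auto
  have Gint: "integrable lborel G"
  proof (rule integrable_decay[of 1])
    fix u
    have b: "1 / norm (complex_of_real k - \<i> * complex_of_real u) \<le> (1 + 1 / k) / (1 + \<bar>u\<bar>)"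
      using inverse_norm_bound[of k "complex_of_real k - \<i> * complex_of_real u"] k by simp
    have "norm (G u) = (1 / norm (complex_of_real k - \<i> * complex_of_real u))\<^sup>2"
      by (simp add: G_def norm_divide norm_power power_divide)
    also have "\<dots> \<le> ((1 + 1 / k) / (1 + \<bar>u\<bar>))\<^sup>2" using b by (intro power_mono) auto
    also have "\<dots> = (1 + 1 / k)\<^sup>2 * (1 + \<bar>u\<bar>) powr (- 1) / (1 + \<bar>u\<bar>)"
      by (simp add: powr_minus power2_eq_square divide_inverse)
    finally show "norm (G u) \<le> (1 + 1 / k)\<^sup>2 * (1 + \<bar>u\<bar>) powr (- 1) / (1 + \<bar>u\<bar>)" .
  qed auto
  have refl: "g (0 + (-1) * x) = complex_of_real (indicator {0..} x * (x * exp (- k * x)))" for x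
    by (simp add: g_def)
  have "integrable lborel (\<lambda>x. complex_of_real (indicator {0..} x * (x * exp (- k * x))))"
    using integrable_x_exp[OF k] by (rule integrable_of_real)
  then have gint: "integrable lborel g"
    using lborel_integrable_real_affine_iff[of "-1" g 0] unfolding refl by simp
  have "(LINT u|lborel. exp (\<i> * Complex u 0 * d) * G u) = 2 * pi * g d"
  proof (rule point_line_inversion[where C="1 / k"])
    show "integrable lborel (\<lambda>y. complex_of_real (exp (0 * y)) * g y)" using gint by simp
    show "norm (complex_of_real (exp (0 * y)) * g y) \<le> 1 / k" for y
    proof (cases "y \<le> 0")
      case True
      have "k * - y \<le> exp (k * - y)" using exp_ge_add_one_self[of "k * - y"] by linarith
      then have "- y * exp (k * y) \<le> exp (k * - y) / k * exp (k * y)"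
        using k by (intro mult_right_mono) (auto simp: field_simps)
      also have "\<dots> = 1 / k" by (simp add: mult_exp_exp exp_minus)
      finally show ?thesis using True by (simp add: g_def norm_mult)
    qed (use k in \<open>simp add: g_def\<close>)
    have "\<forall>\<^sub>F y in nhds d. g y = complex_of_real (- y * exp (k * y))"
      using eventually_nhds_in_open[of "{..<0}" d] d by (auto elim!: eventually_mono simp: g_def)
    then show "isCont g d"
      by (subst isCont_cong) (auto intro!: continuous_intros)
    show "G u = (LINT y|lborel. exp (- (\<i> * Complex u 0 * y)) * g y)" for u
    proof -
      have "(LINT y|lborel. exp (- (\<i> * Complex u 0 * y)) * g y) = \<bar>-1\<bar> *\<^sub>R (LINT x|lborel. exp (- (\<i> * Complex u 0 * complex_of_real (0 + (-1) * x))) * g (0 + (-1) * x))"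
        by (rule lborel_integral_real_affine) simp
      also have "\<dots> = (LINT x|lborel. indicator {0..} x *\<^sub>R (complex_of_real x * exp (- ((complex_of_real k - \<i> * complex_of_real u) * complex_of_real x))))"
        unfolding refl by (simp, intro Bochner_Integration.integral_cong)
          (auto simp: indicator_def exp_of_real[symmetric] mult_exp_exp algebra_simps Complex_eq)
      also have "\<dots> = G u" unfolding G_def by (rule integral_x_exp) (use k in simp)
      finally show ?thesis ..
    qed
  qed (rule Gint)
  then have inv: "(LINT u|lborel. iexp (d * u) * G u) = 2 * pi * (- d * exp (k * d))"
    using d by (simp add: g_def Complex_eq mult_ac)
  have iG: "integrable lborel (\<lambda>u. iexp (d * u) * G u)"
    by (rule Bochner_Integration.integrable_bound[OF Gint]) (auto simp: norm_mult intro!: AE_I2)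
  define F where "F u = iexp (d * u) / (\<i> * d * (k - \<i> * u))" for u
  \<comment> \<open>The boundary terms \<open>F R\<close> and \<open>F (- R)\<close> are of order \<open>1 / R\<close>.\<close>
  have parts: "(LINT u:{-R..R}|lborel. iexp (d * u) / (k - \<i> * u)) = F R - F (- R) - (1 / d) * (LINT u:{-R..R}|lborel. iexp (d * u) * G u)"
    if R: "0 \<le> R" for R
  proof -
    have "(LINT u|lborel. indicator {-R..R} u *\<^sub>R (iexp (d * u) / (k - \<i> * u) + (1 / d) * (iexp (d * u) * G u))) = F R - F (- R)"
    proof (rule integral_FTC_Icc)
      fix u
      have "((\<lambda>z. exp (\<i> * (d * z)) / (\<i> * d * (k - \<i> * z))) has_field_derivative
          iexp (d * u) / (k - \<i> * u) + (1 / d) * (iexp (d * u) * G u)) (at (complex_of_real u))"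
      proof -
        define E D where "E = iexp (d * u)" and "D = complex_of_real k - \<i> * complex_of_real u"
        have f: "((\<lambda>z. exp (\<i> * (d * z))) has_field_derivative E * (\<i> * d)) (at (complex_of_real u))"
          unfolding E_def by (auto intro!: derivative_eq_intros)
        have g: "((\<lambda>z. \<i> * d * (k - \<i> * z)) has_field_derivative \<i> * d * (- \<i>)) (at (complex_of_real u))"
          by (auto intro!: derivative_eq_intros simp: complex_eq_iff)
        have alg: "(E * (\<i> * d) * (\<i> * d * D) - E * (\<i> * d * (- \<i>))) / (\<i> * d * D * (\<i> * d * D)) = E / D + (1 / d) * (E * (1 / D\<^sup>2))"
          using d kz[of u] unfolding D_def[symmetric] by (simp add: field_simps power2_eq_square)
        show ?thesis
          by (rule DERIV_cong[OF DERIV_divide[OF f g]])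
            (use d kz[of u] alg in \<open>simp_all add: E_def D_def G_def\<close>)
      qed
      from has_vector_derivative_real_field[OF this]
      show "(F has_vector_derivative (iexp (d * u) / (k - \<i> * u) + (1 / d) * (iexp (d * u) * G u))) (at u within {-R..R})"
        by (simp add: F_def[abs_def])
    next
      show "continuous_on {-R..R} (\<lambda>u. iexp (d * u) / (k - \<i> * u) + (1 / d) * (iexp (d * u) * G u))"
        unfolding G_def using kz by (intro continuous_intros) auto
    qed (use R in auto)
    moreover have "(LINT u|lborel. indicator {-R..R} u *\<^sub>R (iexp (d * u) / (k - \<i> * u) + (1 / d) * (iexp (d * u) * G u))) =
       (LINT u:{-R..R}|lborel. iexp (d * u) / (k - \<i> * u)) + (LINT u:{-R..R}|lborel. (1 / d) * (iexp (d * u) * G u))"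
      unfolding set_lebesgue_integral_def scaleR_add_right
    proof (rule Bochner_Integration.integral_add)
      show "integrable lborel (\<lambda>u. indicator {-R..R} u *\<^sub>R (iexp (d * u) / (k - \<i> * u)))"
        using kz by (intro borel_integrable_compact continuous_intros) auto
      show "integrable lborel (\<lambda>u. indicator {-R..R} u *\<^sub>R ((1 / d) * (iexp (d * u) * G u)))"
        by (rule Bochner_Integration.integrable_bound[OF integrable_mult_right[OF iG, of "1 / d"]])
          (auto simp: indicator_def norm_mult intro!: AE_I2)
    qed
    moreover have "(LINT u:{-R..R}|lborel. (1 / d) * (iexp (d * u) * G u)) = (1 / d) * (LINT u:{-R..R}|lborel. iexp (d * u) * G u)"
      by (rule set_integral_mult_right)
    ultimately show ?thesis by (simp only: eq_diff_eq)
  qed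
  have F0: "((\<lambda>R. F (e * R)) \<longlongrightarrow> 0) at_top" if "\<bar>e\<bar> = 1" for e
  proof (rule tendsto_norm_zero_cancel, rule tendsto_sandwich[of "\<lambda>_. 0"])
    show "\<forall>\<^sub>F R in at_top. norm (F (e * R)) \<le> 1 / \<bar>d\<bar> * (1 / R)"
      using eventually_gt_at_top[of 0]
    proof eventually_elim
      case (elim R)
      have "R \<le> norm (complex_of_real k - \<i> * complex_of_real (e * R))"
        using abs_Im_le_cmod[of "complex_of_real k - \<i> * complex_of_real (e * R)"] that elim by (simp add: abs_mult)
      then have "\<bar>d\<bar> * R \<le> \<bar>d\<bar> * norm (complex_of_real k - \<i> * complex_of_real (e * R))" by (intro mult_left_mono) auto
      then have "1 / (\<bar>d\<bar> * norm (complex_of_real k - \<i> * complex_of_real (e * R))) \<le> 1 / (\<bar>d\<bar> * R)"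
        using elim d by (intro divide_left_mono mult_pos_pos) auto
      then show ?case by (simp add: F_def norm_divide norm_mult)
    qed
    show "((\<lambda>R. 1 / \<bar>d\<bar> * (1 / R)) \<longlongrightarrow> 0) at_top" using d by real_asymp
  qed auto
  have "((\<lambda>R. F R - F (- R) - (1 / d) * (LINT u:{-R..R}|lborel. iexp (d * u) * G u)) \<longlongrightarrow>
      0 - 0 - complex_of_real (1 / d) * complex_of_real (2 * pi * (- d * exp (k * d)))) at_top"
    using F0[of 1] F0[of "-1"] truncated_integral_tendsto[OF iG] unfolding inv
    by (intro tendsto_diff tendsto_mult tendsto_const) auto
  also have "0 - 0 - complex_of_real (1 / d) * complex_of_real (2 * pi * (- d * exp (k * d))) = 2 * pi * exp (k * d)"
    using d by simp
  finally show ?thesis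
  proof (rule Lim_transform_eventually)
    show "\<forall>\<^sub>F R in at_top. F R - F (- R) - (1 / d) * (LINT u:{-R..R}|lborel. iexp (d * u) * G u) = (LINT u:{-R..R}|lborel. iexp (d * u) / (k - \<i> * u))"
      using eventually_ge_at_top[of 0] by eventually_elim (rule parts[symmetric])
  qed
qed

lemma line_pole_integral:
  assumes k: "0 < k + w" and d: "d < 0"
  shows "((\<lambda>R. LINT u:{-R..R}|lborel. exp (\<i> * Complex u w * d) / (k - \<i> * Complex u w)) \<longlongrightarrow> 2 * pi * exp (k * d)) at_top"
proof -
  have eq: "exp (\<i> * Complex u w * d) / (k - \<i> * Complex u w) = exp (- (w * d)) * (iexp (d * u) / ((k + w) - \<i> * u))" for u
    by (simp add: Complex_eq exp_of_real[symmetric] mult_exp_exp algebra_simps)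
  have "((\<lambda>R. exp (- (w * d)) * (LINT u:{-R..R}|lborel. iexp (d * u) / ((k + w) - \<i> * u))) \<longlongrightarrow> exp (- (w * d)) * (2 * pi * exp ((k + w) * d))) at_top"
    unfolding of_real_mult[of "exp (- (w * d))"]
    by (intro tendsto_mult tendsto_const truncated_pole_integral k d)
  also have "exp (- (w * d)) * (2 * pi * exp ((k + w) * d)) = 2 * pi * exp (k * d)"
    by (simp add: mult_exp_exp algebra_simps)
  finally show ?thesis unfolding eq set_integral_mult_right by simp
qed

text \<open>The inverse transform is \<open>1 - exp (k * y)\<close> on the negative half-line, which is continuous at 0.\<close>

lemma line_double_pole_integral:
  assumes k: "0 < k" and w: "0 < w"
  shows "integrable lborel (\<lambda>u. exp (\<i> * Complex u w * d) * (k / ((k - \<i> * Complex u w) * (- (\<i> * Complex u w)))))"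
    and "(LINT u|lborel. exp (\<i> * Complex u w * d) * (k / ((k - \<i> * Complex u w) * (- (\<i> * Complex u w)))))
      = 2 * pi * (1 - exp (k * min d 0))"
proof -
  define G where "G u = k / ((k - \<i> * Complex u w) * (- (\<i> * Complex u w)))" for u
  define g where "g y = complex_of_real (1 - exp (k * min y 0))" for y
  have r: "Re (- (\<i> * Complex u w)) \<ge> w" "Re (k - \<i> * Complex u w) \<ge> w" for u using k by auto
  then have nz: "- (\<i> * Complex u w) \<noteq> 0" "k - \<i> * Complex u w \<noteq> 0" for u
    using w by (metis less_le_trans not_less_iff_gr_or_eq zero_complex.sel(1))+
  have Gm[measurable]: "G \<in> borel_measurable borel"
    unfolding G_def using nz unfolding Complex_eq by (intro borel_measurable_continuous_onI continuous_intros) auto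
  have Gint: "integrable lborel G"
  proof (rule integrable_decay[of 1])
    fix u
    have b: "1 / norm (- (\<i> * Complex u w)) \<le> (1 + 1 / w) / (1 + \<bar>u\<bar>)" "1 / norm (k - \<i> * Complex u w) \<le> (1 + 1 / w) / (1 + \<bar>u\<bar>)"
      using inverse_norm_bound[OF r(1) w, of u] inverse_norm_bound[OF r(2) w, of u] by simp_all
    have "norm (G u) = k * (1 / norm (k - \<i> * Complex u w) * (1 / norm (- (\<i> * Complex u w))))"
      using k by (simp add: G_def norm_divide norm_mult)
    also have "\<dots> \<le> k * ((1 + 1 / w) / (1 + \<bar>u\<bar>) * ((1 + 1 / w) / (1 + \<bar>u\<bar>)))"
      using b k w by (intro mult_left_mono mult_mono) auto
    also have "\<dots> = k * (1 + 1 / w)\<^sup>2 * (1 + \<bar>u\<bar>) powr (- 1) / (1 + \<bar>u\<bar>)"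
      by (simp add: powr_minus power2_eq_square divide_inverse)
    finally show "norm (G u) \<le> k * (1 + 1 / w)\<^sup>2 * (1 + \<bar>u\<bar>) powr (- 1) / (1 + \<bar>u\<bar>)" .
  qed auto
  have cm: "(\<lambda>u. exp (\<i> * Complex u w * d)) \<in> borel_measurable borel"
    unfolding Complex_eq by (intro borel_measurable_continuous_onI continuous_intros)
  have "integrable lborel (\<lambda>u. exp (\<i> * Complex u w * d) * G u)"
  proof (rule Bochner_Integration.integrable_bound)
    show "integrable lborel (\<lambda>u. exp (- w * d) *\<^sub>R G u)" using Gint by (rule integrable_scaleR_right)
    show "(\<lambda>u. exp (\<i> * Complex u w * d) * G u) \<in> borel_measurable lborel" using cm by measurable
  qed (auto simp: norm_mult norm_exp intro!: AE_I2)
  then show "integrable lborel (\<lambda>u. exp (\<i> * Complex u w * d) * (k / ((k - \<i> * Complex u w) * (- (\<i> * Complex u w)))))"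
    unfolding G_def .
  have gb: "norm (complex_of_real (exp (w * y)) * g y) \<le> indicator {..0} y * exp (w * y)" for y
  proof (cases "y \<le> 0")
    case True
    have "k * y \<le> 0" using k True by (intro mult_nonneg_nonpos) auto
    then have "\<bar>1 - exp (k * min y 0)\<bar> \<le> 1" using True by (simp add: min_absorb1)
    then show ?thesis using True unfolding g_def norm_mult norm_of_real by simp
  qed (simp add: g_def)
  have "(LINT u|lborel. exp (\<i> * Complex u w * d) * G u) = 2 * pi * g d"
  proof (rule point_line_inversion[where C=1])
    have gm: "g \<in> borel_measurable borel" unfolding g_def by measurable
    show "integrable lborel (\<lambda>y. complex_of_real (exp (w * y)) * g y)"
      by (rule Bochner_Integration.integrable_bound[OF integrable_exp_atMost[OF w]]) (use gb gm in \<open>auto intro!: AE_I2 simp: abs_mult\<close>)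
    show "norm (complex_of_real (exp (w * y)) * g y) \<le> 1" for y
      by (rule order_trans[OF gb]) (use w in \<open>auto simp: indicator_def mult_nonneg_nonpos\<close>)
    show "isCont g d" unfolding g_def by (intro continuous_intros)
    show "G u = (LINT y|lborel. exp (- (\<i> * Complex u w * y)) * g y)" for u
    proof -
      let ?s = "\<i> * Complex u w"
      have r0: "Re (- ?s) > 0" "Re (k - ?s) > 0" using k w by auto
      have "(LINT y|lborel. exp (- (?s * complex_of_real y)) * g y) = \<bar>-1\<bar> *\<^sub>R (LINT x|lborel. exp (- (?s * complex_of_real (0 + (-1) * x))) * g (0 + (-1) * x))"
        by (rule lborel_integral_real_affine) simp
      also have "\<dots> = (LINT x|lborel. indicator {0..} x *\<^sub>R exp (- ((- ?s) * complex_of_real x)) - indicator {0..} x *\<^sub>R exp (- ((k - ?s) * complex_of_real x)))"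
        by (simp, intro Bochner_Integration.integral_cong)
          (auto simp: indicator_def g_def exp_of_real[symmetric] mult_exp_exp algebra_simps min_def)
      also have "\<dots> = 1 / (- ?s) - 1 / (k - ?s)"
        by (subst Bochner_Integration.integral_diff)
          (use integral_exp_atLeast[OF r0(1), of 0] integral_exp_atLeast[OF r0(2), of 0] in auto)
      also have "\<dots> = G u"
      proof -
        have "1 / a - 1 / b = (b - a) / (b * a)" if "a \<noteq> 0" "b \<noteq> 0" for a b :: complex
          using that by (simp add: field_simps)
        from this[OF nz[of u]] show ?thesis unfolding G_def by simp
      qed
      finally show ?thesis ..
    qed
  qed (rule Gint)
  then show "(LINT u|lborel. exp (\<i> * Complex u w * d) * (k / ((k - \<i> * Complex u w) * (- (\<i> * Complex u w)))))
      = 2 * pi * (1 - exp (k * min d 0))"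
    unfolding G_def g_def by simp
qed

section \<open>The payoff with a fixed barrier\<close>

lemma powr_decay_mono: "0 < \<nu> \<Longrightarrow> (1 + norm \<xi>) powr (- \<nu>) \<le> (1 + \<bar>Re \<xi>\<bar>) powr (- \<nu>)"
  by (rule powr_mono2') (auto intro: abs_Re_le_cmod)

lemma powr_decay_tendsto_0:
  assumes "0 < \<nu>"
  shows "((\<lambda>u. (1 + \<bar>u::real\<bar>) powr (- \<nu>)) \<longlongrightarrow> 0) at_infinity"
proof -
  have "filterlim (\<lambda>u::real. 1 + norm u) at_top at_infinity"
    by (rule filterlim_tendsto_add_at_top[OF tendsto_const filterlim_norm_at_top])
  then have "((\<lambda>u::real. (1 + norm u) powr (- \<nu>)) \<longlongrightarrow> 0) at_infinity"
    using assms by (intro tendsto_neg_powr) auto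
  then show ?thesis by simp
qed

lemma (in prob_space) expectation_exp_off_zero:
  fixes W :: "'a \<Rightarrow> real" and \<xi> :: complex
  assumes W[measurable]: "W \<in> borel_measurable M" and i: "integrable M (\<lambda>\<omega>. exp (\<i> * \<xi> * W \<omega>))"
  shows "expectation (\<lambda>\<omega>. of_bool (W \<omega> \<noteq> 0) * exp (\<i> * \<xi> * W \<omega>)) = expectation (\<lambda>\<omega>. exp (\<i> * \<xi> * W \<omega>)) - prob {\<omega>\<in>space M. W \<omega> = 0}"
proof -
  have "expectation (\<lambda>\<omega>. of_bool (W \<omega> \<noteq> 0) * exp (\<i> * \<xi> * W \<omega>)) =
      expectation (\<lambda>\<omega>. exp (\<i> * \<xi> * W \<omega>) - complex_of_real (indicator {\<omega>\<in>space M. W \<omega> = 0} \<omega>))"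
    by (intro Bochner_Integration.integral_cong) (auto simp: indicator_def)
  also have "\<dots> = expectation (\<lambda>\<omega>. exp (\<i> * \<xi> * W \<omega>)) - expectation (\<lambda>\<omega>. complex_of_real (indicator {\<omega>\<in>space M. W \<omega> = 0} \<omega>))"
  proof (rule Bochner_Integration.integral_diff[OF i], rule integrable_of_real)
    show "integrable M (indicat_real {\<omega>\<in>space M. W \<omega> = 0})"
      by (rule integrable_const_bound[where B=1]) auto
  qed
  finally show ?thesis by simp
qed

lemma complex_line: "\<i> * Complex u w = complex_of_real (- w) + \<i> * complex_of_real u"
  by (simp add: complex_eq_iff)

lemma recentred_transform_line_bound:
  assumes b: "1 < \<beta>" and y: "0 \<le> y" and w: "0 < w"
  shows "norm (recentred_transform \<beta> (\<i> * Complex u w) y) \<le> (exp (y * \<beta>) + \<beta> * exp y / w + exp y) * (1 + 1 / w) / (1 + \<bar>u\<bar>)"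
proof -
  let ?s = "\<i> * Complex u w"
  define m where "m = (1 + 1 / w) / (1 + \<bar>u\<bar>)"
  have "1 / norm (- ?s) \<le> (1 + 1 / w) / (1 + \<bar>Im (- ?s)\<bar>)" "1 / norm (\<beta> - ?s) \<le> (1 + 1 / w) / (1 + \<bar>Im (\<beta> - ?s)\<bar>)"
    by (rule inverse_norm_bound; use w b in simp)+
  then have n: "1 / norm (- ?s) \<le> m" "1 / norm (\<beta> - ?s) \<le> m" unfolding m_def by simp_all
  have w1: "1 / norm (- ?s) \<le> 1 / w"
    using complex_Re_le_cmod[of "- ?s"] w by (intro frac_le) auto
  have m0: "0 \<le> m" unfolding m_def using w by simp
  have e: "norm (exp (y * (1 + ?s * (1 - 1 / \<beta>)))) \<le> exp y"
  proof -
    have "y * (w * (1 - 1 / \<beta>)) \<ge> 0" using y w b by (intro mult_nonneg_nonneg) auto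
    then show ?thesis by (simp add: norm_exp algebra_simps)
  qed
  have t1: "norm (exp (y * \<beta>) / (\<beta> - ?s)) \<le> exp (y * \<beta>) * m"
    using n(2) mult_left_mono[OF n(2), of "exp (y * \<beta>)"] by (simp add: norm_divide norm_exp)
  have t2: "norm (\<beta> * (exp (y * (1 + ?s * (1 - 1 / \<beta>))) / ((\<beta> - ?s) * (- ?s)))) \<le> \<beta> * (exp y * (m * (1 / w)))"
  proof -
    have "norm (\<beta> * (exp (y * (1 + ?s * (1 - 1 / \<beta>))) / ((\<beta> - ?s) * (- ?s)))) =
       \<beta> * (norm (exp (y * (1 + ?s * (1 - 1 / \<beta>)))) * (1 / norm (\<beta> - ?s) * (1 / norm (- ?s))))"
      using b by (simp only: norm_mult norm_divide norm_of_real) simp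
    also have "\<dots> \<le> \<beta> * (exp y * (m * (1 / w)))"
      by (intro mult_left_mono mult_mono e n w1) (use b m0 w in auto)
    finally show ?thesis .
  qed
  have t3: "norm (complex_of_real (exp y) / (- ?s)) \<le> exp y * m"
    using mult_left_mono[OF n(1), of "exp y"] by (simp add: norm_divide)
  have "norm (recentred_transform \<beta> ?s y) \<le> exp (y * \<beta>) * m + \<beta> * (exp y * (m * (1 / w))) + exp y * m"
  proof -
    have "norm (a + b - c) \<le> A + B + C" if "norm a \<le> A" "norm b \<le> B" "norm c \<le> C" for a b c :: complex and A B C
      using norm_triangle_ineq4[of "a + b" c] norm_triangle_ineq[of a b] that by linarith
    from this[OF t1 t2 t3[folded exp_of_real]] show ?thesis
      unfolding recentred_transform_def by (simp add: exp_of_real[symmetric])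
  qed
  also have "\<dots> = (exp (y * \<beta>) + \<beta> * exp y / w + exp y) * m" by (simp add: algebra_simps)
  finally show ?thesis unfolding m_def by simp
qed

lemma measurable_recentred_transform_line[measurable]:
  "(\<lambda>u. recentred_transform \<beta> (\<i> * Complex u w) y) \<in> borel_measurable borel"
  unfolding recentred_transform_def complex_line by measurable

text \<open>The transform of the payoff is a sum of two simple poles, due to its jump at \<open>x2\<close>, and a double pole, due to its kink at
  \<open>x2 / \<beta>\<close>. The three inverse transforms add up to the payoff.\<close>

lemma payoff_point_inversion:
  assumes b: "1 < \<beta>" and w: "0 < w" and x: "x1 < x2"
  shows "((\<lambda>R. LINT u:{-R..R}|lborel. exp (\<i> * complex_of_real (x1 - x2) * Complex u w) * recentred_transform \<beta> (\<i> * Complex u w) x2)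
    \<longlongrightarrow> 2 * pi * exchange_payoff \<beta> x1 x2) at_top"
proof -
  let ?d = "x1 - x2" and ?d2 = "x1 - x2 / \<beta>"
  let ?g1 = "\<lambda>u. exp (\<i> * Complex u w * ?d) / (complex_of_real \<beta> - \<i> * Complex u w)"
  let ?g0 = "\<lambda>u. exp (\<i> * Complex u w * ?d) / (complex_of_real 0 - \<i> * Complex u w)"
  let ?g2 = "\<lambda>u. exp (\<i> * Complex u w * ?d2) * (\<beta> / ((\<beta> - \<i> * Complex u w) * (- (\<i> * Complex u w))))"
  have d: "?d < 0" using x by simp
  have eq: "exp (\<i> * complex_of_real (x1 - x2) * Complex u w) * recentred_transform \<beta> (\<i> * Complex u w) x2
     = exp (x2 * \<beta>) * ?g1 u + exp x2 * ?g2 u - exp x2 * ?g0 u" for u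
  proof -
    have "exp (\<i> * complex_of_real (x1 - x2) * Complex u w) * exp (x2 * (1 + \<i> * Complex u w * (1 - 1 / \<beta>))) = exp x2 * exp (\<i> * Complex u w * ?d2)"
      using b by (simp add: mult_exp_exp exp_of_real[symmetric] field_simps)
    then have e: "exp (\<i> * Complex u w * ?d) * exp (x2 * (1 + \<i> * Complex u w * (1 - 1 / \<beta>))) = exp x2 * exp (\<i> * Complex u w * ?d2)"
      by (simp only: mult_ac)
    have "E * (A / a + k * (B / c) - D / f) = A * (E / a) + k * (E * B / c) - D * (E / f)" for E A B D k a c f :: complex
      by (simp add: ring_distribs mult.commute mult.left_commute)
    note alg = this
    have A: "exp (\<i> * Complex u w * ?d) * recentred_transform \<beta> (\<i> * Complex u w) x2
      = exp (complex_of_real x2 * complex_of_real \<beta>) * ?g1 u + \<beta> * (exp x2 * exp (\<i> * Complex u w * ?d2) / ((\<beta> - \<i> * Complex u w) * (- (\<i> * Complex u w))))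
         - exp (complex_of_real x2) * (exp (\<i> * Complex u w * ?d) / (- (\<i> * Complex u w)))"
      unfolding recentred_transform_def alg using e by simp
    have B: "\<beta> * (exp x2 * exp (\<i> * Complex u w * ?d2) / ((\<beta> - \<i> * Complex u w) * (- (\<i> * Complex u w)))) = exp x2 * ?g2 u"
      by (simp only: times_divide_eq_right mult_ac)
    have C: "exp (\<i> * Complex u w * ?d) / (- (\<i> * Complex u w)) = ?g0 u" by simp
    have "\<i> * complex_of_real (x1 - x2) * Complex u w = \<i> * Complex u w * ?d" by (simp only: mult_ac)
    then show ?thesis using A unfolding B C by (simp only: exp_of_real[symmetric] of_real_mult)
  qed
  have cont: "continuous_on UNIV ?g1" "continuous_on UNIV ?g0"
  proof -
    have nz: "complex_of_real k - (complex_of_real (- w) + \<i> * complex_of_real u) \<noteq> 0" if "k \<ge> 0" for u k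
      using that w by (auto simp: complex_eq_iff)
    show "continuous_on UNIV ?g1" "continuous_on UNIV ?g0"
      unfolding complex_line using nz[of \<beta>] nz[of 0] b by (auto intro!: continuous_intros simp del: of_real_0)
  qed
  have i: "set_integrable lborel {-R..R} (\<lambda>u. c * f u)" if "continuous_on UNIV f" for R and f :: "real \<Rightarrow> complex" and c
    unfolding set_integrable_def using that
    by (intro borel_integrable_compact continuous_intros) (auto intro: continuous_on_subset)
  have i2: "integrable lborel ?g2" and v2: "(LINT u|lborel. ?g2 u) = 2 * pi * (1 - exp (\<beta> * min ?d2 0))"
    using line_double_pole_integral[of \<beta> w ?d2] b w by auto
  have i2': "set_integrable lborel {-R..R} (\<lambda>u. c * ?g2 u)" for R c
    unfolding set_integrable_def by (intro integrable_mult_indicator integrable_mult_right i2) simp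
  have "((\<lambda>R. exp (x2 * \<beta>) * (LINT u:{-R..R}|lborel. ?g1 u) + exp x2 * (LINT u:{-R..R}|lborel. ?g2 u) - exp x2 * (LINT u:{-R..R}|lborel. ?g0 u))
     \<longlongrightarrow> complex_of_real (exp (x2 * \<beta>)) * (2 * pi * exp (\<beta> * ?d)) + complex_of_real (exp x2) * (2 * pi * (1 - exp (\<beta> * min ?d2 0)))
        - complex_of_real (exp x2) * (2 * pi * exp (0 * ?d))) at_top"
    using line_pole_integral[of \<beta> w ?d] line_pole_integral[of 0 w ?d] truncated_integral_tendsto[OF i2] b w d unfolding v2
    by (intro tendsto_intros) auto
  also have "complex_of_real (exp (x2 * \<beta>)) * (2 * pi * exp (\<beta> * ?d)) + complex_of_real (exp x2) * (2 * pi * (1 - exp (\<beta> * min ?d2 0)))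
        - complex_of_real (exp x2) * (2 * pi * exp (0 * ?d)) = 2 * pi * exchange_payoff \<beta> x1 x2"
  proof -
    have e1: "exp (x2 * \<beta>) * exp (\<beta> * ?d) = exp (\<beta> * x1)" by (simp add: mult_exp_exp algebra_simps)
    have e2: "exp x2 * exp (\<beta> * min ?d2 0) = min (exp (\<beta> * x1)) (exp x2)"
    proof (cases "?d2 \<le> 0")
      case True
      then have "\<beta> * x1 \<le> x2" using b by (simp add: pos_le_divide_eq mult.commute)
      then show ?thesis using True b by (simp add: mult_exp_exp min_def algebra_simps)
    next
      case False
      then have "x2 < \<beta> * x1" using b by (simp add: not_le pos_divide_less_eq mult.commute)
      then show ?thesis using False by (simp add: min_def)
    qed
    have "exp (x2 * \<beta>) * (2 * pi * exp (\<beta> * ?d)) + exp x2 * (2 * pi * (1 - exp (\<beta> * min ?d2 0))) - exp x2 * (2 * pi * exp (0 * ?d))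
      = 2 * pi * (exp (x2 * \<beta>) * exp (\<beta> * ?d) - exp x2 * exp (\<beta> * min ?d2 0))"
      by (simp add: algebra_simps)
    also have "\<dots> = 2 * pi * exchange_payoff \<beta> x1 x2"
      unfolding e1 e2 using x by (auto simp: exchange_payoff_def max_def min_def)
    finally show ?thesis by (simp flip: of_real_mult of_real_add of_real_diff)
  qed
  also have "(\<lambda>R. exp (x2 * \<beta>) * (LINT u:{-R..R}|lborel. ?g1 u) + exp x2 * (LINT u:{-R..R}|lborel. ?g2 u) - exp x2 * (LINT u:{-R..R}|lborel. ?g0 u))
     = (\<lambda>R. LINT u:{-R..R}|lborel. exp (\<i> * complex_of_real (x1 - x2) * Complex u w) * recentred_transform \<beta> (\<i> * Complex u w) x2)"
    unfolding eq
      set_integral_diff(2)[OF set_integral_add(1)[OF i[OF cont(1)] i2'] i[OF cont(2)]]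
      set_integral_add(2)[OF i[OF cont(1)] i2'] set_integral_mult_right ..
  finally show ?thesis .
qed

text \<open>Off the atom of \<open>X\<close> at 0 the integrand is absolutely integrable. The atom contributes \<open>a\<close> times the inversion of the payoff at the point
  \<open>x1\<close>, which holds if \<open>x1 < x2\<close>; for \<open>x1 = x2 > 0\<close> the symmetric limit would give half of the jump, and for
  \<open>x1 = x2 = 0\<close> the payoff and its transform vanish.\<close>

theorem fixed_barrier_inversion:
  fixes X :: "'a \<Rightarrow> real"
  assumes P: "prob_space P" and X[measurable]: "X \<in> borel_measurable P"
    and b: "1 < \<beta>" and w: "0 < w" and nu: "0 < \<nu>"
    and int: "integrable P (\<lambda>\<omega>. exp (- w * X \<omega>))"
    and atoms: "\<And>d. measure P {\<omega>\<in>space P. X \<omega> = d} = (if d = 0 then a else 0)"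
    and Phi: "\<And>u. \<Phi> u = (LINT \<omega>|P. exp (\<i> * Complex u w * X \<omega>))"
    and decay: "\<And>u. norm (\<Phi> u - complex_of_real a) \<le> C * (1 + \<bar>u\<bar>) powr (- \<nu>)"
    and x: "x1 \<le> x2" "0 \<le> x2" and no_atom: "x1 = x2 \<Longrightarrow> 0 < x2 \<Longrightarrow> a = 0"
  shows "((\<lambda>R. LINT u:{-R..R}|lborel. \<Phi> u * (exp (\<i> * complex_of_real (x1 - x2) * Complex u w) * recentred_transform \<beta> (\<i> * Complex u w) x2))
    \<longlongrightarrow> 2 * pi * (LINT \<omega>|P. exchange_payoff \<beta> (x1 + X \<omega>) x2)) at_top"
proof -
  interpret P: prob_space P by fact
  let ?G = "\<lambda>u. exp (\<i> * complex_of_real (x1 - x2) * Complex u w) * recentred_transform \<beta> (\<i> * Complex u w) x2"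
  let ?s = "\<lambda>u. \<i> * Complex u w"
  have iX: "integrable P (\<lambda>\<omega>. exp (\<i> * Complex u w * X \<omega>))" for u
    by (rule Bochner_Integration.integrable_bound[OF int]) (auto simp: norm_exp intro!: AE_I2)
  have a0: "measure P {\<omega>\<in>space P. X \<omega> = 0} = a" using atoms[of 0] by simp
  have H: "\<Phi> u - complex_of_real a = (LINT \<omega>|P. of_bool (X \<omega> \<noteq> 0) * exp (\<i> * Complex u w * X \<omega>))" for u
    using P.expectation_exp_off_zero[OF X iX] unfolding Phi a0 by simp
  have Gm[measurable]: "?G \<in> borel_measurable borel"
  proof -
    have "(\<lambda>u. exp (\<i> * complex_of_real (x1 - x2) * Complex u w)) \<in> borel_measurable borel"
      unfolding Complex_eq by (intro borel_measurable_continuous_onI continuous_intros)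
    then show ?thesis by (intro borel_measurable_times measurable_recentred_transform_line)
  qed
  have Phim[measurable]: "\<Phi> \<in> borel_measurable borel"
    unfolding Phi complex_line by measurable
  define B where "B = (exp (x2 * \<beta>) + \<beta> * exp x2 / w + exp x2) * (1 + 1 / w)"
  have B0: "0 \<le> B" unfolding B_def using b w by (intro mult_nonneg_nonneg add_nonneg_nonneg) auto
  have Gb: "norm (?G u) \<le> exp (w * (x2 - x1)) * (B / (1 + \<bar>u\<bar>))" for u
  proof -
    have n: "norm (exp (\<i> * complex_of_real (x1 - x2) * Complex u w)) = exp (w * (x2 - x1))"
      by (simp add: norm_exp algebra_simps)
    show ?thesis
      unfolding norm_mult n B_def
      by (intro mult_left_mono recentred_transform_line_bound[OF b x(2) w]) auto
  qed
  have PhiG: "integrable lborel (\<lambda>u. (\<Phi> u - a) * ?G u)"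
  proof (rule integrable_decay[OF nu])
    fix u
    have "norm ((\<Phi> u - a) * ?G u) \<le> (C * (1 + \<bar>u\<bar>) powr (- \<nu>)) * (exp (w * (x2 - x1)) * (B / (1 + \<bar>u\<bar>)))"
      unfolding norm_mult[of "\<Phi> u - a"] using order_trans[OF norm_ge_zero decay]
      by (intro mult_mono decay Gb) auto
    then show "norm ((\<Phi> u - a) * ?G u) \<le> (C * exp (w * (x2 - x1)) * B) * (1 + \<bar>u\<bar>) powr (- \<nu>) / (1 + \<bar>u\<bar>)"
      by (simp add: mult_ac)
  qed measurable
  have gG: "?G u = (LINT y|lborel. exp (- (\<i> * Complex u w * complex_of_real y)) * exchange_payoff \<beta> (x1 + y) x2)" for u
    using shifted_payoff_transform(2)[OF b x(2), of "?s u" x1] w by (simp add: mult_ac)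
  have gi: "integrable lborel (\<lambda>y. complex_of_real (exp (w * y)) * complex_of_real (exchange_payoff \<beta> (x1 + y) x2))"
    using shifted_payoff_transform(1)[OF b x(2), of "complex_of_real (- w)" x1] w by (simp add: exp_of_real[symmetric])
  have gb: "norm (complex_of_real (exp (w * y)) * complex_of_real (exchange_payoff \<beta> (x1 + y) x2)) \<le> exp (w * (x2 - x1)) * exp (\<beta> * x2)" for y
  proof (cases "x1 + y \<le> x2")
    case True
    then show ?thesis unfolding norm_mult norm_of_real
      using payoff_le[of \<beta> "x1 + y" x2] payoff_bounds(1)[of \<beta> "x1 + y" x2] b w by (intro mult_mono) auto
  next
    case False
    then show ?thesis by (simp add: payoff_bounds(3))
  qed
  \<comment> \<open>The payoff jumps at \<open>X = x2 - x1\<close>, which is a null event or the removed atom.\<close>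
  have off: "(LINT u|lborel. (\<Phi> u - a) * ?G u) = 2 * pi * (LINT \<omega>|P. of_bool (X \<omega> \<noteq> 0) * complex_of_real (exchange_payoff \<beta> (x1 + X \<omega>) x2))"
  proof (rule line_inversion[OF P.sigma_finite_measure_axioms X _ gi gb _ H gG PhiG])
    show "integrable P (\<lambda>\<omega>. of_bool (X \<omega> \<noteq> 0) * complex_of_real (exp (- w * X \<omega>)))"
      by (rule Bochner_Integration.integrable_bound[OF int]) (auto intro!: AE_I2)
    have "AE \<omega> in P. X \<omega> \<noteq> x2 - x1 \<or> x2 - x1 = 0"
    proof (cases "x2 - x1 = 0")
      case False
      then have "measure P {\<omega>\<in>space P. X \<omega> = x2 - x1} = 0" unfolding atoms by simp
      then have "AE \<omega> in P. \<omega> \<notin> {\<omega>\<in>space P. X \<omega> = x2 - x1}"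
        by (subst (asm) P.prob_eq_0) auto
      with AE_space show ?thesis by eventually_elim auto
    qed simp
    then show "AE \<omega> in P. of_bool (X \<omega> \<noteq> 0) \<noteq> (0::complex) \<longrightarrow> isCont (\<lambda>y. complex_of_real (exchange_payoff \<beta> (x1 + y) x2)) (X \<omega>)"
      by eventually_elim (auto intro!: continuous_intros isCont_payoff)
  qed
  have atom: "((\<lambda>R. a * (LINT u:{-R..R}|lborel. ?G u)) \<longlongrightarrow> complex_of_real a * (2 * pi * exchange_payoff \<beta> x1 x2)) at_top"
  proof (cases "x1 < x2")
    case True
    from tendsto_mult[OF tendsto_const payoff_point_inversion[OF b w True], of "complex_of_real a"]
    show ?thesis .
  next
    case False
    show ?thesis
    proof (cases "a = 0")
      case False
      then have eq: "x1 = x2" using x \<open>\<not> x1 < x2\<close> by simp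
      then have 0: "x1 = 0" "x2 = 0" using no_atom[OF eq] x \<open>a \<noteq> 0\<close> by (auto simp: order_le_less)
      have "recentred_transform \<beta> (?s u) 0 = 0" for u
      proof -
        have nz: "\<beta> - ?s u \<noteq> 0" "- ?s u \<noteq> 0" using w b by (auto simp: complex_eq_iff)
        have "1 / x + k * (1 / (x * y)) - 1 / y = (y + k - x) / (x * y)" if "x \<noteq> 0" "y \<noteq> 0" for x y k :: complex
          using that by (simp add: divide_simps)
        from this[OF nz, of "complex_of_real \<beta>"] show ?thesis unfolding recentred_transform_def by simp
      qed
      then show ?thesis using 0 by (simp add: exchange_payoff_def)
    qed simp
  qed
  have GR: "set_integrable lborel {-R..R} ?G" for R
  proof (unfold set_integrable_def, rule integrableI_bounded_set[where A="{-R..R}" and B="exp (w * (x2 - x1)) * B"])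
    show "AE u in lborel. u \<in> {-R..R} \<longrightarrow> norm (indicat_real {-R..R} u *\<^sub>R ?G u) \<le> exp (w * (x2 - x1)) * B"
    proof (intro AE_I2 impI)
      fix u
      have "B / (1 + \<bar>u\<bar>) \<le> B" using B0 by (simp add: divide_le_eq mult_le_cancel_left1)
      then have "exp (w * (x2 - x1)) * (B / (1 + \<bar>u\<bar>)) \<le> exp (w * (x2 - x1)) * B" by (intro mult_left_mono) auto
      moreover have "norm (indicat_real {-R..R} u *\<^sub>R ?G u) \<le> norm (?G u)" by (simp add: indicator_def)
      ultimately show "norm (indicat_real {-R..R} u *\<^sub>R ?G u) \<le> exp (w * (x2 - x1)) * B"
        using Gb[of u] by linarith
    qed
    show "(\<lambda>u. indicat_real {-R..R} u *\<^sub>R ?G u) \<in> borel_measurable lborel"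
      unfolding measurable_lborel2 by (intro borel_measurable_scaleR borel_measurable_indicator Gm) simp
  qed (auto simp: emeasure_lborel_Icc_eq)
  have FR: "set_integrable lborel {-R..R} (\<lambda>u. (\<Phi> u - a) * ?G u)" for R
    unfolding set_integrable_def by (intro integrable_mult_indicator PhiG) simp
  have "(LINT u:{-R..R}|lborel. \<Phi> u * ?G u) = (LINT u:{-R..R}|lborel. (\<Phi> u - a) * ?G u) + a * (LINT u:{-R..R}|lborel. ?G u)" for R
  proof -
    have "(LINT u:{-R..R}|lborel. \<Phi> u * ?G u) = (LINT u:{-R..R}|lborel. (\<Phi> u - a) * ?G u + a * ?G u)"
      by (simp add: algebra_simps)
    also have "\<dots> = (LINT u:{-R..R}|lborel. (\<Phi> u - a) * ?G u) + (LINT u:{-R..R}|lborel. a * ?G u)"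
      by (rule set_integral_add(2)[OF FR]) (use GR in \<open>auto intro: set_integrable_mult_right\<close>)
    finally show ?thesis by (simp only: set_integral_mult_right)
  qed
  moreover have "((\<lambda>R. (LINT u:{-R..R}|lborel. (\<Phi> u - a) * ?G u) + a * (LINT u:{-R..R}|lborel. ?G u)) \<longlongrightarrow>
     2 * pi * (LINT \<omega>|P. of_bool (X \<omega> \<noteq> 0) * complex_of_real (exchange_payoff \<beta> (x1 + X \<omega>) x2)) + complex_of_real a * (2 * pi * exchange_payoff \<beta> x1 x2)) at_top"
    using truncated_integral_tendsto[OF PhiG] atom unfolding off by (intro tendsto_add)
  moreover have "2 * pi * (LINT \<omega>|P. of_bool (X \<omega> \<noteq> 0) * complex_of_real (exchange_payoff \<beta> (x1 + X \<omega>) x2)) + complex_of_real a * (2 * pi * exchange_payoff \<beta> x1 x2)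
     = 2 * pi * complex_of_real (LINT \<omega>|P. exchange_payoff \<beta> (x1 + X \<omega>) x2)"
  proof -
    have ip: "integrable P (\<lambda>\<omega>. exchange_payoff \<beta> (x1 + X \<omega>) x2)"
      by (rule P.integrable_const_bound[where B="exp (\<beta> * x2)"])
        (use payoff_le[of \<beta> _ x2] payoff_bounds(1)[of \<beta> _ x2] b in \<open>auto\<close>)
    have "(LINT \<omega>|P. exchange_payoff \<beta> (x1 + X \<omega>) x2) =
       (LINT \<omega>|P. of_bool (X \<omega> \<noteq> 0) * exchange_payoff \<beta> (x1 + X \<omega>) x2 + indicator {\<omega>\<in>space P. X \<omega> = 0} \<omega> * exchange_payoff \<beta> x1 x2)"
      by (intro Bochner_Integration.integral_cong) (auto simp: indicator_def)
    also have "\<dots> = (LINT \<omega>|P. of_bool (X \<omega> \<noteq> 0) * exchange_payoff \<beta> (x1 + X \<omega>) x2) + (LINT \<omega>|P. indicator {\<omega>\<in>space P. X \<omega> = 0} \<omega> * exchange_payoff \<beta> x1 x2)"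
    proof (rule Bochner_Integration.integral_add)
      show "integrable P (\<lambda>\<omega>. of_bool (X \<omega> \<noteq> 0) * exchange_payoff \<beta> (x1 + X \<omega>) x2)"
        by (rule Bochner_Integration.integrable_bound[OF ip]) (auto intro!: AE_I2)
      show "integrable P (\<lambda>\<omega>. indicator {\<omega>\<in>space P. X \<omega> = 0} \<omega> * exchange_payoff \<beta> x1 x2)"
        by (rule P.integrable_const_bound[where B="\<bar>exchange_payoff \<beta> x1 x2\<bar>"]) (auto simp: indicator_def)
    qed
    also have "(LINT \<omega>|P. indicator {\<omega>\<in>space P. X \<omega> = 0} \<omega> * exchange_payoff \<beta> x1 x2) = a * exchange_payoff \<beta> x1 x2"
      using a0 by simp
    finally have "(LINT \<omega>|P. exchange_payoff \<beta> (x1 + X \<omega>) x2) = (LINT \<omega>|P. of_bool (X \<omega> \<noteq> 0) * exchange_payoff \<beta> (x1 + X \<omega>) x2) + a * exchange_payoff \<beta> x1 x2" .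
    moreover have "(LINT \<omega>|P. of_bool (X \<omega> \<noteq> 0) * complex_of_real (exchange_payoff \<beta> (x1 + X \<omega>) x2)) = complex_of_real (LINT \<omega>|P. of_bool (X \<omega> \<noteq> 0) * exchange_payoff \<beta> (x1 + X \<omega>) x2)"
      by (subst integral_complex_of_real[symmetric], intro Bochner_Integration.integral_cong) auto
    ultimately show ?thesis by (simp add: algebra_simps)
  qed
  ultimately show ?thesis by simp
qed

section \<open>Inversion in the supremum and in the infimum\<close>

lemma measurable_gain_transform_line:
  "(\<lambda>q. gain_transform \<beta> b (\<i> * Complex (fst q) v) (snd q)) \<in> borel_measurable (borel \<Otimes>\<^sub>M borel)"
  unfolding gain_transform_def complex_line by measurable

text \<open>What the formula needs from the process: \<open>S\<close> and \<open>Z\<close> are the supremum and the drawdown, \<open>v\<close> and \<open>w\<close> the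
  heights of the two lines of integration.\<close>

locale wiener_hopf_pair = prob_space P for P :: "'b measure" +
  fixes S Z :: "'b \<Rightarrow> real" and \<phi>pp \<phi>mm :: "complex \<Rightarrow> complex" and ap am Cp Cm \<nu>p \<nu>m w v :: real
  assumes indep: "indep_var borel S borel Z"
    and S_nonneg: "\<And>\<omega>. \<omega> \<in> space P \<Longrightarrow> 0 \<le> S \<omega>" and Z_nonpos: "\<And>\<omega>. \<omega> \<in> space P \<Longrightarrow> Z \<omega> \<le> 0"
    and w_pos: "0 < w" and v_neg: "v < 0"
    and moment_v: "integrable P (\<lambda>\<omega>. exp (- v * (S \<omega> + Z \<omega>)))"
    and moment_w: "integrable P (\<lambda>\<omega>. exp (- w * (S \<omega> + Z \<omega>)))"
    and const: "0 < \<nu>p" "0 < \<nu>m" "0 < Cp" "0 < Cm"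
    and repr_plus: "\<And>\<xi>. v \<le> Im \<xi> \<Longrightarrow> expectation (\<lambda>\<omega>. exp (\<i> * \<xi> * complex_of_real (S \<omega>))) = complex_of_real ap + \<phi>pp \<xi>"
    and repr_minus: "\<And>\<xi>. Im \<xi> \<le> w \<Longrightarrow> expectation (\<lambda>\<omega>. exp (\<i> * \<xi> * complex_of_real (Z \<omega>))) = complex_of_real am + \<phi>mm \<xi>"
    and bound_plus: "\<And>\<xi>. v \<le> Im \<xi> \<Longrightarrow> norm (\<phi>pp \<xi>) \<le> Cp * (1 + norm \<xi>) powr (- \<nu>p)"
    and bound_minus: "\<And>\<xi>. Im \<xi> \<le> w \<Longrightarrow> norm (\<phi>mm \<xi>) \<le> Cm * (1 + norm \<xi>) powr (- \<nu>m)"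
begin

lemma measurable_SZ[measurable]: "S \<in> borel_measurable P" "Z \<in> borel_measurable P"
  using indep unfolding indep_var_eq by auto

lemma moments:
  "integrable P (\<lambda>\<omega>. exp (- v * S \<omega>))" "integrable P (\<lambda>\<omega>. exp (- w * Z \<omega>))"
  using indep_var_integrable_exp[OF indep moment_v] indep_var_integrable_exp[OF indep moment_w] by auto

lemma integrable_plus: "v \<le> Im \<xi> \<Longrightarrow> integrable P (\<lambda>\<omega>. exp (\<i> * \<xi> * complex_of_real (S \<omega>)))"
  by (rule Bochner_Integration.integrable_bound[OF moments(1)])
    (auto simp: norm_exp intro!: AE_I2 mult_right_mono S_nonneg)

lemma integrable_minus: "Im \<xi> \<le> w \<Longrightarrow> integrable P (\<lambda>\<omega>. exp (\<i> * \<xi> * complex_of_real (Z \<omega>)))"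
  by (rule Bochner_Integration.integrable_bound[OF moments(2)])
    (auto simp: norm_exp intro!: AE_I2 mult_right_mono_neg Z_nonpos)

lemma line_bound_plus: "v \<le> y \<Longrightarrow> norm (\<phi>pp (Complex u y)) \<le> Cp * (1 + \<bar>u\<bar>) powr (- \<nu>p)"
proof -
  assume "v \<le> y"
  then have "norm (\<phi>pp (Complex u y)) \<le> Cp * (1 + norm (Complex u y)) powr (- \<nu>p)"
    by (intro bound_plus) simp
  also have "\<dots> \<le> Cp * (1 + \<bar>Re (Complex u y)\<bar>) powr (- \<nu>p)"
    using const by (intro mult_left_mono powr_decay_mono) auto
  finally show ?thesis by simp
qed

lemma line_bound_minus: "y \<le> w \<Longrightarrow> norm (\<phi>mm (Complex u y)) \<le> Cm * (1 + \<bar>u\<bar>) powr (- \<nu>m)"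
proof -
  assume "y \<le> w"
  then have "norm (\<phi>mm (Complex u y)) \<le> Cm * (1 + norm (Complex u y)) powr (- \<nu>m)"
    by (intro bound_minus) simp
  also have "\<dots> \<le> Cm * (1 + \<bar>Re (Complex u y)\<bar>) powr (- \<nu>m)"
    using const by (intro mult_left_mono powr_decay_mono) auto
  finally show ?thesis by simp
qed

lemma expectation_product:
  assumes "v \<le> Im \<xi>" "Im \<xi> \<le> w"
  shows "expectation (\<lambda>\<omega>. exp (\<i> * \<xi> * complex_of_real (S \<omega> + Z \<omega>))) = (ap + \<phi>pp \<xi>) * (am + \<phi>mm \<xi>)"
proof -
  have e: "(\<lambda>x. exp (\<i> * \<xi> * complex_of_real x)) \<in> borel_measurable borel"
    by (intro borel_measurable_continuous_onI continuous_intros)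
  have "indep_var borel ((\<lambda>x. exp (\<i> * \<xi> * complex_of_real x)) \<circ> S) borel ((\<lambda>x. exp (\<i> * \<xi> * complex_of_real x)) \<circ> Z)"
    by (rule indep_var_compose[OF indep e e])
  from indep_var_lebesgue_integral[OF this] integrable_plus[OF assms(1)] integrable_minus[OF assms(2)]
  have "expectation (\<lambda>\<omega>. exp (\<i> * \<xi> * complex_of_real (S \<omega>)) * exp (\<i> * \<xi> * complex_of_real (Z \<omega>))) = (ap + \<phi>pp \<xi>) * (am + \<phi>mm \<xi>)"
    using repr_plus[OF assms(1)] repr_minus[OF assms(2)] by (simp add: comp_def)
  then show ?thesis by (simp add: distrib_left exp_add)
qed

definition \<nu> :: real where "\<nu> = min \<nu>p \<nu>m"
definition C_prod :: real where "C_prod = \<bar>ap\<bar> * Cm + \<bar>am\<bar> * Cp + Cp * Cm"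

lemma product_decay:
  assumes y: "v \<le> y" "y \<le> w"
  shows "norm (expectation (\<lambda>\<omega>. exp (\<i> * Complex u y * complex_of_real (S \<omega> + Z \<omega>))) - complex_of_real (ap * am)) \<le> C_prod * (1 + \<bar>u\<bar>) powr (- \<nu>)"
proof -
  let ?q = "(1 + \<bar>u\<bar>) powr (- \<nu>)"
  let ?p = "\<phi>pp (Complex u y)" and ?m = "\<phi>mm (Complex u y)"
  have q1: "?q \<le> 1"
    using const powr_mono[of "- \<nu>" 0 "1 + \<bar>u\<bar>"] by (auto simp: \<nu>_def split: if_splits)
  have "norm ?p \<le> Cp * ?q"
    by (rule order_trans[OF line_bound_plus[OF y(1)]]) (use const in \<open>auto intro!: mult_left_mono powr_mono simp: \<nu>_def\<close>)
  moreover have "norm ?m \<le> Cm * ?q"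
    by (rule order_trans[OF line_bound_minus[OF y(2)]]) (use const in \<open>auto intro!: mult_left_mono powr_mono simp: \<nu>_def\<close>)
  moreover have "norm ?p * norm ?m \<le> Cp * Cm * ?q"
  proof -
    have "norm ?p * norm ?m \<le> (Cp * ?q) * (Cm * ?q)"
      using calculation const by (intro mult_mono) auto
    also have "\<dots> = Cp * Cm * ?q * ?q" by simp
    also have "\<dots> \<le> Cp * Cm * ?q * 1" using q1 const by (intro mult_left_mono) auto
    finally show ?thesis by simp
  qed
  ultimately have "\<bar>ap\<bar> * norm ?m + \<bar>am\<bar> * norm ?p + norm ?p * norm ?m \<le> \<bar>ap\<bar> * (Cm * ?q) + \<bar>am\<bar> * (Cp * ?q) + Cp * Cm * ?q"
    by (intro add_mono mult_left_mono) auto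
  also have "\<dots> = C_prod * ?q" by (simp add: C_prod_def algebra_simps)
  finally have r: "\<bar>ap\<bar> * norm ?m + \<bar>am\<bar> * norm ?p + norm ?p * norm ?m \<le> C_prod * ?q" .
  have e: "expectation (\<lambda>\<omega>. exp (\<i> * Complex u y * complex_of_real (S \<omega> + Z \<omega>))) = (ap + ?p) * (am + ?m)"
    by (rule expectation_product) (use y in auto)
  have "norm (expectation (\<lambda>\<omega>. exp (\<i> * Complex u y * complex_of_real (S \<omega> + Z \<omega>))) - complex_of_real (ap * am)) = norm (ap * ?m + am * ?p + ?p * ?m)"
    unfolding e by (simp add: algebra_simps)
  also have "\<dots> \<le> norm (ap * ?m) + norm (am * ?p) + norm (?p * ?m)"
    by (intro order_trans[OF norm_triangle_ineq] add_mono norm_triangle_ineq order_refl)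
  finally show ?thesis using r by (simp add: norm_mult)
qed

lemma real_line: "iexp (u * x) = exp (\<i> * Complex u 0 * complex_of_real x)"
  by (simp add: Complex_eq mult.assoc)

text \<open>On the real line the decaying part of a factor vanishes at infinity, which leaves an atom at 0 and no other.\<close>

lemma atom_of_char_decay:
  assumes [measurable]: "W \<in> borel_measurable P" and nu: "0 < n"
    and b: "\<And>u. norm (expectation (\<lambda>\<omega>. exp (\<i> * Complex u 0 * complex_of_real (W \<omega>))) - complex_of_real a) \<le> C * (1 + \<bar>u\<bar>) powr (- n)"
  shows "prob {\<omega>\<in>space P. W \<omega> = d} = (if d = 0 then a else 0)"
proof (rule measure_singleton_eq_char_limit[OF prob_space_axioms])
  show "((\<lambda>u. expectation (\<lambda>\<omega>. iexp (u * W \<omega>)) - complex_of_real a) \<longlongrightarrow> 0) at_infinity"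
  proof (rule tendsto_norm_zero_cancel, rule tendsto_sandwich[of "\<lambda>_. 0"])
    show "((\<lambda>u. C * (1 + \<bar>u\<bar>) powr (- n)) \<longlongrightarrow> 0) at_infinity"
      using tendsto_mult[OF tendsto_const powr_decay_tendsto_0[OF nu], of C] by simp
    show "\<forall>\<^sub>F u in at_infinity. norm (expectation (\<lambda>\<omega>. iexp (u * W \<omega>)) - complex_of_real a) \<le> C * (1 + \<bar>u\<bar>) powr (- n)"
      using b unfolding real_line by (intro always_eventually allI)
  qed auto
qed measurable

lemma atoms:
  "prob {\<omega>\<in>space P. S \<omega> = d} = (if d = 0 then ap else 0)"
  "prob {\<omega>\<in>space P. Z \<omega> = d} = (if d = 0 then am else 0)"
  "prob {\<omega>\<in>space P. S \<omega> + Z \<omega> = d} = (if d = 0 then ap * am else 0)"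
proof -
  show "prob {\<omega>\<in>space P. S \<omega> = d} = (if d = 0 then ap else 0)"
    by (rule atom_of_char_decay[OF measurable_SZ(1) const(1)]) (use v_neg repr_plus line_bound_plus[of 0] in auto)
  show "prob {\<omega>\<in>space P. Z \<omega> = d} = (if d = 0 then am else 0)"
    by (rule atom_of_char_decay[OF measurable_SZ(2) const(2)]) (use w_pos repr_minus line_bound_minus[of 0] in auto)
  have n: "0 < \<nu>" using const by (simp add: \<nu>_def)
  show "prob {\<omega>\<in>space P. S \<omega> + Z \<omega> = d} = (if d = 0 then ap * am else 0)"
    by (rule atom_of_char_decay[OF _ n product_decay]) (use w_pos v_neg in auto)
qed

text \<open>The decaying parts of the factors are the transforms of the laws with the atom at 0 removed.\<close>

lemma off_zero_plus:
  assumes "v \<le> Im \<xi>"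
  shows "\<phi>pp \<xi> = expectation (\<lambda>\<omega>. of_bool (S \<omega> \<noteq> 0) * exp (\<i> * \<xi> * complex_of_real (S \<omega>)))"
  using expectation_exp_off_zero[OF measurable_SZ(1) integrable_plus[OF assms]] repr_plus[OF assms] atoms(1)[of 0] by simp

lemma off_zero_minus:
  assumes "Im \<xi> \<le> w"
  shows "\<phi>mm \<xi> = expectation (\<lambda>\<omega>. of_bool (Z \<omega> \<noteq> 0) * exp (\<i> * \<xi> * complex_of_real (Z \<omega>)))"
  using expectation_exp_off_zero[OF measurable_SZ(2) integrable_minus[OF assms]] repr_minus[OF assms] atoms(2)[of 0] by simp

lemma measurable_plus_line[measurable]: "(\<lambda>u. \<phi>pp (Complex u v)) \<in> borel_measurable borel"
proof -
  have "(\<lambda>u. \<phi>pp (Complex u v)) = (\<lambda>u. expectation (\<lambda>\<omega>. of_bool (S \<omega> \<noteq> 0) * exp (\<i> * Complex u v * complex_of_real (S \<omega>))))"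
    using off_zero_plus by auto
  also have "\<dots> \<in> borel_measurable borel" unfolding complex_line by measurable
  finally show ?thesis .
qed

lemma measurable_minus_line[measurable]: "(\<lambda>u. \<phi>mm (Complex u w)) \<in> borel_measurable borel"
proof -
  have "(\<lambda>u. \<phi>mm (Complex u w)) = (\<lambda>u. expectation (\<lambda>\<omega>. of_bool (Z \<omega> \<noteq> 0) * exp (\<i> * Complex u w * complex_of_real (Z \<omega>))))"
    using off_zero_minus by auto
  also have "\<dots> \<in> borel_measurable borel" unfolding complex_line by measurable
  finally show ?thesis .
qed

context
  fixes \<beta> x1 x2 :: real
  assumes beta: "1 < \<beta>" and v_beta: "v < - \<beta>" and x: "x1 \<le> x2" "0 \<le> x2"
begin

text \<open>As a function of \<open>S\<close> the gain is discontinuous at most at \<open>d = x2 - x1\<close> and \<open>d - z\<close>, which carry no mass unless they are 0; the atom at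
  0 has been removed. It does not contribute to the mean either, since the gain at excess 0 is 0.\<close>

lemma supremum_inversion:
  shows "integrable lborel (\<lambda>u. \<phi>pp (Complex u v) * (exp (- (\<i> * Complex u v * complex_of_real (x2 - x1))) * gain_transform \<beta> x2 (\<i> * Complex u v) z))" (is ?int)
    and "(LINT u|lborel. \<phi>pp (Complex u v) * (exp (- (\<i> * Complex u v * complex_of_real (x2 - x1))) * gain_transform \<beta> x2 (\<i> * Complex u v) z))
      = 2 * pi * complex_of_real (expectation (\<lambda>\<omega>. indicator {x2 - x1..} (S \<omega>) * lookback_gain \<beta> x2 (S \<omega> - (x2 - x1)) z))"
proof -
  define d where "d = x2 - x1"
  have d0: "0 \<le> d" using x by (simp add: d_def)
  let ?p = "\<lambda>u. \<i> * Complex u v"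
  have p: "\<beta> < Re (?p u)" for u using v_beta by simp
  define M where "M = 6 * exp (\<beta> * x2) * (1 + 1 / (- v - \<beta>))"
  have K: "norm (gain_transform \<beta> x2 (?p u) z) \<le> M / (1 + \<bar>u\<bar>)" for u
    using gain_transform_bound[OF beta x(2) p, of u z] by (simp add: M_def)
  have M0: "0 \<le> M" unfolding M_def using v_beta by simp
  have em: "(\<lambda>u. exp (- (\<i> * Complex u v * complex_of_real d))) \<in> borel_measurable borel"
    unfolding Complex_eq by (intro borel_measurable_continuous_onI continuous_intros)
  have gm[measurable]: "(\<lambda>u. gain_transform \<beta> x2 (?p u) z) \<in> borel_measurable borel"
    using measurable_compose[OF _ measurable_gain_transform_line, of "\<lambda>u. (u, z)" borel] by simp
  have ne: "norm (exp (- (\<i> * Complex u v * complex_of_real d))) = exp (v * d)" for u by (simp add: norm_exp)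
  have int: "integrable lborel (\<lambda>u. \<phi>pp (Complex u v) * (exp (- (\<i> * Complex u v * complex_of_real d)) * gain_transform \<beta> x2 (?p u) z))"
  proof (rule integrable_decay[OF const(1)])
    fix u
    have "norm (\<phi>pp (Complex u v) * (exp (- (\<i> * Complex u v * complex_of_real d)) * gain_transform \<beta> x2 (?p u) z))
       \<le> (Cp * (1 + \<bar>u\<bar>) powr (- \<nu>p)) * (exp (v * d) * (M / (1 + \<bar>u\<bar>)))"
      unfolding norm_mult ne by (intro mult_mono line_bound_plus K order_refl) (use const in auto)
    then show "norm (\<phi>pp (Complex u v) * (exp (- (\<i> * Complex u v * complex_of_real d)) * gain_transform \<beta> x2 (?p u) z))
       \<le> (Cp * exp (v * d) * M) * (1 + \<bar>u\<bar>) powr (- \<nu>p) / (1 + \<bar>u\<bar>)"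
      by (simp add: mult_ac)
  next
    show "(\<lambda>u. \<phi>pp (Complex u v) * (exp (- (\<i> * Complex u v * complex_of_real d)) * gain_transform \<beta> x2 (?p u) z)) \<in> borel_measurable borel"
      by (intro borel_measurable_times em gm measurable_plus_line)
  qed
  then show ?int unfolding d_def .
  define g where "g s = complex_of_real (indicator {d..} s * lookback_gain \<beta> x2 (s - d) z)" for s
  have gb: "norm (complex_of_real (exp (v * s)) * g s) \<le> exp (\<beta> * (x2 - d)) * (indicator {d..} s * exp (- (- v - \<beta>) * s))" for s
  proof (cases "d \<le> s")
    case True
    have "\<bar>lookback_gain \<beta> x2 (s - d) z\<bar> \<le> exp (\<beta> * (x2 + (s - d)))"
      by (rule lookback_gain_bound) (use beta True in auto)
    then have "exp (v * s) * \<bar>lookback_gain \<beta> x2 (s - d) z\<bar> \<le> exp (v * s) * exp (\<beta> * (x2 + (s - d)))" by (intro mult_left_mono) auto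
    also have "\<dots> = exp (\<beta> * (x2 - d)) * exp (- (- v - \<beta>) * s)" by (simp add: mult_exp_exp algebra_simps)
    finally show ?thesis using True by (simp add: g_def norm_mult)
  qed (simp add: g_def)
  have "(LINT u|lborel. \<phi>pp (Complex u v) * (exp (- (\<i> * Complex u v * complex_of_real d)) * gain_transform \<beta> x2 (?p u) z))
     = 2 * pi * (LINT \<omega>|P. of_bool (S \<omega> \<noteq> 0) * g (S \<omega>))"
  proof (rule line_inversion[OF sigma_finite_measure_axioms measurable_SZ(1) _ _ _ _ _ _ int])
    show "integrable P (\<lambda>\<omega>. of_bool (S \<omega> \<noteq> 0) * complex_of_real (exp (- v * S \<omega>)))"
      by (rule Bochner_Integration.integrable_bound[OF moments(1)]) (auto intro!: AE_I2)
    have gmeas: "g \<in> borel_measurable borel" unfolding g_def by measurable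
    show "integrable lborel (\<lambda>s. complex_of_real (exp (v * s)) * g s)"
    proof (rule Bochner_Integration.integrable_bound)
      show "integrable lborel (\<lambda>s. exp (\<beta> * (x2 - d)) * (indicator {d..} s * exp (- (- v - \<beta>) * s)))"
        by (intro integrable_mult_right integrable_exp_atLeast) (use v_beta in simp)
    qed (use gb gmeas in \<open>auto intro!: AE_I2 simp: abs_mult\<close>)
    show "norm (complex_of_real (exp (v * s)) * g s) \<le> exp (\<beta> * (x2 - d))" for s
    proof (rule order_trans[OF gb])
      have "indicator {d..} s * exp (- (- v - \<beta>) * s) \<le> 1"
      proof (cases "d \<le> s")
        case True
        then have "- (- v - \<beta>) * s \<le> 0" using v_beta d0 by (intro mult_nonpos_nonneg) auto
        then show ?thesis by (simp add: indicator_def)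
      qed simp
      then show "exp (\<beta> * (x2 - d)) * (indicator {d..} s * exp (- (- v - \<beta>) * s)) \<le> exp (\<beta> * (x2 - d))"
        by (intro mult_left_le) auto
    qed
    have na: "AE \<omega> in P. S \<omega> \<noteq> a \<or> a = 0" for a
    proof (cases "a = 0")
      case False
      then have "prob {\<omega>\<in>space P. S \<omega> = a} = 0" unfolding atoms by simp
      then have "AE \<omega> in P. \<omega> \<notin> {\<omega>\<in>space P. S \<omega> = a}" by (subst (asm) prob_eq_0) auto
      with AE_space show ?thesis by eventually_elim auto
    qed simp
    show "AE \<omega> in P. of_bool (S \<omega> \<noteq> 0) \<noteq> (0::complex) \<longrightarrow> isCont g (S \<omega>)"
      using na[of d] na[of "d - z"]
    proof eventually_elim
      case (elim \<omega>)
      show ?case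
      proof
        assume "of_bool (S \<omega> \<noteq> 0) \<noteq> (0::complex)"
        then have ne: "S \<omega> \<noteq> d" "S \<omega> \<noteq> d - z" using elim by auto
        show "isCont g (S \<omega>)"
        proof (cases "S \<omega> < d")
          case True
          then have "\<forall>\<^sub>F s in nhds (S \<omega>). g s = 0"
            using eventually_nhds_in_open[of "{..<d}" "S \<omega>"] by (auto elim!: eventually_mono simp: g_def)
          from isCont_cong[OF this] show ?thesis by simp
        next
          case False
          then have gt: "d < S \<omega>" using ne by simp
          then have ev: "\<forall>\<^sub>F s in nhds (S \<omega>). g s = complex_of_real (lookback_gain \<beta> x2 (s - d) z)"
            using eventually_nhds_in_open[of "{d<..}" "S \<omega>"] by (auto elim!: eventually_mono simp: g_def)
          show ?thesis
          proof (cases "z = 0")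
            case True
            have "\<forall>\<^sub>F s in nhds (S \<omega>). complex_of_real (lookback_gain \<beta> x2 (s - d) z) = complex_of_real (max (exp (\<beta> * (x2 + (s - d))) - exp (x2 + (s - d))) 0)"
              using eventually_nhds_in_open[of "{d<..}" "S \<omega>"] gt True
              by (auto elim!: eventually_mono simp: lookback_gain_def exchange_payoff_def)
            from isCont_cong[OF this] isCont_cong[OF ev] show ?thesis by (auto intro!: continuous_intros)
          next
            case False
            have "isCont (\<lambda>s. complex_of_real (lookback_gain \<beta> x2 (s - d) z)) (S \<omega>)"
              unfolding lookback_gain_def using ne False by (intro continuous_intros isCont_payoff) auto
            with isCont_cong[OF ev] show ?thesis by simp
          qed
        qed
      qed
    qed
    show "\<phi>pp (Complex u v) = (LINT \<omega>|P. of_bool (S \<omega> \<noteq> 0) * exp (\<i> * Complex u v * complex_of_real (S \<omega>)))" for u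
      by (rule off_zero_plus) simp
    show "exp (- (\<i> * Complex u v * complex_of_real d)) * gain_transform \<beta> x2 (?p u) z = (LINT s|lborel. exp (- (\<i> * Complex u v * complex_of_real s)) * g s)" for u
    proof -
      have "(LINT s|lborel. exp (- (\<i> * Complex u v * complex_of_real s)) * g s)
         = \<bar>1\<bar> *\<^sub>R (LINT y|lborel. exp (- (\<i> * Complex u v * complex_of_real (d + 1 * y))) * g (d + 1 * y))"
        by (rule lborel_integral_real_affine) simp
      also have "\<dots> = (LINT y|lborel. exp (- (\<i> * Complex u v * complex_of_real d)) * (indicator {0..} y *\<^sub>R (exp (- (?p u * complex_of_real y)) * lookback_gain \<beta> x2 y z)))"
        by (simp, intro Bochner_Integration.integral_cong)
          (auto simp: g_def indicator_def distrib_left exp_add[symmetric] mult.assoc[symmetric] exp_diff exp_minus divide_inverse)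
      finally show ?thesis unfolding gain_transform_def integral_mult_right_zero by (rule sym)
    qed
  qed
  also have "(LINT \<omega>|P. of_bool (S \<omega> \<noteq> 0) * g (S \<omega>)) = (LINT \<omega>|P. complex_of_real (indicator {d..} (S \<omega>) * lookback_gain \<beta> x2 (S \<omega> - d) z))"
  proof (intro Bochner_Integration.integral_cong refl)
    fix \<omega> assume "\<omega> \<in> space P"
    show "of_bool (S \<omega> \<noteq> 0) * g (S \<omega>) = complex_of_real (indicator {d..} (S \<omega>) * lookback_gain \<beta> x2 (S \<omega> - d) z)"
      using d0 by (auto simp: g_def lookback_gain_def indicator_def)
  qed
  finally show "(LINT u|lborel. \<phi>pp (Complex u v) * (exp (- (\<i> * Complex u v * complex_of_real (x2 - x1))) * gain_transform \<beta> x2 (\<i> * Complex u v) z))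
      = 2 * pi * complex_of_real (expectation (\<lambda>\<omega>. indicator {x2 - x1..} (S \<omega>) * lookback_gain \<beta> x2 (S \<omega> - (x2 - x1)) z))"
    unfolding d_def by (simp only: integral_complex_of_real)
qed

text \<open>The function to be inverted is \<open>gain_transform\<close>, which is continuous off 0 and vanishes on the positive half-line.\<close>

lemma infimum_inversion:
  fixes p :: complex
  assumes p: "\<beta> < Re p"
  defines "B \<equiv> \<lambda>u. 1 / (p - \<i> * Complex u w) * (exp (\<beta> * x2) / (p - \<beta>)
        + \<beta> * exp ((1 + \<i> * Complex u w * (1 - 1 / \<beta>)) * x2) * (1 - \<i> * Complex u w / \<beta>)
          / ((\<beta> - \<i> * Complex u w) * (- (\<i> * Complex u w)) * (p - 1 - \<i> * Complex u w * (1 - 1 / \<beta>)))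
        - exp x2 * (1 - \<i> * Complex u w) / ((- (\<i> * Complex u w)) * (p - 1)))"
  shows "integrable lborel (\<lambda>u. \<phi>mm (Complex u w) * B u)"
    and "(LINT u|lborel. \<phi>mm (Complex u w) * B u) = 2 * pi * expectation (\<lambda>\<omega>. of_bool (Z \<omega> \<noteq> 0) * gain_transform \<beta> x2 p (Z \<omega>))"
proof -
  let ?s = "\<lambda>u. \<i> * Complex u w"
  have s: "Re (?s u) < 0" for u using w_pos by simp
  have BK: "B u = (LINT z|lborel. exp (- (?s u * complex_of_real z)) * gain_transform \<beta> x2 p z)" for u
    unfolding B_def by (rule gain_transform_fourier[OF beta x(2) p s, symmetric])
  have Bm: "B \<in> borel_measurable borel"
  proof -
    note [measurable] = measurable_gain_transform[OF beta x(2) p]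
    have "(\<lambda>u. LINT z|lborel. exp (- (?s u * complex_of_real z)) * gain_transform \<beta> x2 p z) \<in> borel_measurable borel"
      unfolding complex_line by measurable
    then show ?thesis unfolding BK[abs_def] .
  qed
  define N where "N = (1 + 1 / (Re p + w)) * (1 + \<bar>Im p\<bar>) * (exp (\<beta> * x2) / norm (p - \<beta>) + exp x2 / (w * (Re p - 1)) + exp x2 * (1 / w + 1) / norm (p - 1))"
  have Bb: "norm (B u) \<le> N / (1 + \<bar>u\<bar>)" for u
    using gain_transform_fourier_bound[OF beta x(2) p s, of u w] unfolding B_def N_def by simp
  show int: "integrable lborel (\<lambda>u. \<phi>mm (Complex u w) * B u)"
  proof (rule integrable_decay[OF const(2)])
    fix u
    have "norm (\<phi>mm (Complex u w) * B u) \<le> (Cm * (1 + \<bar>u\<bar>) powr (- \<nu>m)) * (N / (1 + \<bar>u\<bar>))"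
      unfolding norm_mult by (intro mult_mono line_bound_minus Bb order_refl) (use const in auto)
    then show "norm (\<phi>mm (Complex u w) * B u) \<le> (Cm * N) * (1 + \<bar>u\<bar>) powr (- \<nu>m) / (1 + \<bar>u\<bar>)"
      by (simp add: mult_ac)
  next
    show "(\<lambda>u. \<phi>mm (Complex u w) * B u) \<in> borel_measurable borel"
      by (intro borel_measurable_times Bm measurable_minus_line)
  qed
  define M where "M = 6 * exp (\<beta> * x2) * (1 + 1 / (Re p - \<beta>)) / (1 + \<bar>Im p\<bar>)"
  have K: "norm (gain_transform \<beta> x2 p z) \<le> M" for z
    using gain_transform_bound[OF beta x(2) p] unfolding M_def .
  have M0: "0 \<le> M" using order_trans[OF norm_ge_zero K] .
  have gb: "norm (complex_of_real (exp (w * z)) * gain_transform \<beta> x2 p z) \<le> M * (indicator {..0} z * exp (w * z))" for z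
  proof (cases "z \<le> 0")
    case True
    then show ?thesis using mult_right_mono[OF K, of "exp (w * z)" z] by (simp add: norm_mult mult.commute)
  next
    case False
    then show ?thesis using gain_transform_pos[OF beta x(2) p, of z] by simp
  qed
  show "(LINT u|lborel. \<phi>mm (Complex u w) * B u) = 2 * pi * expectation (\<lambda>\<omega>. of_bool (Z \<omega> \<noteq> 0) * gain_transform \<beta> x2 p (Z \<omega>))"
  proof (rule line_inversion[OF sigma_finite_measure_axioms measurable_SZ(2) _ _ _ _ _ BK int])
    show "integrable P (\<lambda>\<omega>. of_bool (Z \<omega> \<noteq> 0) * complex_of_real (exp (- w * Z \<omega>)))"
      by (rule Bochner_Integration.integrable_bound[OF moments(2)]) (auto intro!: AE_I2)
    show "integrable lborel (\<lambda>z. complex_of_real (exp (w * z)) * gain_transform \<beta> x2 p z)"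
    proof (rule Bochner_Integration.integrable_bound)
      show "integrable lborel (\<lambda>z. M * (indicator {..0} z * exp (w * z)))"
        by (intro integrable_mult_right integrable_exp_atMost w_pos)
      note [measurable] = measurable_gain_transform[OF beta x(2) p]
      show "(\<lambda>z. complex_of_real (exp (w * z)) * gain_transform \<beta> x2 p z) \<in> borel_measurable lborel" by measurable
      show "AE z in lborel. norm (complex_of_real (exp (w * z)) * gain_transform \<beta> x2 p z) \<le> norm (M * (indicator {..0} z * exp (w * z)))"
        using gb M0 by (intro AE_I2) (auto simp: abs_mult)
    qed
    show "norm (complex_of_real (exp (w * z)) * gain_transform \<beta> x2 p z) \<le> M" for z
    proof (rule order_trans[OF gb])
      show "M * (indicator {..0} z * exp (w * z)) \<le> M"
        using M0 w_pos by (intro mult_left_le) (auto simp: indicator_def mult_nonneg_nonpos)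
    qed
    show "AE \<omega> in P. of_bool (Z \<omega> \<noteq> 0) \<noteq> (0::complex) \<longrightarrow> isCont (gain_transform \<beta> x2 p) (Z \<omega>)"
      using isCont_gain_transform[OF beta x(2) p] by (intro AE_I2) auto
    show "\<phi>mm (Complex u w) = (LINT \<omega>|P. of_bool (Z \<omega> \<noteq> 0) * exp (\<i> * Complex u w * complex_of_real (Z \<omega>)))" for u
      by (rule off_zero_minus) simp
  qed
qed

lemma expectation_gain_transform:
  fixes p :: complex
  assumes p: "\<beta> < Re p"
  shows "integrable P (\<lambda>\<omega>. gain_transform \<beta> x2 p (Z \<omega>))"
    and "expectation (\<lambda>\<omega>. gain_transform \<beta> x2 p (Z \<omega>)) =
      am * gain_transform \<beta> x2 p 0 + expectation (\<lambda>\<omega>. of_bool (Z \<omega> \<noteq> 0) * gain_transform \<beta> x2 p (Z \<omega>))"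
proof -
  note [measurable] = measurable_gain_transform[OF beta x(2) p]
  show i: "integrable P (\<lambda>\<omega>. gain_transform \<beta> x2 p (Z \<omega>))"
    by (rule integrable_const_bound[where B="6 * exp (\<beta> * x2) * (1 + 1 / (Re p - \<beta>)) / (1 + \<bar>Im p\<bar>)"])
      (use gain_transform_bound[OF beta x(2) p] in auto)
  have "expectation (\<lambda>\<omega>. gain_transform \<beta> x2 p (Z \<omega>)) =
     expectation (\<lambda>\<omega>. complex_of_real (indicator {\<omega>\<in>space P. Z \<omega> = 0} \<omega>) * gain_transform \<beta> x2 p 0 + of_bool (Z \<omega> \<noteq> 0) * gain_transform \<beta> x2 p (Z \<omega>))"
    by (intro Bochner_Integration.integral_cong) (auto simp: indicator_def)
  also have "\<dots> = expectation (\<lambda>\<omega>. complex_of_real (indicator {\<omega>\<in>space P. Z \<omega> = 0} \<omega>) * gain_transform \<beta> x2 p 0)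
      + expectation (\<lambda>\<omega>. of_bool (Z \<omega> \<noteq> 0) * gain_transform \<beta> x2 p (Z \<omega>))"
  proof (rule Bochner_Integration.integral_add)
    show "integrable P (\<lambda>\<omega>. complex_of_real (indicator {\<omega>\<in>space P. Z \<omega> = 0} \<omega>) * gain_transform \<beta> x2 p 0)"
      by (rule integrable_const_bound[where B="norm (gain_transform \<beta> x2 p 0)"]) (auto simp: indicator_def)
    show "integrable P (\<lambda>\<omega>. of_bool (Z \<omega> \<noteq> 0) * gain_transform \<beta> x2 p (Z \<omega>))"
      by (rule Bochner_Integration.integrable_bound[OF i]) (auto intro!: AE_I2)
  qed
  also have "expectation (\<lambda>\<omega>. complex_of_real (indicator {\<omega>\<in>space P. Z \<omega> = 0} \<omega>) * gain_transform \<beta> x2 p 0) = am * gain_transform \<beta> x2 p 0"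
    using atoms(2)[of 0] by simp
  finally show "expectation (\<lambda>\<omega>. gain_transform \<beta> x2 p (Z \<omega>)) =
      am * gain_transform \<beta> x2 p 0 + expectation (\<lambda>\<omega>. of_bool (Z \<omega> \<noteq> 0) * gain_transform \<beta> x2 p (Z \<omega>))" .
qed

text \<open>Independence allows to fix \<open>Z\<close> and to invert in \<open>S\<close>. The bound on \<open>gain_transform\<close> is uniform in \<open>z\<close>, so the average over \<open>Z\<close> may
  be taken inside the line integral.\<close>

lemma lookback_gain_inversion:
  shows "integrable P (\<lambda>\<omega>. indicator {x2 - x1..} (S \<omega>) * lookback_gain \<beta> x2 (S \<omega> - (x2 - x1)) (Z \<omega>))"
    and "2 * pi * complex_of_real (expectation (\<lambda>\<omega>. indicator {x2 - x1..} (S \<omega>) * lookback_gain \<beta> x2 (S \<omega> - (x2 - x1)) (Z \<omega>)))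
      = (LINT u|lborel. \<phi>pp (Complex u v) * (exp (- (\<i> * Complex u v * complex_of_real (x2 - x1)))
          * expectation (\<lambda>\<omega>. gain_transform \<beta> x2 (\<i> * Complex u v) (Z \<omega>))))"
proof -
  define d where "d = x2 - x1"
  have d0: "0 \<le> d" using x by (simp add: d_def)
  define \<Psi> where "\<Psi> q = indicator {d..} (fst q) * lookback_gain \<beta> x2 (fst q - d) (snd q)" for q :: "real \<times> real"
  have Psim[measurable]: "\<Psi> \<in> borel_measurable (borel \<Otimes>\<^sub>M borel)" unfolding \<Psi>_def by measurable
  \<comment> \<open>The gain grows like \<open>exp (\<beta> * s)\<close>; this needs the exponential moment of order \<open>- v > \<beta>\<close> of \<open>S\<close>.\<close>
  have Psib: "\<bar>\<Psi> (s, z)\<bar> \<le> exp (\<beta> * (x2 - d)) * exp (- v * s)" if s: "0 \<le> s" for s z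
  proof (cases "d \<le> s")
    case True
    have "\<bar>lookback_gain \<beta> x2 (s - d) z\<bar> \<le> exp (\<beta> * (x2 + (s - d)))"
      by (rule lookback_gain_bound) (use beta True in auto)
    also have "\<dots> = exp (\<beta> * (x2 - d)) * exp (\<beta> * s)" by (simp add: mult_exp_exp algebra_simps)
    also have "\<dots> \<le> exp (\<beta> * (x2 - d)) * exp (- v * s)"
      using v_beta s mult_right_mono[of \<beta> "- v" s] by (intro mult_left_mono) auto
    finally show ?thesis using True by (simp add: \<Psi>_def)
  qed (simp add: \<Psi>_def)
  let ?nS = "distr P borel S" and ?nZ = "distr P borel Z"
  interpret nS: prob_space ?nS by (rule prob_space_distr) measurable
  interpret nZ: prob_space ?nZ by (rule prob_space_distr) measurable
  interpret SZ: pair_sigma_finite ?nS ?nZ ..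
  interpret PL: pair_sigma_finite P lborel ..
  have joint: "?nS \<Otimes>\<^sub>M ?nZ = distr P (borel \<Otimes>\<^sub>M borel) (\<lambda>\<omega>. (S \<omega>, Z \<omega>))"
    using indep unfolding indep_var_distribution_eq by auto
  have iP: "integrable P (\<lambda>\<omega>. \<Psi> (S \<omega>, Z \<omega>))"
  proof (rule Bochner_Integration.integrable_bound)
    show "integrable P (\<lambda>\<omega>. exp (\<beta> * (x2 - d)) * exp (- v * S \<omega>))" by (intro integrable_mult_right moments)
    show "AE \<omega> in P. norm (\<Psi> (S \<omega>, Z \<omega>)) \<le> norm (exp (\<beta> * (x2 - d)) * exp (- v * S \<omega>))"
      using Psib S_nonneg by (intro AE_I2) (auto simp del: mult_minus_left)
  qed measurable
  then show "integrable P (\<lambda>\<omega>. indicator {x2 - x1..} (S \<omega>) * lookback_gain \<beta> x2 (S \<omega> - (x2 - x1)) (Z \<omega>))"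
    unfolding \<Psi>_def d_def by simp
  have ipair: "integrable (?nS \<Otimes>\<^sub>M ?nZ) (\<lambda>(s, z). \<Psi> (s, z))"
    unfolding joint by (subst integrable_distr_eq) (use iP in auto)
  define J where "J z = expectation (\<lambda>\<omega>. indicator {d..} (S \<omega>) * lookback_gain \<beta> x2 (S \<omega> - d) z)" for z
  define F where "F \<omega> u = \<phi>pp (Complex u v) * (exp (- (\<i> * Complex u v * complex_of_real d)) * gain_transform \<beta> x2 (\<i> * Complex u v) (Z \<omega>))" for \<omega> u
  have Jm: "J \<in> borel_measurable borel" unfolding J_def by measurable
  have "expectation (\<lambda>\<omega>. \<Psi> (S \<omega>, Z \<omega>)) = (LINT q|distr P (borel \<Otimes>\<^sub>M borel) (\<lambda>\<omega>. (S \<omega>, Z \<omega>)). \<Psi> q)"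
    by (subst integral_distr) auto
  also have "\<dots> = (LINT z|?nZ. LINT s|?nS. \<Psi> (s, z))"
    using SZ.integral_snd[OF ipair] unfolding joint by simp
  also have "\<dots> = (LINT z|?nZ. J z)"
    unfolding J_def \<Psi>_def by (subst integral_distr) auto
  also have "\<dots> = expectation (\<lambda>\<omega>. J (Z \<omega>))" by (rule integral_distr) (use Jm in auto)
  finally have E1: "expectation (\<lambda>\<omega>. \<Psi> (S \<omega>, Z \<omega>)) = expectation (\<lambda>\<omega>. J (Z \<omega>))" .
  have F: "(LINT u|lborel. F \<omega> u) = 2 * pi * complex_of_real (J (Z \<omega>))" for \<omega>
    unfolding F_def J_def d_def by (rule supremum_inversion(2))
  define M where "M = 6 * exp (\<beta> * x2) * (1 + 1 / (- v - \<beta>))"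
  have M0: "0 \<le> M" unfolding M_def using v_beta by simp
  define b where "b u = Cp * exp (v * d) * M * (1 + \<bar>u\<bar>) powr (- \<nu>p - 1)" for u
  have Fb: "norm (F \<omega> u) \<le> b u" for \<omega> u
  proof -
    have p: "\<beta> < Re (\<i> * Complex u v)" using v_beta by simp
    have K: "norm (gain_transform \<beta> x2 (\<i> * Complex u v) (Z \<omega>)) \<le> M / (1 + \<bar>u\<bar>)"
      using gain_transform_bound[OF beta x(2) p, of "Z \<omega>"] by (simp add: M_def)
    have ne: "norm (exp (- (\<i> * Complex u v * complex_of_real d))) = exp (v * d)" by (simp add: norm_exp)
    have "norm (F \<omega> u) \<le> (Cp * (1 + \<bar>u\<bar>) powr (- \<nu>p)) * (exp (v * d) * (M / (1 + \<bar>u\<bar>)))"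
      unfolding F_def norm_mult ne by (intro mult_mono line_bound_plus K order_refl) (use const in auto)
    also have "\<dots> = b u"
      using powr_diff[of "1 + \<bar>u\<bar>" "- \<nu>p" 1] unfolding b_def by simp
    finally show ?thesis .
  qed
  have em: "(\<lambda>u. exp (- (\<i> * Complex u v * complex_of_real d))) \<in> borel_measurable borel"
    unfolding Complex_eq by (intro borel_measurable_continuous_onI continuous_intros)
  have Fm: "(\<lambda>(\<omega>, u). F \<omega> u) \<in> borel_measurable (P \<Otimes>\<^sub>M lborel)"
  proof -
    have sn: "snd \<in> measurable (P \<Otimes>\<^sub>M lborel) borel" using measurable_snd[of P lborel] by simp
    have "(\<lambda>q. (snd q, Z (fst q))) \<in> measurable (P \<Otimes>\<^sub>M lborel) (borel \<Otimes>\<^sub>M borel)"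
      by (intro measurable_Pair sn measurable_compose[OF measurable_fst measurable_SZ(2)])
    from measurable_compose[OF this measurable_gain_transform_line]
    have "(\<lambda>q. gain_transform \<beta> x2 (\<i> * Complex (snd q) v) (Z (fst q))) \<in> borel_measurable (P \<Otimes>\<^sub>M lborel)" by simp
    then have "(\<lambda>q. F (fst q) (snd q)) \<in> borel_measurable (P \<Otimes>\<^sub>M lborel)"
      unfolding F_def
      by (intro borel_measurable_times measurable_compose[OF sn em] measurable_compose[OF sn measurable_plus_line])
    then show ?thesis by (simp add: case_prod_beta')
  qed
  have Fint: "integrable (P \<Otimes>\<^sub>M lborel) (\<lambda>(\<omega>, u). F \<omega> u)"
  proof (rule Bochner_Integration.integrable_bound[OF _ Fm])
    have "integrable (P \<Otimes>\<^sub>M lborel) (\<lambda>q. (\<lambda>_. 1) (fst q) * complex_of_real (b (snd q)))"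
      by (rule integrable_mult_pair) (unfold_locales, auto simp: b_def intro!: integrable_of_real integrable_mult_right integrable_powr_decay const)
    then show "integrable (P \<Otimes>\<^sub>M lborel) (\<lambda>q. complex_of_real (b (snd q)))" by simp
    show "AE q in P \<Otimes>\<^sub>M lborel. norm (case q of (\<omega>, u) \<Rightarrow> F \<omega> u) \<le> norm (complex_of_real (b (snd q)))"
      using order_trans[OF Fb abs_ge_self] by (intro AE_I2) (auto split: prod.split)
  qed
  have "2 * pi * complex_of_real (expectation (\<lambda>\<omega>. \<Psi> (S \<omega>, Z \<omega>))) = expectation (\<lambda>\<omega>. 2 * pi * complex_of_real (J (Z \<omega>)))"
    unfolding E1 by simp
  also have "\<dots> = expectation (\<lambda>\<omega>. LINT u|lborel. F \<omega> u)" unfolding F ..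
  also have "\<dots> = (LINT u|lborel. expectation (\<lambda>\<omega>. F \<omega> u))"
    by (rule PL.Fubini_integral[OF Fint, symmetric])
  also have "\<dots> = (LINT u|lborel. \<phi>pp (Complex u v) * (exp (- (\<i> * Complex u v * complex_of_real d)) * expectation (\<lambda>\<omega>. gain_transform \<beta> x2 (\<i> * Complex u v) (Z \<omega>))))"
    unfolding F_def integral_mult_right_zero ..
  finally show "2 * pi * complex_of_real (expectation (\<lambda>\<omega>. indicator {x2 - x1..} (S \<omega>) * lookback_gain \<beta> x2 (S \<omega> - (x2 - x1)) (Z \<omega>)))
      = (LINT u|lborel. \<phi>pp (Complex u v) * (exp (- (\<i> * Complex u v * complex_of_real (x2 - x1)))
          * expectation (\<lambda>\<omega>. gain_transform \<beta> x2 (\<i> * Complex u v) (Z \<omega>))))"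
    unfolding \<Psi>_def d_def by simp
qed

end

end

section \<open>The formula\<close>

context wiener_hopf_pair begin

context
  fixes \<beta> x1 x2 :: real
  assumes beta: "1 < \<beta>" and v_beta: "v < - \<beta>" and x: "x1 \<le> x2" "0 \<le> x2"
begin

lemma Re_line_gt: "\<beta> < Re (\<i> * Complex u v)"
  using v_beta by simp

lemma I3_inner_integral:
  "line_integral w (\<lambda>\<xi>. \<phi>mm \<xi> / (\<i> * (Complex u v - \<xi>)) *
       (exp (\<beta> * x2) / (\<i> * Complex u v - \<beta>)
        + \<beta> * exp ((1 + \<i> * \<xi> * (1 - 1 / \<beta>)) * x2) * (1 - \<i> * \<xi> / \<beta>)
          / ((\<beta> - \<i> * \<xi>) * (- \<i> * \<xi>) * (\<i> * Complex u v - 1 - \<i> * \<xi> * (1 - 1 / \<beta>)))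
        - exp x2 * (1 - \<i> * \<xi>) / ((- \<i> * \<xi>) * (\<i> * Complex u v - 1))))
    = 2 * pi * expectation (\<lambda>\<omega>. of_bool (Z \<omega> \<noteq> 0) * gain_transform \<beta> x2 (\<i> * Complex u v) (Z \<omega>))"
  (is "line_integral w ?g = _")
proof -
  let ?p = "\<i> * Complex u v"
  note inf = infimum_inversion[OF beta v_beta x Re_line_gt[of u]]
  have int: "integrable lborel (\<lambda>r. ?g (Complex r w))"
    by (rule Bochner_Integration.integrable_cong[THEN iffD1, OF refl _ inf(1)]) (simp add: right_diff_distrib)
  have "(LINT r|lborel. ?g (Complex r w)) = 2 * pi * expectation (\<lambda>\<omega>. of_bool (Z \<omega> \<noteq> 0) * gain_transform \<beta> x2 ?p (Z \<omega>))"
    by (rule trans[OF Bochner_Integration.integral_cong[OF refl] inf(2)]) (simp add: right_diff_distrib)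
  then show ?thesis by (simp only: line_integral_eq[OF int])
qed

lemma integrable_outer:
  assumes T: "\<And>u. norm (T u) \<le> B / (1 + \<bar>u\<bar>)" and [measurable]: "T \<in> borel_measurable borel"
  shows "integrable lborel (\<lambda>u. \<phi>pp (Complex u v) * (exp (- (\<i> * Complex u v * complex_of_real (x2 - x1))) * T u))"
proof (rule integrable_decay[OF const(1)])
  have ne: "norm (exp (- (\<i> * Complex u v * complex_of_real (x2 - x1)))) = exp (v * (x2 - x1))" for u by (simp add: norm_exp)
  fix u
  have "norm (\<phi>pp (Complex u v) * (exp (- (\<i> * Complex u v * complex_of_real (x2 - x1))) * T u))
     \<le> (Cp * (1 + \<bar>u\<bar>) powr (- \<nu>p)) * (exp (v * (x2 - x1)) * (B / (1 + \<bar>u\<bar>)))"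
    unfolding norm_mult ne by (intro mult_mono line_bound_plus T order_refl) (use const in auto)
  then show "norm (\<phi>pp (Complex u v) * (exp (- (\<i> * Complex u v * complex_of_real (x2 - x1))) * T u))
     \<le> (Cp * exp (v * (x2 - x1)) * B) * (1 + \<bar>u\<bar>) powr (- \<nu>p) / (1 + \<bar>u\<bar>)"
    by (simp add: mult_ac)
next
  have "(\<lambda>u. exp (- (\<i> * Complex u v * complex_of_real (x2 - x1)))) \<in> borel_measurable borel"
    unfolding Complex_eq by (intro borel_measurable_continuous_onI continuous_intros)
  then show "(\<lambda>u. \<phi>pp (Complex u v) * (exp (- (\<i> * Complex u v * complex_of_real (x2 - x1))) * T u)) \<in> borel_measurable borel"
    by (rule borel_measurable_times[OF measurable_plus_line borel_measurable_times[OF _ assms(2)]])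
qed

text \<open>Splitting the average of \<open>gain_transform\<close> over \<open>Z\<close> at the atom gives \<open>I2\<close>; the rest is the inner integral of \<open>I3\<close>.\<close>

lemma lookback_gain_formula:
  "complex_of_real (expectation (\<lambda>\<omega>. indicator {x2 - x1..} (S \<omega>) * lookback_gain \<beta> x2 (S \<omega> - (x2 - x1)) (Z \<omega>)))
    = I2 am \<phi>pp \<beta> v x1 x2 + I3 \<phi>pp \<phi>mm \<beta> w v x1 x2"
proof -
  let ?p = "\<lambda>u. \<i> * Complex u v"
  let ?e = "\<lambda>u. exp (- (\<i> * Complex u v * complex_of_real (x2 - x1)))"
  define M where "M = 6 * exp (\<beta> * x2) * (1 + 1 / (- v - \<beta>))"
  have K: "norm (gain_transform \<beta> x2 (?p u) z) \<le> M / (1 + \<bar>u\<bar>)" for u z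
    using gain_transform_bound[OF beta x(2) Re_line_gt, of u z] by (simp add: M_def)
  have gz: "gain_transform \<beta> x2 (?p u) 0 = exp (\<beta> * x2) / (?p u - \<beta>) - exp x2 / (?p u - 1)" for u
    by (rule gain_transform_0[OF beta x(2) Re_line_gt])
  define T where "T u = expectation (\<lambda>\<omega>. of_bool (Z \<omega> \<noteq> 0) * gain_transform \<beta> x2 (?p u) (Z \<omega>))" for u
  have m0: "(\<lambda>u. gain_transform \<beta> x2 (?p u) 0) \<in> borel_measurable borel"
    using measurable_compose[OF _ measurable_gain_transform_line, of "\<lambda>u. (u, 0)" borel] by simp
  have Tm: "T \<in> borel_measurable borel"
  proof -
    have "(\<lambda>q. (fst q, Z (snd q))) \<in> measurable (borel \<Otimes>\<^sub>M P) (borel \<Otimes>\<^sub>M borel)" by measurable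
    from measurable_compose[OF this measurable_gain_transform_line]
    have [measurable]: "(\<lambda>q. gain_transform \<beta> x2 (?p (fst q)) (Z (snd q))) \<in> borel_measurable (borel \<Otimes>\<^sub>M P)" by simp
    have "(\<lambda>q. of_bool (Z (snd q) \<noteq> 0) * gain_transform \<beta> x2 (?p (fst q)) (Z (snd q))) \<in> borel_measurable (borel \<Otimes>\<^sub>M P)"
      by measurable
    then show ?thesis unfolding T_def
      by (intro borel_measurable_lebesgue_integral) (simp add: case_prod_beta')
  qed
  have Tb: "norm (T u) \<le> M / (1 + \<bar>u\<bar>)" for u
  proof -
    have B0: "0 \<le> M / (1 + \<bar>u\<bar>)" using order_trans[OF norm_ge_zero K] .
    have "norm (T u) \<le> expectation (\<lambda>\<omega>. norm (of_bool (Z \<omega> \<noteq> 0) * gain_transform \<beta> x2 (?p u) (Z \<omega>)))"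
      unfolding T_def by (rule integral_norm_bound)
    also have "\<dots> \<le> expectation (\<lambda>\<omega>. M / (1 + \<bar>u\<bar>))"
    proof (rule integral_mono_AE)
      note [measurable] = measurable_gain_transform[OF beta x(2) Re_line_gt[of u]]
      show "integrable P (\<lambda>\<omega>. norm (of_bool (Z \<omega> \<noteq> 0) * gain_transform \<beta> x2 (?p u) (Z \<omega>)))"
        by (rule integrable_const_bound[where B="M / (1 + \<bar>u\<bar>)"]) (use K B0 in \<open>auto simp: norm_mult\<close>)
    qed (use K B0 in \<open>auto simp: norm_mult\<close>)
    finally show ?thesis by (simp add: prob_space)
  qed
  have i0: "integrable lborel (\<lambda>u. \<phi>pp (Complex u v) * (?e u * gain_transform \<beta> x2 (?p u) 0))"
    by (rule integrable_outer[OF K m0])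
  have iT: "integrable lborel (\<lambda>u. \<phi>pp (Complex u v) * (?e u * T u))"
    by (rule integrable_outer[OF Tb Tm])
  have ee: "exp (\<i> * complex_of_real (x1 - x2) * Complex u v) = ?e u" for u
    by (simp add: algebra_simps)
  have ee': "exp (\<i> * (complex_of_real x1 - complex_of_real x2) * Complex u v) = ?e u" for u
    by (simp add: algebra_simps)
  have L2: "line_integral v (\<lambda>\<eta>. exp (\<i> * (x1 - x2) * \<eta>) * \<phi>pp \<eta> * (exp (\<beta> * x2) / (\<i> * \<eta> - \<beta>) - exp x2 / (\<i> * \<eta> - 1)))
     = (LINT u|lborel. \<phi>pp (Complex u v) * (?e u * gain_transform \<beta> x2 (?p u) 0))"
  proof -
    have eq: "exp (\<i> * (x1 - x2) * Complex u v) * \<phi>pp (Complex u v) * (exp (\<beta> * x2) / (\<i> * Complex u v - \<beta>) - exp x2 / (\<i> * Complex u v - 1))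
      = \<phi>pp (Complex u v) * (?e u * gain_transform \<beta> x2 (?p u) 0)" for u
      unfolding gz ee ee' by (simp only: mult_ac)
    show ?thesis by (subst line_integral_eq) (use i0 in \<open>simp_all only: eq\<close>)
  qed
  have L3: "line_integral v (\<lambda>\<eta>. exp (\<i> * (x1 - x2) * \<eta>) * \<phi>pp \<eta> *
     line_integral w (\<lambda>\<xi>. \<phi>mm \<xi> / (\<i> * (\<eta> - \<xi>)) *
       (exp (\<beta> * x2) / (\<i> * \<eta> - \<beta>)
        + \<beta> * exp ((1 + \<i> * \<xi> * (1 - 1 / \<beta>)) * x2) * (1 - \<i> * \<xi> / \<beta>)
          / ((\<beta> - \<i> * \<xi>) * (- \<i> * \<xi>) * (\<i> * \<eta> - 1 - \<i> * \<xi> * (1 - 1 / \<beta>)))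
        - exp x2 * (1 - \<i> * \<xi>) / ((- \<i> * \<xi>) * (\<i> * \<eta> - 1)))))
     = (LINT u|lborel. 2 * pi * (\<phi>pp (Complex u v) * (?e u * T u)))" (is "line_integral v ?h = _")
  proof -
    have eq: "?h (Complex u v) = 2 * pi * (\<phi>pp (Complex u v) * (?e u * T u))" for u
      unfolding I3_inner_integral T_def[symmetric] ee ee' by (simp only: mult_ac)
    show ?thesis by (subst line_integral_eq) (use integrable_mult_right[OF iT, of "2 * pi"] in \<open>simp_all only: eq\<close>)
  qed
  have "2 * pi * complex_of_real (expectation (\<lambda>\<omega>. indicator {x2 - x1..} (S \<omega>) * lookback_gain \<beta> x2 (S \<omega> - (x2 - x1)) (Z \<omega>)))
     = (LINT u|lborel. am * (\<phi>pp (Complex u v) * (?e u * gain_transform \<beta> x2 (?p u) 0)) + \<phi>pp (Complex u v) * (?e u * T u))"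
    unfolding lookback_gain_inversion(2)[OF beta v_beta x] expectation_gain_transform(2)[OF beta v_beta x Re_line_gt] T_def
    by (simp add: algebra_simps)
  also have "\<dots> = am * (LINT u|lborel. \<phi>pp (Complex u v) * (?e u * gain_transform \<beta> x2 (?p u) 0)) + (LINT u|lborel. \<phi>pp (Complex u v) * (?e u * T u))"
    by (subst Bochner_Integration.integral_add) (use i0 iT in auto)
  finally have "2 * pi * complex_of_real (expectation (\<lambda>\<omega>. indicator {x2 - x1..} (S \<omega>) * lookback_gain \<beta> x2 (S \<omega> - (x2 - x1)) (Z \<omega>)))
     = am * (LINT u|lborel. \<phi>pp (Complex u v) * (?e u * gain_transform \<beta> x2 (?p u) 0)) + (LINT u|lborel. \<phi>pp (Complex u v) * (?e u * T u))" .
  note total = this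
  have I2: "I2 am \<phi>pp \<beta> v x1 x2 = am / (2 * pi) * (LINT u|lborel. \<phi>pp (Complex u v) * (?e u * gain_transform \<beta> x2 (?p u) 0))"
    unfolding I2_def L2[symmetric] by (simp add: exp_of_real[symmetric])
  have I3: "I3 \<phi>pp \<phi>mm \<beta> w v x1 x2 = 1 / (2 * pi)\<^sup>2 * (LINT u|lborel. 2 * pi * (\<phi>pp (Complex u v) * (?e u * T u)))"
    unfolding I3_def L3[symmetric] by (simp add: exp_of_real[symmetric])
  have alg: "E = c / (2 * pi) * A + 1 / (2 * pi)\<^sup>2 * (2 * pi * B)" if "2 * pi * E = c * A + B" for A B E c :: complex
  proof -
    have "E = (2 * pi * E) / (2 * pi)" by simp
    also have "\<dots> = (c * A + B) / (2 * pi)" unfolding that ..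
    also have "\<dots> = c / (2 * pi) * A + 1 / (2 * pi)\<^sup>2 * (2 * pi * B)"
      by (simp add: add_divide_distrib power2_eq_square)
    finally show ?thesis .
  qed
  show ?thesis
    unfolding I2 I3 integral_mult_right_zero
    by (rule trans[OF alg[OF trans[OF _ total]]]) simp_all
qed

end

end

lemma I1_eq:
  assumes b: "1 < \<beta>"
    and psi: "\<And>u. \<Phi> u = complex_of_real q / (complex_of_real q + \<psi> (Complex u w))" and q: "0 < q"
    and lim: "((\<lambda>R. LINT u:{-R..R}|lborel. \<Phi> u * (exp (\<i> * complex_of_real (x1 - x2) * Complex u w) * recentred_transform \<beta> (\<i> * Complex u w) x2))
    \<longlongrightarrow> 2 * pi * L) at_top"
  shows "I1 \<psi> \<beta> w q x1 x2 = L / q"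
proof -
  have eq: "exp (\<i> * (x1 - x2) * Complex u w) / (q + \<psi> (Complex u w)) *
     (exp (x2 * \<beta>) / (\<beta> - \<i> * Complex u w)
      + \<beta> * (exp (x2 * (1 + \<i> * Complex u w * (1 - 1 / \<beta>))) / ((\<beta> - \<i> * Complex u w) * (- \<i> * Complex u w)))
      - exp x2 / (- \<i> * Complex u w)) = 1 / q * (\<Phi> u * (exp (\<i> * complex_of_real (x1 - x2) * Complex u w) * recentred_transform \<beta> (\<i> * Complex u w) x2))" for u
    unfolding psi recentred_transform_def using q by (simp add: exp_of_real[symmetric])
  have "((\<lambda>R. 1 / complex_of_real q * (LINT u:{-R..R}|lborel. \<Phi> u * (exp (\<i> * complex_of_real (x1 - x2) * Complex u w) * recentred_transform \<beta> (\<i> * Complex u w) x2)))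
    \<longlongrightarrow> 1 / complex_of_real q * (2 * pi * L)) at_top"
    by (intro tendsto_mult tendsto_const lim)
  then have "line_integral w (\<lambda>\<xi>. exp (\<i> * (x1 - x2) * \<xi>) / (q + \<psi> \<xi>) *
     (exp (x2 * \<beta>) / (\<beta> - \<i> * \<xi>)
      + \<beta> * (exp (x2 * (1 + \<i> * \<xi> * (1 - 1 / \<beta>))) / ((\<beta> - \<i> * \<xi>) * (- \<i> * \<xi>)))
      - exp x2 / (- \<i> * \<xi>))) = 1 / complex_of_real q * (2 * pi * L)"
    unfolding line_integral_def eq set_integral_mult_right by (intro tendsto_Lim) auto
  then show ?thesis unfolding I1_def by (simp add: exp_of_real[symmetric])
qed

theorem proposition3p6:
  fixes M :: "'a measure" and X :: "real \<Rightarrow> 'a \<Rightarrow> real" and T :: "'a \<Rightarrow> real"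
    and \<psi> \<phi>pp \<phi>mm :: "complex \<Rightarrow> complex"
    and \<beta> q \<mu>m \<mu>p ap am Cp Cm \<nu>p \<nu>m x1 x2 w1 wm :: real
  assumes levy: "levy_process M X"
    and exponent: "characteristic_exponent M X \<psi>"
    and beta: "1 < \<beta>" and q: "0 < q"
    and exp_time: "independent_exponential_time M X q T"
    and mu: "\<mu>m < - \<beta>" "0 < \<mu>p"
    and moments: "\<And>\<gamma>. \<gamma> \<in> {\<mu>m..\<mu>p} \<Longrightarrow> integrable M (\<lambda>\<omega>. exp (- \<gamma> * X 1 \<omega>))"
    and positive: "\<And>\<gamma>. \<gamma> \<in> {\<mu>m..\<mu>p} \<Longrightarrow> 0 < q + Re (\<psi> (\<i> * complex_of_real \<gamma>))"
    and a_nonneg: "0 \<le> ap" "0 \<le> am"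
    and const_pos: "0 < \<nu>p" "0 < \<nu>m" "0 < Cp" "0 < Cm"
    and repr_plus: "\<And>\<xi>. \<mu>m \<le> Im \<xi> \<Longrightarrow> wh_plus M X T \<xi> = complex_of_real ap + \<phi>pp \<xi>"
    and repr_minus: "\<And>\<xi>. Im \<xi> \<le> \<mu>p \<Longrightarrow> wh_minus M X T \<xi> = complex_of_real am + \<phi>mm \<xi>"
    and bound_plus: "\<And>\<xi>. \<mu>m \<le> Im \<xi> \<Longrightarrow> norm (\<phi>pp \<xi>) \<le> Cp * (1 + norm \<xi>) powr (- \<nu>p)"
    and bound_minus: "\<And>\<xi>. Im \<xi> \<le> \<mu>p \<Longrightarrow> norm (\<phi>mm \<xi>) \<le> Cm * (1 + norm \<xi>) powr (- \<nu>m)"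
    and x: "x1 \<le> x2" "0 \<le> x2"
    and no_atom: "x1 = x2 \<Longrightarrow> 0 < x2 \<Longrightarrow> ap * am = 0"
    and w1: "0 < w1" "w1 < \<mu>p"
    and wm: "\<mu>m < wm" "wm < - \<beta>"
  shows "complex_of_real (laplace_value M X (exchange_payoff \<beta>) q x1 x2)
    = I1 \<psi> \<beta> w1 q x1 x2
      + 1 / complex_of_real q * (I2 am \<phi>pp \<beta> wm x1 x2 + I3 \<phi>pp \<phi>mm \<beta> w1 wm x1 x2)"
proof -
  interpret levy_process M X by (rule levy)
  let ?P = "exp_law q \<Otimes>\<^sub>M M"
  interpret P: prob_space ?P by (rule prob_space_randomized[OF q])
  note [measurable] = measurable_randomized[of q]
  have Zm[measurable]: "ZT \<in> borel_measurable ?P" unfolding ZT_def[abs_def] by measurable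
  have XSZ: "XT p = ST p + ZT p" for p by (simp add: ZT_def)
  have sp: "snd p \<in> space M" if "p \<in> space ?P" for p using that by (auto simp: space_pair_measure)
  have S0: "0 \<le> ST p" if "p \<in> space ?P" for p
  proof -
    have "X 0 (snd p) \<le> ST p"
      unfolding ST_def running_sup_def by (rule cSUP_upper) (use path_bounded(1)[OF sp[OF that]] in auto)
    then show ?thesis using start_zero[OF sp[OF that]] by simp
  qed
  have Z0: "ZT p \<le> 0" if "p \<in> space ?P" for p
  proof -
    have "XT p \<le> ST p"
      unfolding ST_def XT_def running_sup_def by (rule cSUP_upper) (use path_bounded(1)[OF sp[OF that]] in auto)
    then show ?thesis by (simp add: ZT_def)
  qed
  \<comment> \<open>Since \<open>\<mu>m < - \<beta> < 0 < \<mu>p\<close>, both lines of integration and the real line lie in the strip of the moment conditions.\<close>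
  have char: "integrable ?P (\<lambda>p. exp (- Im \<xi> * XT p))"
    "(LINT p|?P. exp (\<i> * \<xi> * complex_of_real (XT p))) = q / (q + \<psi> \<xi>)"
    if "\<mu>m \<le> Im \<xi>" "Im \<xi> \<le> \<mu>p" for \<xi>
    using randomized_characteristic_function[OF exponent q moments[of "Im \<xi>"] positive[of "Im \<xi>"]] that by auto
  interpret W: wiener_hopf_pair ?P ST ZT \<phi>pp \<phi>mm ap am Cp Cm \<nu>p \<nu>m w1 wm
  proof
    show "P.indep_var borel ST borel ZT" by (rule wiener_hopf(1)[OF q])
    show "0 \<le> ST p" "ZT p \<le> 0" if "p \<in> space ?P" for p using S0 Z0 that by auto
    show "integrable ?P (\<lambda>p. exp (- wm * (ST p + ZT p)))"
      using char(1)[of "Complex 0 wm"] mu wm beta unfolding XSZ by auto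
    show "integrable ?P (\<lambda>p. exp (- w1 * (ST p + ZT p)))"
      using char(1)[of "Complex 0 w1"] mu w1 beta unfolding XSZ by auto
    show "(LINT p|?P. exp (\<i> * \<xi> * complex_of_real (ST p))) = complex_of_real ap + \<phi>pp \<xi>" if "wm \<le> Im \<xi>" for \<xi>
      using repr_plus[of \<xi>] wh_eq_expectation(1)[OF exp_time q, of \<xi>] that wm by simp
    show "(LINT p|?P. exp (\<i> * \<xi> * complex_of_real (ZT p))) = complex_of_real am + \<phi>mm \<xi>" if "Im \<xi> \<le> w1" for \<xi>
      using repr_minus[of \<xi>] wh_eq_expectation(2)[OF exp_time q, of \<xi>] that w1 by simp
  qed (use w1 wm beta const_pos bound_plus bound_minus in auto)
  have nu: "0 < W.\<nu>" using const_pos by (simp add: W.\<nu>_def)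
  define \<Phi> where "\<Phi> u = complex_of_real q / (complex_of_real q + \<psi> (Complex u w1))" for u
  have Phi: "\<Phi> u = (LINT p|?P. exp (\<i> * Complex u w1 * complex_of_real (XT p)))" for u
    unfolding \<Phi>_def using char(2)[of "Complex u w1"] mu w1 beta by auto
  have "((\<lambda>R. LINT u:{-R..R}|lborel. \<Phi> u * (exp (\<i> * complex_of_real (x1 - x2) * Complex u w1) * recentred_transform \<beta> (\<i> * Complex u w1) x2))
    \<longlongrightarrow> 2 * pi * (LINT p|?P. exchange_payoff \<beta> (x1 + XT p) x2)) at_top"
  proof (rule fixed_barrier_inversion[OF P.prob_space_axioms _ beta w1(1) nu _ _ Phi _ x no_atom])
    show "integrable ?P (\<lambda>p. exp (- w1 * XT p))" using W.moment_w unfolding XSZ .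
    show "measure ?P {p\<in>space ?P. XT p = d} = (if d = 0 then ap * am else 0)" for d
      using W.atoms(3)[of d] unfolding XSZ .
    show "norm (\<Phi> u - complex_of_real (ap * am)) \<le> W.C_prod * (1 + \<bar>u\<bar>) powr (- W.\<nu>)" for u
      using W.product_decay[of w1 u] w1 wm beta unfolding Phi XSZ by simp
  qed measurable
  then have I1: "I1 \<psi> \<beta> w1 q x1 x2 = complex_of_real ((LINT p|?P. exchange_payoff \<beta> (x1 + XT p) x2) / q)"
    by (rule I1_eq[where \<Phi>=\<Phi>, OF beta \<Phi>_def q])
  let ?g = "\<lambda>p. indicator {x2 - x1..} (ST p) * lookback_gain \<beta> x2 (ST p - (x2 - x1)) (ZT p)"
  have gain: "complex_of_real (LINT p|?P. ?g p) = I2 am \<phi>pp \<beta> wm x1 x2 + I3 \<phi>pp \<phi>mm \<beta> w1 wm x1 x2"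
    by (rule W.lookback_gain_formula[OF beta wm(2) x])
  have split: "exchange_payoff \<beta> (x1 + XT p) (max x2 (x1 + ST p)) = exchange_payoff \<beta> (x1 + XT p) x2 + ?g p" for p
    unfolding XSZ by (rule payoff_split)
  have i1: "integrable ?P (\<lambda>p. exchange_payoff \<beta> (x1 + XT p) x2)"
    by (rule P.integrable_const_bound[where B="exp (\<beta> * x2)"])
      (use payoff_le[of \<beta> _ x2] payoff_bounds(1)[of \<beta> _ x2] beta in auto)
  have i2: "integrable ?P ?g" by (rule W.lookback_gain_inversion(1)[OF beta wm(2) x])
  have int: "integrable ?P (\<lambda>p. exchange_payoff \<beta> (x1 + XT p) (max x2 (x1 + ST p)))"
    unfolding split using i1 i2 by (rule Bochner_Integration.integrable_add)
  have "laplace_value M X (exchange_payoff \<beta>) q x1 x2 = (LINT p|?P. exchange_payoff \<beta> (x1 + XT p) (max x2 (x1 + ST p))) / q"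
    by (rule laplace_value_eq_expectation[OF q _ int]) (use int in auto)
  also have "\<dots> = ((LINT p|?P. exchange_payoff \<beta> (x1 + XT p) x2) + (LINT p|?P. ?g p)) / q"
    unfolding split Bochner_Integration.integral_add[OF i1 i2] ..
  finally show ?thesis unfolding I1 gain[symmetric] by (simp add: add_divide_distrib)
qed

end
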